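(* The isomorphism problem for automatic equivalence structures is $\Pi^0_1$-complete. That is, the set of pairs $(\mathcal P_1,\mathcal P_2)$ of automatic presentations such that $\mathcal S(\mathcal P_1)$ and $\mathcal S(\mathcal P_2)$ are equivalence structures and $\mathcal S(\mathcal P_1)\cong\mathcal S(\mathcal P_2)$ is $\Pi^0_1$-complete.
   Context: For words $w_1,\dots,w_n$ over an alphabet $\Sigma$, their convolution $w_1\otimes\cdots\otimes w_n$ is the word over $(\Sigma\cup\{\diamond\})^n$ ($\diamond\notin\Sigma$) of length $\max_i|w_i|$ whose $k$-th letter is $(\sigma_1,\dots,\sigma_n)$ with $\sigma_i$ the $k$-th letter of $w_i$ if $k\le|w_i|$ and $\sigma_i=\diamond$ otherwise. An $n$-ary relation on $\Sigma^*$ is FA recognizable if the set of convolutions of its tuples is regular. A structure is automatic if its domain is a regular subset of $\Sigma^*$ and each of its relations is FA recognizable; a tuple $\mathcal P$ of finite automata accepting the domain and the relations is an automatic presentation, and $\mathcal S(\mathcal P)$ denotes the structure it presents. An equivalence structure is a structure $(D;E)$ with $E$ an equivalence relation on $D$. For a class $\mathcal K$ of structures closed under isomorphism, the isomorphism problem for (automatic members of) $\mathcal K$ is the set of pairs $(\mathcal P_1,\mathcal P_2)$ of automatic presentations with $\mathcal S(\mathcal P_1)\cong\mathcal S(\mathcal P_2)\in\mathcal K$; $\Pi^0_n,\Sigma^0_n$ are the levels of the arithmetical hierarchy (via an effective encoding of presentations by natural numbers). *)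

theory Defs
  imports Main "HOL-Library.Nat_Bijection"
begin

datatype recf =
    Zero_f
  | Succ_f
  | Proj_f nat
  | Comp_f recf "recf list"
  | Prec_f recf recf
  | Mn_f recf

inductive recf_eval :: "recf \<Rightarrow> nat list \<Rightarrow> nat \<Rightarrow> bool" where
  ev_zero: "recf_eval Zero_f xs 0"
| ev_succ: "recf_eval Succ_f (x # xs) (Suc x)"
| ev_proj: "i < length xs \<Longrightarrow> recf_eval (Proj_f i) xs (xs ! i)"
| ev_comp: "length ys = length gs \<Longrightarrow> (\<forall>i < length gs. recf_eval (gs ! i) xs (ys ! i))
            \<Longrightarrow> recf_eval f ys z \<Longrightarrow> recf_eval (Comp_f f gs) xs z"
| ev_prec0: "recf_eval f xs y \<Longrightarrow> recf_eval (Prec_f f g) (0 # xs) y"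
| ev_precS: "recf_eval (Prec_f f g) (n # xs) y \<Longrightarrow> recf_eval g (n # y # xs) z
            \<Longrightarrow> recf_eval (Prec_f f g) (Suc n # xs) z"
| ev_mn: "recf_eval f (n # xs) 0 \<Longrightarrow> (\<forall>m < n. \<exists>y. recf_eval f (m # xs) (Suc y))
            \<Longrightarrow> recf_eval (Mn_f f) xs n"

definition computable :: "(nat \<Rightarrow> nat) \<Rightarrow> bool" where
  "computable h \<longleftrightarrow> (\<exists>f. \<forall>n. recf_eval f [n] (h n))"

definition Sigma01 :: "nat set \<Rightarrow> bool" where
  "Sigma01 A \<longleftrightarrow> (\<exists>f. \<forall>n. n \<in> A \<longleftrightarrow> (\<exists>y. recf_eval f [n] y))"

definition Pi01 :: "nat set \<Rightarrow> bool" where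
  "Pi01 A \<longleftrightarrow> Sigma01 (- A)"

definition many_one_reducible :: "nat set \<Rightarrow> nat set \<Rightarrow> bool" where
  "many_one_reducible B A \<longleftrightarrow> (\<exists>h. computable h \<and> (\<forall>n. n \<in> B \<longleftrightarrow> h n \<in> A))"

definition Pi01_complete :: "nat set \<Rightarrow> bool" where
  "Pi01_complete A \<longleftrightarrow> Pi01 A \<and> (\<forall>B. Pi01 B \<longrightarrow> many_one_reducible B A)"

text \<open>Nondeterministic finite automaton: initial states, final states, transitions (q, a, q').
  States are natural numbers; only finitely many occur.\<close>
datatype 'a nfa = NFA "nat list" "nat list" "(nat \<times> 'a \<times> nat) list"

fun nfa_reach :: "(nat \<times> 'a \<times> nat) list \<Rightarrow> nat set \<Rightarrow> 'a list \<Rightarrow> nat set" where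
  "nfa_reach tr S [] = S"
| "nfa_reach tr S (a # w) = nfa_reach tr {q'. \<exists>q \<in> S. (q, a, q') \<in> set tr} w"

fun nfa_accepts :: "'a nfa \<Rightarrow> 'a list \<Rightarrow> bool" where
  "nfa_accepts (NFA I F tr) w \<longleftrightarrow> nfa_reach tr (set I) w \<inter> set F \<noteq> {}"

text \<open>Convolution of two words; None plays the role of the padding symbol diamond.\<close>
definition conv2 :: "'a list \<Rightarrow> 'a list \<Rightarrow> ('a option \<times> 'a option) list" where
  "conv2 u v = map (\<lambda>k. (if k < length u then Some (u ! k) else None,
                          if k < length v then Some (v ! k) else None))
                   [0..<max (length u) (length v)]"

text \<open>An automatic presentation of a structure with one binary relation:
  alphabet {0..<k}, a domain automaton over it, and an automaton over the
  convolution alphabet for the binary relation.\<close>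
datatype pres = Pres nat "nat nfa" "(nat option \<times> nat option) nfa"

fun pres_dom :: "pres \<Rightarrow> nat list set" where
  "pres_dom (Pres k AD AE) = {w. set w \<subseteq> {..<k} \<and> nfa_accepts AD w}"

fun pres_rel :: "pres \<Rightarrow> (nat list \<times> nat list) set" where
  "pres_rel (Pres k AD AE) =
     {(u, v). u \<in> pres_dom (Pres k AD AE) \<and> v \<in> pres_dom (Pres k AD AE)
              \<and> nfa_accepts AE (conv2 u v)}"

definition is_equiv_structure :: "pres \<Rightarrow> bool" where
  "is_equiv_structure P \<longleftrightarrow> equiv (pres_dom P) (pres_rel P)"

definition pres_iso :: "pres \<Rightarrow> pres \<Rightarrow> bool" where
  "pres_iso P Q \<longleftrightarrow> (\<exists>f. bij_betw f (pres_dom P) (pres_dom Q) \<and>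
      (\<forall>u \<in> pres_dom P. \<forall>v \<in> pres_dom P. (u, v) \<in> pres_rel P \<longleftrightarrow> (f u, f v) \<in> pres_rel Q))"

section \<open>Effective numbering of presentations (surjective, via Cantor pairing)\<close>

fun dec_opt :: "nat \<Rightarrow> nat option" where
  "dec_opt 0 = None"
| "dec_opt (Suc j) = Some j"

definition dec_letter2 :: "nat \<Rightarrow> nat option \<times> nat option" where
  "dec_letter2 m = (case prod_decode m of (x, y) \<Rightarrow> (dec_opt x, dec_opt y))"

definition dec_nfa :: "(nat \<Rightarrow> 'a) \<Rightarrow> nat \<Rightarrow> 'a nfa" where
  "dec_nfa dl n = (case prod_decode n of (a, b) \<Rightarrow>
     (case prod_decode b of (c, d) \<Rightarrow>
        NFA (list_decode a) (list_decode c)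
          (map (\<lambda>m. case prod_decode m of (q, r) \<Rightarrow>
                      (case prod_decode r of (x, q') \<Rightarrow> (q, dl x, q')))
               (list_decode d))))"

definition dec_pres :: "nat \<Rightarrow> pres" where
  "dec_pres n = (case prod_decode n of (k, r) \<Rightarrow>
     (case prod_decode r of (a, b) \<Rightarrow> Pres k (dec_nfa id a) (dec_nfa dec_letter2 b)))"

definition equiv_iso_problem :: "nat set" where
  "equiv_iso_problem = {n. case prod_decode n of (a, b) \<Rightarrow>
      is_equiv_structure (dec_pres a) \<and> pres_iso (dec_pres a) (dec_pres b)}"

end

theory Submission
  imports Defs "HOL-Library.Countable_Set" "HOL-Library.FuncSet"
begin

text \<open>
  Two countable equivalence relations are isomorphic iff they have, for each cardinality, equally many classes
  of that cardinality.

  Upper bound: the shortest elements of the classes of a given size m in an automatic presentation form a set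
  that can be pumped.  A prefix x only matters through the states reached on x and through the numbers, truncated
  at m + 1, of words v of length at most that of x for which the two automata reach given sets of states on the
  convolution of x and v and on v.  So if no such element has its length in an explicit window beyond l, then none is
  longer than l, and all classes of size m have been seen.  This makes "the first structure has more
  classes of size m than the second" recursively enumerable.

  Lower bound: a partial recursive function is compiled into a nondeterministic register program.  A word over
  the edges of its control graph is executed blindly, while two numbers x and y accumulate squares and
  mixed terms so that x - y is the sum of the squares of all mismatches; thus x = y exactly for the halting runs.
  The number (x + y)^2 + x + 1 is a polynomial in the registers, hence a natural linear combination of finitely
  many functions of the store that are closed under all instructions.  Such linear systems count the runs of an
  automaton, which yields an automatic equivalence structure whose class sizes are these numbers.  It is compared
  with the one having only the sizes with x > y.
\<close>

section \<open>Computable functions\<close>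

text \<open>A priori, finiteness of the set of classes of size m is a Sigma_2 statement. The pumping
  window replaces it by a search for one length with a bounded check, which brings the complement of
  the problem down to Sigma_1. Shortest elements serve as representatives because their length is
  constant on a class, so finitely many classes bound all of them. Truncation at m + 1 loses
  nothing: a count that contributes to a class of size m is at most m. In the lower bound, sizes are
  numbers of words, so only sums of naturals are available: no subtraction, no division, and a
  failed test cannot discard a word. This is why x and y are kept apart, why programs test nothing
  but equality, whose error is a square, and why the pairing has natural coefficients. The input n
  enters as n copies of one letter that act first, so the linear system is the same for all n. A
  further letter without effect makes every occurring size occur infinitely often; then only the
  sets of sizes matter.\<close>

lemma recf_eval_deterministic: "recf_eval f xs y \<Longrightarrow> recf_eval f xs z \<Longrightarrow> y = z"
proof (induction arbitrary: z rule: recf_eval.induct)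
  case (ev_comp ys gs xs f w)
  from ev_comp.prems obtain ys' where ys': "length ys' = length gs"
    "\<forall>i<length gs. recf_eval (gs ! i) xs (ys' ! i)" "recf_eval f ys' z"
    by (cases rule: recf_eval.cases) auto
  have "ys = ys'"
    using ev_comp.IH(1) ys' ev_comp.hyps(1) by (auto intro!: nth_equalityI)
  with ys'(3) ev_comp.IH(2) show ?case by blast
next
  case (ev_precS f g n xs y w)
  from ev_precS.prems obtain y' where "recf_eval (Prec_f f g) (n # xs) y'" "recf_eval g (n # y' # xs) z"
    by (cases rule: recf_eval.cases) auto
  with ev_precS.IH show ?case by blast
next
  case (ev_mn f n xs)
  from ev_mn.prems have z: "recf_eval f (z # xs) 0" "\<forall>m<z. \<exists>y. recf_eval f (m # xs) (Suc y)"
    by (cases rule: recf_eval.cases; auto)+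
  have "\<not> z < n" using ev_mn.IH(2) z(1) by fastforce
  moreover have "\<not> n < z" using ev_mn.IH(1) z(2) by fastforce
  ultimately show ?case by simp
next
  case (ev_prec0 f xs y g)
  from ev_prec0.prems have "recf_eval f xs z" by (cases rule: recf_eval.cases) auto
  with ev_prec0.IH show ?case .
next
  case (ev_zero xs)
  then show ?case by (cases rule: recf_eval.cases) auto
next
  case (ev_succ x xs)
  then show ?case by (cases rule: recf_eval.cases) auto
next
  case (ev_proj i xs)
  from ev_proj.prems show ?case by (cases rule: recf_eval.cases) auto
qed

definition total_rec :: "nat \<Rightarrow> (nat list \<Rightarrow> nat) \<Rightarrow> bool" where
  "total_rec n F \<longleftrightarrow> (\<exists>f. \<forall>xs. length xs = n \<longrightarrow> recf_eval f xs (F xs))"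

lemma total_rec_zero: "total_rec n (\<lambda>_. 0)"
  unfolding total_rec_def by (blast intro: ev_zero)

lemma total_rec_proj: "i < n \<Longrightarrow> total_rec n (\<lambda>xs. xs ! i)"
  unfolding total_rec_def by (blast intro: ev_proj)

lemma total_rec_comp:
  assumes "total_rec (length Gs) F" "\<And>G. G \<in> set Gs \<Longrightarrow> total_rec n G"
  shows "total_rec n (\<lambda>xs. F (map (\<lambda>G. G xs) Gs))"
proof -
  obtain f where f: "\<And>xs. length xs = length Gs \<Longrightarrow> recf_eval f xs (F xs)"
    using assms(1) by (auto simp: total_rec_def)
  obtain g where g: "\<And>G xs. G \<in> set Gs \<Longrightarrow> length xs = n \<Longrightarrow> recf_eval (g G) xs (G xs)"
    using assms(2) unfolding total_rec_def by metis
  have "recf_eval (Comp_f f (map g Gs)) xs (F (map (\<lambda>G. G xs) Gs))" if "length xs = n" for xs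
    by (rule ev_comp[where ys = "map (\<lambda>G. G xs) Gs"]) (use that in \<open>auto intro!: f g\<close>)
  then show ?thesis unfolding total_rec_def by blast
qed

lemma total_rec_comp1:
  assumes "total_rec 1 (\<lambda>xs. f (xs ! 0))" "total_rec n G"
  shows "total_rec n (\<lambda>xs. f (G xs))"
  using total_rec_comp[of "[G]" "\<lambda>xs. f (xs ! 0)" n] assms by simp

text \<open>The arity \<open>Suc 1\<close> and the argument \<open>tl xs ! 0\<close> have the shape
  in which \<open>total_rec_prec\<close> delivers binary recursions, so these fit directly.\<close>

lemma total_rec_comp2:
  assumes "total_rec (Suc 1) (\<lambda>xs. f (xs ! 0) (tl xs ! 0))" "total_rec n G" "total_rec n H"
  shows "total_rec n (\<lambda>xs. f (G xs) (H xs))"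
  using total_rec_comp[of "[G, H]" "\<lambda>xs. f (xs ! 0) (tl xs ! 0)" n] assms by auto

lemma total_rec_Suc:
  assumes "total_rec n G" shows "total_rec n (\<lambda>xs. Suc (G xs))"
proof (rule total_rec_comp1[OF _ assms])
  have "recf_eval Succ_f xs (Suc (xs ! 0))" if "length xs = 1" for xs
    using that by (cases xs) (auto intro: ev_succ)
  then show "total_rec 1 (\<lambda>xs. Suc (xs ! 0))" unfolding total_rec_def by blast
qed

lemma total_rec_prec:
  assumes "total_rec n F" "total_rec (Suc (Suc n)) G"
  shows "total_rec (Suc n) (\<lambda>xs. rec_nat (F (tl xs)) (\<lambda>i r. G (i # r # tl xs)) (xs ! 0))"
proof -
  obtain f g where f: "\<And>xs. length xs = n \<Longrightarrow> recf_eval f xs (F xs)"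
    and g: "\<And>xs. length xs = Suc (Suc n) \<Longrightarrow> recf_eval g xs (G xs)"
    using assms by (auto simp: total_rec_def)
  have "recf_eval (Prec_f f g) (m # xs) (rec_nat (F xs) (\<lambda>i r. G (i # r # xs)) m)"
    if "length xs = n" for m xs
  proof (induction m)
    case 0
    show ?case using f[OF that] by (simp add: ev_prec0)
  next
    case (Suc m)
    show ?case by (simp, rule ev_precS[OF Suc g]) (simp add: that)
  qed
  then have "recf_eval (Prec_f f g) xs (rec_nat (F (tl xs)) (\<lambda>i r. G (i # r # tl xs)) (xs ! 0))"
    if "length xs = Suc n" for xs
    using that by (cases xs) auto
  then show ?thesis unfolding total_rec_def by blast
qed

lemma total_rec_least:
  assumes "total_rec (Suc n) F" "\<And>xs. length xs = n \<Longrightarrow> \<exists>i. F (i # xs) = 0"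
  shows "total_rec n (\<lambda>xs. LEAST i. F (i # xs) = 0)"
proof -
  obtain f where f: "\<And>xs. length xs = Suc n \<Longrightarrow> recf_eval f xs (F xs)"
    using assms(1) by (auto simp: total_rec_def)
  have "recf_eval (Mn_f f) xs (LEAST i. F (i # xs) = 0)" if xs: "length xs = n" for xs
  proof (rule ev_mn)
    have "F ((LEAST i. F (i # xs) = 0) # xs) = 0"
      using assms(2)[OF xs] by (rule LeastI_ex)
    then show "recf_eval f ((LEAST i. F (i # xs) = 0) # xs) 0"
      using f[of "(LEAST i. F (i # xs) = 0) # xs"] xs by simp
    show "\<forall>m<(LEAST i. F (i # xs) = 0). \<exists>y. recf_eval f (m # xs) (Suc y)"
    proof (intro allI impI)
      fix m assume "m < (LEAST i. F (i # xs) = 0)"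
      then have "F (m # xs) \<noteq> 0" by (rule not_less_Least)
      then obtain y where "F (m # xs) = Suc y" using not0_implies_Suc by blast
      then show "\<exists>y. recf_eval f (m # xs) (Suc y)" using f[of "m # xs"] xs by auto
    qed
  qed
  then show ?thesis unfolding total_rec_def by blast
qed

lemma computable_iff_total_rec: "computable h \<longleftrightarrow> total_rec 1 (\<lambda>xs. h (xs ! 0))"
proof -
  have "(\<forall>xs. length xs = 1 \<longrightarrow> recf_eval f xs (h (xs ! 0))) \<longleftrightarrow> (\<forall>n. recf_eval f [n] (h n))" for f
    by (auto simp: length_Suc_conv)
  then show ?thesis by (simp add: computable_def total_rec_def)
qed

lemma total_rec_add:
  assumes "total_rec n G" "total_rec n H" shows "total_rec n (\<lambda>xs. G xs + H xs)"
proof (rule total_rec_comp2[OF _ assms])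
  have "total_rec (Suc 1) (\<lambda>xs. rec_nat (tl xs ! 0) (\<lambda>i r. Suc ((i # r # tl xs) ! 1)) (xs ! 0))"
    by (intro total_rec_prec total_rec_Suc total_rec_proj) auto
  moreover have "rec_nat y (\<lambda>i r. Suc r) x = x + y" for x y by (induction x) auto
  ultimately show "total_rec (Suc 1) (\<lambda>xs. xs ! 0 + tl xs ! 0)" by simp
qed

lemma total_rec_mult:
  assumes "total_rec n G" "total_rec n H" shows "total_rec n (\<lambda>xs. G xs * H xs)"
proof (rule total_rec_comp2[OF _ assms])
  have "total_rec (Suc 1) (\<lambda>xs. rec_nat 0 (\<lambda>i r. (i # r # tl xs) ! 1 + (i # r # tl xs) ! 2) (xs ! 0))"
    by (intro total_rec_prec total_rec_add total_rec_proj total_rec_zero) auto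
  moreover have "rec_nat 0 (\<lambda>i r. r + y) x = x * y" for x y :: nat by (induction x) auto
  ultimately show "total_rec (Suc 1) (\<lambda>xs. xs ! 0 * tl xs ! 0)" by simp
qed

lemma total_rec_pred:
  assumes "total_rec n G" shows "total_rec n (\<lambda>xs. G xs - 1)"
proof (rule total_rec_comp1[OF _ assms])
  have "total_rec (Suc 0) (\<lambda>xs. rec_nat 0 (\<lambda>i r. (i # r # tl xs) ! 0) (xs ! 0))"
    by (intro total_rec_prec total_rec_proj total_rec_zero) auto
  moreover have "rec_nat 0 (\<lambda>i r. i) x = x - 1" for x :: nat by (cases x) auto
  ultimately show "total_rec 1 (\<lambda>xs. xs ! 0 - 1)" by simp
qed

lemma total_rec_diff:
  assumes "total_rec n G" "total_rec n H" shows "total_rec n (\<lambda>xs. G xs - H xs)"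
\<comment> \<open>Subtraction recurses on the subtrahend, which therefore has to come first.\<close>
proof (rule total_rec_comp2[where f = "\<lambda>x y. y - x", OF _ assms(2,1)])
  have "total_rec (Suc 1) (\<lambda>xs. rec_nat (tl xs ! 0) (\<lambda>i r. (i # r # tl xs) ! 1 - 1) (xs ! 0))"
    by (intro total_rec_prec total_rec_pred total_rec_proj) auto
  moreover have "rec_nat y (\<lambda>i r. r - 1) x = y - x" for x y :: nat by (induction x) auto
  ultimately show "total_rec (Suc 1) (\<lambda>xs. tl xs ! 0 - xs ! 0)" by simp
qed

lemma total_rec_triangle:
  assumes "total_rec n G" shows "total_rec n (\<lambda>xs. triangle (G xs))"
proof (rule total_rec_comp1[OF _ assms])
  have "total_rec (Suc 0) (\<lambda>xs. rec_nat 0 (\<lambda>i r. (i # r # tl xs) ! 1 + Suc ((i # r # tl xs) ! 0)) (xs ! 0))"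
    by (intro total_rec_prec total_rec_add total_rec_Suc total_rec_proj total_rec_zero) auto
  moreover have "rec_nat 0 (\<lambda>i r. r + Suc i) x = triangle x" for x :: nat by (induction x) auto
  ultimately show "total_rec 1 (\<lambda>xs. triangle (xs ! 0))" by simp
qed

lemma total_rec_prod_encode:
  assumes "total_rec n G" "total_rec n H" shows "total_rec n (\<lambda>xs. prod_encode (G xs, H xs))"
  unfolding prod_encode_def using assms by (auto intro!: total_rec_add total_rec_triangle)

section \<open>Cantor pairing and its inverse\<close>

definition pfst :: "nat \<Rightarrow> nat" where "pfst n = fst (prod_decode n)"
definition psnd :: "nat \<Rightarrow> nat" where "psnd n = snd (prod_decode n)"

lemma pfst_prod_encode [simp]: "pfst (prod_encode (a, b)) = a" by (simp add: pfst_def)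
lemma psnd_prod_encode [simp]: "psnd (prod_encode (a, b)) = b" by (simp add: psnd_def)
lemma prod_encode_pfst_psnd [simp]: "prod_encode (pfst n, psnd n) = n" by (simp add: pfst_def psnd_def)
lemma prod_decode_eq: "prod_decode n = (pfst n, psnd n)" by (simp add: pfst_def psnd_def)

lemma triangle_pfst_psnd: "triangle (pfst n + psnd n) + pfst n = n"
proof -
  have "prod_encode (pfst n, psnd n) = triangle (pfst n + psnd n) + pfst n"
    unfolding prod_encode_def by simp
  then show ?thesis by simp
qed

lemma triangle_mono: "i \<le> j \<Longrightarrow> triangle i \<le> triangle j"
  by (induction j) (auto simp: le_Suc_eq)

text \<open>\<open>prod_encode (a, b)\<close> is \<open>triangle (a + b) + a\<close> with a \<le> a
  + b, so the code lies below the next triangular number; the truncated difference phrases n <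
  \<open>triangle (Suc k)\<close> as a search for a zero.\<close>

lemma pfst_plus_psnd: "pfst n + psnd n = (LEAST k. Suc n - triangle (Suc k) = 0)"
proof (rule Least_equality[symmetric])
  have n: "n = triangle (pfst n + psnd n) + pfst n"
    by (simp add: triangle_pfst_psnd)
  then show "Suc n - triangle (Suc (pfst n + psnd n)) = 0" by simp
  fix k assume "Suc n - triangle (Suc k) = 0"
  then have "n < triangle (Suc k)" by simp
  show "pfst n + psnd n \<le> k"
  proof (rule ccontr)
    assume "\<not> ?thesis"
    then have "triangle (Suc k) \<le> triangle (pfst n + psnd n)" by (intro triangle_mono) auto
    with n \<open>n < triangle (Suc k)\<close> show False by linarith
  qed
qed

lemma pfst_eq: "pfst n = n - triangle (pfst n + psnd n)"
  using triangle_pfst_psnd[of n] by simp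

lemma computable_pfst_plus_psnd: "computable (\<lambda>n. pfst n + psnd n)"
proof -
  have "total_rec 1 (\<lambda>xs. LEAST i. Suc ((i # xs) ! 1) - triangle (Suc ((i # xs) ! 0)) = 0)"
  proof (rule total_rec_least)
    show "total_rec (Suc 1) (\<lambda>xs. Suc (xs ! 1) - triangle (Suc (xs ! 0)))"
      by (intro total_rec_diff total_rec_triangle total_rec_Suc total_rec_proj) auto
    show "\<exists>i. Suc ((i # xs) ! 1) - triangle (Suc ((i # xs) ! 0)) = 0" if "length xs = 1" for xs
      by (rule exI[of _ "xs ! 0"]) simp
  qed
  then show ?thesis
    unfolding computable_iff_total_rec pfst_plus_psnd by (simp only: One_nat_def nth_Cons_0 nth_Cons_Suc)
qed

lemma total_rec_unary: "computable f \<Longrightarrow> total_rec n G \<Longrightarrow> total_rec n (\<lambda>xs. f (G xs))"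
  unfolding computable_iff_total_rec by (rule total_rec_comp1)

lemma computable_comp: "computable f \<Longrightarrow> computable g \<Longrightarrow> computable (\<lambda>e. f (g e))"
  unfolding computable_iff_total_rec[of "\<lambda>e. f (g e)"] computable_iff_total_rec[of g]
  by (rule total_rec_unary)

lemma computable_id: "computable (\<lambda>e. e)"
  unfolding computable_iff_total_rec by (rule total_rec_proj) simp

lemma computable_Suc: "computable f \<Longrightarrow> computable (\<lambda>e. Suc (f e))"
  unfolding computable_iff_total_rec by (rule total_rec_Suc)

lemma computable_const: "computable (\<lambda>e. c)"
  by (induction c) (auto simp: computable_Suc computable_iff_total_rec[of "\<lambda>_. 0"] total_rec_zero)

lemma computable_add: "computable f \<Longrightarrow> computable g \<Longrightarrow> computable (\<lambda>e. f e + g e)"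
  unfolding computable_iff_total_rec by (rule total_rec_add)

lemma computable_mult: "computable f \<Longrightarrow> computable g \<Longrightarrow> computable (\<lambda>e. f e * g e)"
  unfolding computable_iff_total_rec by (rule total_rec_mult)

lemma computable_diff: "computable f \<Longrightarrow> computable g \<Longrightarrow> computable (\<lambda>e. f e - g e)"
  unfolding computable_iff_total_rec by (rule total_rec_diff)

lemma computable_prod_encode:
  "computable f \<Longrightarrow> computable g \<Longrightarrow> computable (\<lambda>e. prod_encode (f e, g e))"
  unfolding computable_iff_total_rec by (rule total_rec_prod_encode)

lemma computable_pfst: assumes "computable f" shows "computable (\<lambda>e. pfst (f e))"
proof -
  have "total_rec 1 (\<lambda>xs. xs ! 0 - triangle (pfst (xs ! 0) + psnd (xs ! 0)))"
    by (intro total_rec_diff total_rec_triangle total_rec_proj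
          computable_pfst_plus_psnd[unfolded computable_iff_total_rec]) auto
  then have "computable pfst"
    by (simp add: computable_iff_total_rec pfst_eq[symmetric])
  from this assms show ?thesis by (rule computable_comp)
qed

lemma computable_psnd: assumes "computable f" shows "computable (\<lambda>e. psnd (f e))"
proof -
  have "computable (\<lambda>e. (pfst e + psnd e) - pfst e)"
    by (intro computable_diff computable_pfst computable_id computable_pfst_plus_psnd)
  then have "computable psnd" by simp
  from this assms show ?thesis by (rule computable_comp)
qed

text \<open>Parameter, counter and previous value travel packed in one pair code, so that later
  computability arguments concern unary functions only.\<close>

lemma computable_rec_nat:
  assumes "computable a" "computable (\<lambda>p. b (pfst p) (pfst (psnd p)) (psnd (psnd p)))" "computable n"
  shows "computable (\<lambda>e. rec_nat (a e) (\<lambda>i r. b e i r) (n e))"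
proof -
  define B where "B = (\<lambda>p. b (pfst p) (pfst (psnd p)) (psnd (psnd p)))"
  have "total_rec (Suc 1) (\<lambda>xs. rec_nat (a (tl xs ! 0))
      (\<lambda>i r. B (prod_encode ((i # r # tl xs) ! 2, prod_encode ((i # r # tl xs) ! 0, (i # r # tl xs) ! 1)))) (xs ! 0))"
    by (intro total_rec_prec[where F = "\<lambda>ys. a (ys ! 0)" and
            G = "\<lambda>ys. B (prod_encode (ys ! 2, prod_encode (ys ! 0, ys ! 1)))"]
          total_rec_unary[of B] total_rec_prod_encode total_rec_proj
          assms(1)[unfolded computable_iff_total_rec] assms(2)[folded B_def]) auto
  then have "total_rec (Suc 1) (\<lambda>xs. rec_nat (a (tl xs ! 0))
      (\<lambda>i r. B (prod_encode (tl xs ! 0, prod_encode (i, r)))) (xs ! 0))"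
    by simp
  from total_rec_comp2[OF this assms(3)[unfolded computable_iff_total_rec] total_rec_proj[of 0]]
  show ?thesis by (simp add: computable_iff_total_rec B_def)
qed

section \<open>Decidable predicates, bounded quantifiers and counting\<close>

definition decidable :: "(nat \<Rightarrow> bool) \<Rightarrow> bool" where
  "decidable P \<longleftrightarrow> computable (\<lambda>e. of_bool (P e))"

lemma decidable_not: assumes "decidable P" shows "decidable (\<lambda>e. \<not> P e)"
proof -
  have "computable (\<lambda>e. 1 - of_bool (P e))"
    using assms unfolding decidable_def by (intro computable_diff computable_const)
  moreover have "(\<lambda>e. 1 - of_bool (P e) :: nat) = (\<lambda>e. of_bool (\<not> P e))" by auto
  ultimately show ?thesis by (simp only: decidable_def)
qed

lemma decidable_conj: assumes "decidable P" "decidable Q" shows "decidable (\<lambda>e. P e \<and> Q e)"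
proof -
  have "computable (\<lambda>e. of_bool (P e) * of_bool (Q e))"
    using assms unfolding decidable_def by (intro computable_mult)
  moreover have "(\<lambda>e. of_bool (P e) * of_bool (Q e) :: nat) = (\<lambda>e. of_bool (P e \<and> Q e))" by auto
  ultimately show ?thesis by (simp only: decidable_def)
qed

lemma decidable_disj:
  assumes "decidable P" "decidable Q" shows "decidable (\<lambda>e. P e \<or> Q e)"
proof -
  have "decidable (\<lambda>e. \<not> (\<not> P e \<and> \<not> Q e))"
    by (intro decidable_not decidable_conj assms)
  then show ?thesis by (simp only: de_Morgan_conj not_not)
qed

lemma decidable_imp:
  assumes "decidable P" "decidable Q" shows "decidable (\<lambda>e. P e \<longrightarrow> Q e)"
  unfolding imp_conv_disj by (intro decidable_not decidable_disj assms)

lemma decidable_less: assumes "computable f" "computable g" shows "decidable (\<lambda>e. f e < g e)"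
proof -
  have "computable (\<lambda>e. 1 - (1 - (g e - f e)))"
    using assms by (intro computable_diff computable_const)
  moreover have "(\<lambda>e. 1 - (1 - (g e - f e))) = (\<lambda>e. of_bool (f e < g e))" by auto
  ultimately show ?thesis by (simp only: decidable_def)
qed

lemma decidable_le:
  assumes "computable f" "computable g" shows "decidable (\<lambda>e. f e \<le> g e)"
  unfolding not_less[symmetric] by (intro decidable_not decidable_less assms)

lemma decidable_eq:
  assumes "computable f" "computable g" shows "decidable (\<lambda>e. f e = (g e :: nat))"
  unfolding eq_iff by (intro decidable_conj decidable_le assms)

lemma computable_if:
  assumes "decidable P" "computable f" "computable g" shows "computable (\<lambda>e. if P e then f e else g e)"
proof -
  have "computable (\<lambda>e. of_bool (P e) * f e + (1 - of_bool (P e)) * g e)"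
    using assms unfolding decidable_def
    by (intro computable_add computable_mult computable_diff computable_const)
  moreover have "(\<lambda>e. of_bool (P e) * f e + (1 - of_bool (P e)) * g e) = (\<lambda>e. if P e then f e else g e)"
    by auto
  ultimately show ?thesis by simp
qed

text \<open>Source of both bounded quantifiers and bounded counting: a sum of truth values is a
  cardinality, and it is positive iff a witness exists.\<close>

lemma computable_sum:
  assumes "computable (\<lambda>p. f (pfst p) (psnd p))" "computable b"
  shows "computable (\<lambda>e. \<Sum>i<b e. f e i)"
proof -
  have f: "computable (\<lambda>p. f (pfst p) (pfst (psnd p)))"
    using computable_comp[OF assms(1), of "\<lambda>p. prod_encode (pfst p, pfst (psnd p))"]
    by (simp add: computable_prod_encode computable_pfst computable_psnd computable_id)
  have "computable (\<lambda>e. rec_nat 0 (\<lambda>i r. f e i + r) (b e))"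
    by (intro computable_rec_nat computable_const computable_add assms(2) f computable_psnd computable_id)
  moreover have "rec_nat 0 (\<lambda>i r. f e i + r) n = (\<Sum>i<n. f e i)" for e n by (induction n) auto
  ultimately show ?thesis by simp
qed

lemma sum_of_bool_eq_card: "(\<Sum>i<n::nat. of_bool (P i)) = card {i. i < n \<and> P i}"
proof (induction n)
  case (Suc n)
  have "{i. i < Suc n \<and> P i} = (if P n then insert n {i. i < n \<and> P i} else {i. i < n \<and> P i})"
    by (auto simp: less_Suc_eq)
  then show ?case using Suc by simp
qed simp

lemma decidable_bex:
  assumes "decidable (\<lambda>p. P (pfst p) (psnd p))" "computable b"
  shows "decidable (\<lambda>e. \<exists>i<b e. P e i)"
proof -
  have "decidable (\<lambda>e. (0::nat) < (\<Sum>i<b e. of_bool (P e i)))"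
    by (intro decidable_less computable_const computable_sum assms[unfolded decidable_def])
  moreover have "0 < (\<Sum>i<n. of_bool (P e i)::nat) \<longleftrightarrow> (\<exists>i<n. P e i)" for e n
    by (simp add: sum_of_bool_eq_card card_gt_0_iff)
  ultimately show ?thesis by simp
qed

lemma decidable_ball:
  assumes "decidable (\<lambda>p. P (pfst p) (psnd p))" "computable b"
  shows "decidable (\<lambda>e. \<forall>i<b e. P e i)"
proof -
  have "decidable (\<lambda>e. \<not> (\<exists>i<b e. \<not> P e i))"
    by (intro decidable_not decidable_bex assms)
  then show ?thesis by simp
qed

lemma computable_card:
  assumes "decidable (\<lambda>p. P (pfst p) (psnd p))" "computable b"
  shows "computable (\<lambda>e. card {i. i < b e \<and> P e i})"
proof -
  have "computable (\<lambda>e. \<Sum>i<b e. of_bool (P e i))"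
    by (intro computable_sum assms[unfolded decidable_def])
  then show ?thesis by (simp add: sum_of_bool_eq_card)
qed

lemma computable_power:
  assumes "computable f" "computable g" shows "computable (\<lambda>e. f e ^ g e)"
proof -
  have "computable (\<lambda>e. rec_nat 1 (\<lambda>i r. f e * r) (g e))"
    by (intro computable_rec_nat computable_mult assms(2) computable_comp[OF assms(1)]
         computable_const[of 1] computable_pfst computable_psnd computable_id)
  moreover have "rec_nat 1 (\<lambda>i r. f e * r) n = f e ^ n" for e n by (induction n) auto
  ultimately show ?thesis by simp
qed

text \<open>Minimization searches for a zero, so the truth value of P is complemented; the search
  then halts exactly for those n that have a witness.\<close>

lemma Sigma01_exists:
  assumes "decidable (\<lambda>p. P (pfst p) (psnd p))"
  shows "Sigma01 {n. \<exists>i. P n i}"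
proof -
  define Q where "Q = (\<lambda>p. 1 - of_bool (P (pfst p) (psnd p)) :: nat)"
  have "computable Q"
    using assms unfolding Q_def decidable_def by (intro computable_diff computable_const)
  then have "total_rec 2 (\<lambda>xs. Q (prod_encode (xs ! 1, xs ! 0)))"
    by (intro total_rec_unary[of Q] total_rec_prod_encode total_rec_proj) auto
  then obtain f where f: "\<And>xs. length xs = 2 \<Longrightarrow> recf_eval f xs (Q (prod_encode (xs ! 1, xs ! 0)))"
    by (auto simp: total_rec_def)
  have f: "recf_eval f [i, n] (1 - of_bool (P n i))" for i n
    using f[of "[i, n]"] by (simp add: Q_def)
  have "(\<exists>i. P n i) \<longleftrightarrow> (\<exists>y. recf_eval (Mn_f f) [n] y)" for n
  proof
    assume ex: "\<exists>i. P n i"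
    have "recf_eval (Mn_f f) [n] (LEAST i. P n i)"
    proof (rule ev_mn)
      show "recf_eval f [LEAST i. P n i, n] 0" using f[of "LEAST i. P n i" n] LeastI_ex[OF ex] by simp
      show "\<forall>m<(LEAST i. P n i). \<exists>y. recf_eval f [m, n] (Suc y)"
      proof (intro allI impI)
        fix m assume "m < (LEAST i. P n i)"
        then have "\<not> P n m" by (rule not_less_Least)
        then show "\<exists>y. recf_eval f [m, n] (Suc y)" using f[of m n] by auto
      qed
    qed
    then show "\<exists>y. recf_eval (Mn_f f) [n] y" ..
  next
    assume "\<exists>y. recf_eval (Mn_f f) [n] y"
    then obtain y where "recf_eval (Mn_f f) [n] y" ..
    then have "recf_eval f [y, n] 0" by (cases rule: recf_eval.cases) auto
    \<comment> \<open>Evaluation is a relation; determinism identifies the value 0 met by the search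
      with the computed truth value.\<close>
    from recf_eval_deterministic[OF this f] have "(0::nat) = 1 - of_bool (P n y)" .
    then show "\<exists>i. P n i" by (cases "P n y") auto
  qed
  then show ?thesis unfolding Sigma01_def by auto
qed

section \<open>Isomorphism of countable equivalence relations\<close>

text \<open>\<open>card\<close> is 0 for infinite sets as for the empty set, so finiteness has to be
  compared separately.\<close>

lemma countable_bij_betw_iff:
  assumes "countable X" "countable Y"
  shows "(\<exists>g. bij_betw g X Y) \<longleftrightarrow> (finite X \<longleftrightarrow> finite Y) \<and> card X = card Y"
proof
  assume "\<exists>g. bij_betw g X Y"
  then show "(finite X \<longleftrightarrow> finite Y) \<and> card X = card Y"
    using bij_betw_finite bij_betw_same_card by blast
next
  assume eq: "(finite X \<longleftrightarrow> finite Y) \<and> card X = card Y"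
  show "\<exists>g. bij_betw g X Y"
  proof (cases "finite X")
    case True
    with eq show ?thesis by (intro finite_same_card_bij) auto
  next
    case False
    then have "bij_betw (to_nat_on X) X UNIV" "bij_betw (to_nat_on Y) Y UNIV"
      using assms eq by (auto intro: to_nat_on_infinite)
    then show ?thesis using bij_betw_trans bij_betw_inv_into by blast
  qed
qed

text \<open>Equivalence classes are nonempty, so index 0 collects exactly the infinite ones. In a
  countable structure the index thus determines the class up to bijection.\<close>

definition classes_of_card :: "'a set \<Rightarrow> ('a \<times> 'a) set \<Rightarrow> nat \<Rightarrow> 'a set set" where
  "classes_of_card A r k = {C \<in> A // r. card C = k}"

lemma countable_classes_of_card: "countable A \<Longrightarrow> countable (classes_of_card A r k)"
  unfolding classes_of_card_def quotient_def
  by (rule countable_subset[of _ "(\<lambda>x. r `` {x}) ` A"]) auto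

lemma bij_betw_classes_of_card:
  assumes "equiv A r" "equiv B s" and f: "bij_betw f A B"
    and pres: "\<forall>u\<in>A. \<forall>v\<in>A. (u, v) \<in> r \<longleftrightarrow> (f u, f v) \<in> s"
  shows "bij_betw ((`) f) (classes_of_card A r k) (classes_of_card B s k)"
proof -
  have rA: "r \<subseteq> A \<times> A" and sB: "s \<subseteq> B \<times> B" using assms(1,2) by (auto simp: equiv_def refl_on_def)
  have sub: "C \<subseteq> A" if "C \<in> A // r" for C using that rA by (auto simp: quotient_def)
  have img: "f ` (r `` {u}) = s `` {f u}" if "u \<in> A" for u
  proof
    show "f ` (r `` {u}) \<subseteq> s `` {f u}" using pres that rA by auto
    show "s `` {f u} \<subseteq> f ` (r `` {u})"
    proof
      fix y assume "y \<in> s `` {f u}"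
      then have y: "(f u, y) \<in> s" by simp
      then have "y \<in> B" using sB by auto
      then obtain v where v: "v \<in> A" "y = f v" using f by (auto simp: bij_betw_def)
      with y pres that show "y \<in> f ` (r `` {u})" by auto
    qed
  qed
  have card: "card (f ` C) = card C" if "C \<in> A // r" for C
    using sub[OF that] f by (intro card_image) (auto simp: bij_betw_def intro: inj_on_subset)
  show ?thesis
  proof (rule bij_betw_imageI)
    show "inj_on ((`) f) (classes_of_card A r k)"
    proof (rule inj_onI)
      fix C D assume "C \<in> classes_of_card A r k" "D \<in> classes_of_card A r k" and eq: "f ` C = f ` D"
      then have "C \<subseteq> A" "D \<subseteq> A" by (auto simp: classes_of_card_def sub)
      with eq f show "C = D" by (auto simp: bij_betw_def inj_on_image_eq_iff)
    qed
    show "(`) f ` classes_of_card A r k = classes_of_card B s k"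
    proof
      show "(`) f ` classes_of_card A r k \<subseteq> classes_of_card B s k"
      proof
        fix D assume "D \<in> (`) f ` classes_of_card A r k"
        then obtain C where C: "C \<in> A // r" "card C = k" "D = f ` C" by (auto simp: classes_of_card_def)
        then obtain u where u: "u \<in> A" "C = r `` {u}" by (auto elim: quotientE)
        then have "f u \<in> B" using f by (auto simp: bij_betw_def)
        with C u img show "D \<in> classes_of_card B s k"
          using card[OF C(1)] by (simp add: classes_of_card_def quotientI)
      qed
      show "classes_of_card B s k \<subseteq> (`) f ` classes_of_card A r k"
      proof
        fix D assume "D \<in> classes_of_card B s k"
        then obtain y where y: "y \<in> B" "D = s `` {y}" "card D = k"
          by (auto simp: classes_of_card_def elim: quotientE)
        then obtain u where u: "u \<in> A" "y = f u" using f by (auto simp: bij_betw_def)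
        have "D = f ` (r `` {u})" using img u y by simp
        moreover have "r `` {u} \<in> classes_of_card A r k"
          using card[OF quotientI[OF u(1), of r]] img[OF u(1)] y u by (simp add: classes_of_card_def quotientI)
        ultimately show "D \<in> (`) f ` classes_of_card A r k" by blast
      qed
    qed
  qed
qed

lemma equiv_class_of_mem_quotient:
  assumes "equiv A r" "C \<in> A // r" "u \<in> C" shows "r `` {u} = C"
proof -
  obtain y where y: "C = r `` {y}" using assms(2) by (auto elim: quotientE)
  with assms(3) have "(y, u) \<in> r" by simp
  from equiv_class_eq[OF assms(1) this] y show ?thesis by simp
qed

text \<open>A bijection between the quotients that preserves cardinality is refined by a bijection
  inside each class.\<close>

lemma equiv_iso_of_bij_classes:
  assumes A: "equiv A r" "countable A" and B: "equiv B s" "countable B"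
    and g: "\<And>k. bij_betw (g k) (classes_of_card A r k) (classes_of_card B s k)"
  shows "\<exists>f. bij_betw f A B \<and> (\<forall>u\<in>A. \<forall>v\<in>A. (u, v) \<in> r \<longleftrightarrow> (f u, f v) \<in> s)"
proof -
  have rA: "r \<subseteq> A \<times> A" and sB: "s \<subseteq> B \<times> B" using assms by (auto simp: equiv_def refl_on_def)
  have subA: "C \<subseteq> A" if "C \<in> A // r" for C using that rA by (auto simp: quotient_def)
  have subB: "D \<subseteq> B" if "D \<in> B // s" for D using that sB by (auto simp: quotient_def)
  \<comment> \<open>The family \<open>g\<close> glues to one map of the quotients: a class is sent
    by the bijection for its own cardinality.\<close>
  define G where "G C = g (card C) C" for C
  have G: "G C \<in> B // s \<and> card (G C) = card C" if "C \<in> A // r" for C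
    using bij_betwE[OF g[of "card C"]] that by (auto simp: G_def classes_of_card_def)
  have G_inj: "C = D" if "C \<in> A // r" "D \<in> A // r" "G C = G D" for C D
  proof -
    have "card C = card D" using G that by metis
    then show ?thesis
      using that g[of "card C"] by (auto simp: bij_betw_def inj_on_def G_def classes_of_card_def)
  qed
  have G_surj: "\<exists>C \<in> A // r. G C = D" if "D \<in> B // s" for D
  proof -
    have "D \<in> g (card D) ` classes_of_card A r (card D)"
      using g[of "card D"] that by (auto simp: bij_betw_def classes_of_card_def)
    then obtain C where C: "C \<in> classes_of_card A r (card D)" and D: "D = g (card D) C" by (rule imageE)
    from C have "C \<in> A // r" "card C = card D" by (simp_all add: classes_of_card_def)
    then have "G C = D" using D by (simp only: G_def)
    with \<open>C \<in> A // r\<close> show ?thesis by blast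
  qed
  have "\<exists>h. bij_betw h C (G C)" if C: "C \<in> A // r" for C
  proof -
    \<comment> \<open>A nonempty class with \<open>card\<close> 0 is infinite, so equal
      \<open>card\<close> yields equal finiteness.\<close>
    have "C \<noteq> {}" using in_quotient_imp_non_empty[OF A(1) C] .
    moreover have "G C \<noteq> {}" using in_quotient_imp_non_empty[OF B(1)] G[OF C] by blast
    ultimately have "finite C \<longleftrightarrow> finite (G C)" using G[OF C] by (metis card_eq_0_iff)
    moreover have "countable C" "countable (G C)"
      using countable_subset[OF subA[OF C] A(2)] countable_subset[OF subB B(2)] G[OF C] by simp_all
    ultimately show ?thesis using G[OF C] by (simp add: countable_bij_betw_iff)
  qed
  then obtain h where h: "\<And>C. C \<in> A // r \<Longrightarrow> bij_betw (h C) C (G C)" by metis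
  define f where "f u = h (r `` {u}) u" for u
  have fG: "f u \<in> G (r `` {u})" if "u \<in> A" for u
    using bij_betwE[OF h[OF quotientI[OF that]]] equiv_class_self[OF A(1) that] by (simp add: f_def)
  have f_eq: "s `` {f u} = G (r `` {u})" if "u \<in> A" for u
    using equiv_class_of_mem_quotient[OF B(1) _ fG[OF that]] G[OF quotientI[OF that, of r]] by blast
  have fB: "f u \<in> B" if "u \<in> A" for u
    using fG[OF that] G[OF quotientI[OF that, of r]] subB[of "G (r `` {u})"] by blast
  have pres: "(u, v) \<in> r \<longleftrightarrow> (f u, f v) \<in> s" if "u \<in> A" "v \<in> A" for u v
  proof -
    have "(f u, f v) \<in> s \<longleftrightarrow> s `` {f u} = s `` {f v}"
      using eq_equiv_class_iff[OF B(1) fB[OF that(1)] fB[OF that(2)]] by simp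
    also have "\<dots> \<longleftrightarrow> r `` {u} = r `` {v}"
      using f_eq[OF that(1)] f_eq[OF that(2)] G_inj[OF quotientI[OF that(1)] quotientI[OF that(2)]] by auto
    also have "\<dots> \<longleftrightarrow> (u, v) \<in> r" using eq_equiv_class_iff[OF A(1) that] by simp
    finally show ?thesis by simp
  qed
  have "bij_betw f A B"
  proof (rule bij_betw_imageI)
    show "inj_on f A"
    proof (rule inj_onI)
      fix u v assume uv: "u \<in> A" "v \<in> A" and eq: "f u = f v"
      then have "G (r `` {u}) = G (r `` {v})" using f_eq[OF uv(1)] f_eq[OF uv(2)] by simp
      then have same: "r `` {u} = r `` {v}"
        using G_inj[OF quotientI[OF uv(1)] quotientI[OF uv(2)]] by blast
      have "inj_on (h (r `` {u})) (r `` {u})" using h[OF quotientI[OF uv(1)]] by (simp add: bij_betw_def)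
      moreover have "u \<in> r `` {u}" "v \<in> r `` {u}" using equiv_class_self[OF A(1)] uv same by auto
      ultimately show "u = v" using eq same by (auto simp: f_def inj_on_def)
    qed
    show "f ` A = B"
    proof
      show "f ` A \<subseteq> B" using fB by blast
      show "B \<subseteq> f ` A"
      proof
        fix y assume y: "y \<in> B"
        obtain C where C: "C \<in> A // r" "G C = s `` {y}" using G_surj[OF quotientI[OF y]] by blast
        then have "y \<in> G C" using equiv_class_self[OF B(1) y] by simp
        then have "y \<in> h C ` C" using bij_betw_imp_surj_on[OF h[OF C(1)]] by simp
        then obtain u where u: "u \<in> C" "h C u = y" by blast
        have "u \<in> A" using u subA C by blast
        have "r `` {u} = C" by (rule equiv_class_of_mem_quotient[OF A(1) C(1) u(1)])
        then have "f u = y" using u by (simp add: f_def)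
        then show "y \<in> f ` A" using \<open>u \<in> A\<close> by blast
      qed
    qed
  qed
  with pres show ?thesis by blast
qed

theorem equiv_iso_iff_classes:
  assumes "equiv A r" "countable A" "equiv B s" "countable B"
  shows "(\<exists>f. bij_betw f A B \<and> (\<forall>u\<in>A. \<forall>v\<in>A. (u, v) \<in> r \<longleftrightarrow> (f u, f v) \<in> s)) \<longleftrightarrow>
    (\<forall>k. (finite (classes_of_card A r k) \<longleftrightarrow> finite (classes_of_card B s k)) \<and>
         card (classes_of_card A r k) = card (classes_of_card B s k))" (is "?L \<longleftrightarrow> ?R")
proof
  assume ?L
  then have "\<exists>g. bij_betw g (classes_of_card A r k) (classes_of_card B s k)" for k
    using bij_betw_classes_of_card[OF assms(1,3)] by blast
  then show ?R using assms by (simp add: countable_bij_betw_iff countable_classes_of_card)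
next
  assume ?R
  then have "\<exists>g. bij_betw g (classes_of_card A r k) (classes_of_card B s k)" for k
    using assms by (simp add: countable_bij_betw_iff countable_classes_of_card)
  then obtain g where "\<And>k. bij_betw (g k) (classes_of_card A r k) (classes_of_card B s k)" by metis
  then show ?L using equiv_iso_of_bij_classes[OF assms] by blast
qed

section \<open>Pumping in automatic presentations\<close>

text \<open>Pigeonhole: M + 1 positions, at most M types.\<close>

lemma equal_types_in_window:
  fixes ty :: "nat \<Rightarrow> 'b"
  assumes "finite T" "card T \<le> M" "\<And>i. a \<le> i \<Longrightarrow> i \<le> a + M \<Longrightarrow> ty i \<in> T"
  obtains i j where "a \<le> i" "i < j" "j \<le> a + M" "ty i = ty j"
proof -
  have "\<not> inj_on ty {a..a + M}"
  proof
    assume "inj_on ty {a..a + M}"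
    then have "card {a..a + M} \<le> card T"
      by (rule card_inj_on_le) (use assms in auto)
    with assms(2) show False by simp
  qed
  then obtain i j where "i \<in> {a..a + M}" "j \<in> {a..a + M}" "i \<noteq> j" "ty i = ty j"
    by (auto simp: inj_on_def)
  then show ?thesis using that[of i j] that[of j i] by (cases "i < j") auto
qed

text \<open>If a shortest word longer than L exceeded L + M, two of its last M + 1 prefixes would
  have equal type. Cutting out the part between them, at most M letters, would leave a shorter word
  that is still longer than L.\<close>

lemma pumping_down:
  assumes pump: "\<And>w i j. w \<in> A \<Longrightarrow> l \<le> i \<Longrightarrow> i \<le> length w \<Longrightarrow> l \<le> j \<Longrightarrow> j \<le> length w \<Longrightarrow>
      ty (take i w) = ty (take j w) \<Longrightarrow> take i w @ drop j w \<in> A"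
    and fin: "\<And>w i. w \<in> A \<Longrightarrow> l \<le> i \<Longrightarrow> i \<le> length w \<Longrightarrow> ty (take i w) \<in> T"
    and T: "finite T" "card T \<le> M"
    and w: "w \<in> A" "L < length w" and "l \<le> L"
  shows "\<exists>w'\<in>A. L < length w' \<and> length w' \<le> L + M"
proof -
  define w' where "w' = arg_min length (\<lambda>w. w \<in> A \<and> L < length w)"
  have w': "w' \<in> A" "L < length w'" and min: "\<And>v. v \<in> A \<Longrightarrow> L < length v \<Longrightarrow> length w' \<le> length v"
    using arg_min_nat_lemma[of "\<lambda>w. w \<in> A \<and> L < length w" w length] w by (auto simp: w'_def)
  have "length w' \<le> L + M"
  proof (rule ccontr)
    assume long: "\<not> ?thesis"
    define a where "a = length w' - M"
    have a: "l \<le> a" "a + M = length w'" using long \<open>l \<le> L\<close> by (auto simp: a_def)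
    obtain i j where ij: "a \<le> i" "i < j" "j \<le> a + M" "ty (take i w') = ty (take j w')"
      by (rule equal_types_in_window[where ty = "\<lambda>i. ty (take i w')" and a = a, OF T])
        (use fin[OF w'(1)] a in auto)
    have "take i w' @ drop j w' \<in> A" using ij a by (intro pump w') auto
    moreover have "L < length (take i w' @ drop j w')" using ij a long by (auto simp: min_def)
    ultimately have "length w' \<le> length (take i w' @ drop j w')" by (rule min)
    then show False using ij a by (auto simp: min_def)
  qed
  with w' show ?thesis by blast
qed

text \<open>The exchange of prefixes in \<open>pump\<close> puts no order on i and j, so it can also
  repeat a segment; a longest word of a finite A would be lengthened.\<close>

lemma pumping_up:
  assumes pump: "\<And>w i j. w \<in> A \<Longrightarrow> l \<le> i \<Longrightarrow> i \<le> length w \<Longrightarrow> l \<le> j \<Longrightarrow> j \<le> length w \<Longrightarrow>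
      ty (take i w) = ty (take j w) \<Longrightarrow> take i w @ drop j w \<in> A"
    and fin: "\<And>w i. w \<in> A \<Longrightarrow> l \<le> i \<Longrightarrow> i \<le> length w \<Longrightarrow> ty (take i w) \<in> T"
    and T: "finite T" "card T \<le> M"
    and w: "w \<in> A" "l + M \<le> length w"
  shows "infinite A"
proof
  assume A: "finite A"
  define B where "B = {w \<in> A. l + M \<le> length w}"
  have B: "finite B" "B \<noteq> {}" using A w by (auto simp: B_def)
  then have "Max (length ` B) \<in> length ` B" by (intro Max_in) auto
  then obtain w' where w': "w' \<in> B" and "length w' = Max (length ` B)" by force
  then have max: "length v \<le> length w'" if "v \<in> B" for v using B that by simp
  obtain i j where ij: "l \<le> i" "i < j" "j \<le> l + M" "ty (take i w') = ty (take j w')"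
    by (rule equal_types_in_window[where ty = "\<lambda>i. ty (take i w')" and a = l, OF T])
      (use fin w' in \<open>auto simp: B_def\<close>)
  have "take j w' @ drop i w' \<in> A" using ij w' by (intro pump) (auto simp: B_def)
  then have "take j w' @ drop i w' \<in> B" using ij w' by (auto simp: B_def min_def)
  then have "length (take j w' @ drop i w') \<le> length w'" by (rule max)
  then show False using ij w' by (auto simp: B_def min_def split: if_splits)
qed

lemma nfa_reach_append: "nfa_reach tr S (u @ v) = nfa_reach tr (nfa_reach tr S u) v"
  by (induction u arbitrary: S) auto

lemma nfa_reach_subset:
  assumes "\<And>q a q'. (q, a, q') \<in> set tr \<Longrightarrow> q' \<in> Q" "S \<subseteq> Q"
  shows "nfa_reach tr S w \<subseteq> Q"
  using assms(2)
proof (induction w arbitrary: S)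
  case (Cons a w)
  have "{q'. \<exists>q\<in>S. (q, a, q') \<in> set tr} \<subseteq> Q" using assms(1) by blast
  from Cons.IH[OF this] show ?case by simp
qed simp

lemma length_conv2 [simp]: "length (conv2 u v) = max (length u) (length v)"
  by (simp add: conv2_def)

lemma nth_conv2: "i < max (length u) (length v) \<Longrightarrow>
    conv2 u v ! i = (if i < length u then Some (u ! i) else None, if i < length v then Some (v ! i) else None)"
  unfolding conv2_def by (subst nth_map) auto

text \<open>Either both words are cut at the same position, or the second one has ended by the cut
  and continues as padding.\<close>

lemma conv2_append:
  assumes "length u = length v \<or> length v \<le> length u \<and> v' = []"
  shows "conv2 (u @ u') (v @ v') = conv2 u v @ conv2 u' v'"
  using assms by (intro nth_equalityI) (auto simp: nth_conv2 nth_append)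

text \<open>Both automata share the bound p on their states, so a reached set of states is one of
  \<open>2 ^ p\<close> subsets.\<close>

locale presentation =
  fixes k :: nat and ID FD :: "nat list" and TD :: "(nat \<times> nat \<times> nat) list"
    and IE FE :: "nat list" and TE :: "(nat \<times> (nat option \<times> nat option) \<times> nat) list"
    and p :: nat and P :: pres
  assumes P_def: "P = Pres k (NFA ID FD TD) (NFA IE FE TE)"
    and ID: "set ID \<subseteq> {..<p}" and IE: "set IE \<subseteq> {..<p}"
    and TD: "\<And>q a q'. (q, a, q') \<in> set TD \<Longrightarrow> q' < p"
    and TE: "\<And>q a q'. (q, a, q') \<in> set TE \<Longrightarrow> q' < p"
begin

definition reachD :: "nat list \<Rightarrow> nat set" where "reachD = nfa_reach TD (set ID)"
definition reachE :: "(nat option \<times> nat option) list \<Rightarrow> nat set" where "reachE = nfa_reach TE (set IE)"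
definition cls :: "nat list \<Rightarrow> nat list set" where "cls u = pres_rel P `` {u}"

lemma reachD_subset: "reachD w \<in> Pow {..<p}"
  unfolding reachD_def using nfa_reach_subset[of TD "{..<p}"] TD ID by blast

lemma reachE_subset: "reachE w \<in> Pow {..<p}"
  unfolding reachE_def using nfa_reach_subset[of TE "{..<p}"] TE IE by blast

lemma dom_iff: "w \<in> pres_dom P \<longleftrightarrow> set w \<subseteq> {..<k} \<and> reachD w \<inter> set FD \<noteq> {}"
  by (simp add: P_def reachD_def)

lemma cls_iff: "u \<in> pres_dom P \<Longrightarrow> v \<in> cls u \<longleftrightarrow> v \<in> pres_dom P \<and> reachE (conv2 u v) \<inter> set FE \<noteq> {}"
  unfolding cls_def reachE_def by (simp add: P_def)

lemma reachD_append: "reachD x = reachD y \<Longrightarrow> reachD (x @ z) = reachD (y @ z)"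
  by (simp add: reachD_def nfa_reach_append)

text \<open>Beyond the length of u the convolution reads only padding on the first track, so a
  longer v matters only through the pair of state sets reached on its prefixes. There are
  \<open>4 ^ p\<close> such pairs: pumping up needs that many letters beyond u, and pumping down
  brings a longer word into a window of the same width.\<close>

lemma assumes u: "u \<in> pres_dom P"
  shows infinite_cls_if_long: "v \<in> cls u \<Longrightarrow> length u + 4 ^ p \<le> length v \<Longrightarrow> infinite (cls u)"
    and infinite_cls_iff: "infinite (cls u) \<longleftrightarrow>
      (\<exists>v \<in> cls u. length u + 4 ^ p < length v \<and> length v \<le> length u + 2 * 4 ^ p)"
proof -
  define ty where "ty v = (reachE (conv2 u v), reachD v)" for v
  define T where "T = Pow {..<p} \<times> Pow {..<p}"
  have T: "finite T" "card T \<le> 4 ^ p"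
    by (auto simp: T_def card_cartesian_product card_Pow power_mult_distrib[symmetric])
  have pump: "take i w @ drop j w \<in> cls u"
    if w: "w \<in> cls u" and i: "length u \<le> i" "i \<le> length w" and j: "length u \<le> j" "j \<le> length w"
      and eq: "ty (take i w) = ty (take j w)" for w i j
  proof -
    have E: "reachE (conv2 u (x @ z)) = nfa_reach TE (reachE (conv2 u x)) (conv2 [] z)"
      if "length u \<le> length x" for x z
    proof -
      have "conv2 u (x @ z) = conv2 u x @ conv2 [] z"
        using that by (intro nth_equalityI) (auto simp: nth_conv2 nth_append)
      then show ?thesis by (simp add: reachE_def nfa_reach_append)
    qed
    have w': "take j w @ drop j w \<in> cls u" using w by simp
    have "set (take i w @ drop j w) \<subseteq> set w" using set_take_subset[of i w] set_drop_subset[of j w] by auto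
    moreover have "reachD (take i w @ drop j w) = reachD (take j w @ drop j w)"
      by (rule reachD_append) (use eq in \<open>simp add: ty_def\<close>)
    moreover have "reachE (conv2 u (take i w @ drop j w)) = reachE (conv2 u (take j w @ drop j w))"
      using E[of "take i w" "drop j w"] E[of "take j w" "drop j w"] i j eq by (simp add: ty_def)
    ultimately show ?thesis using w w' by (auto simp: cls_iff[OF u] dom_iff)
  qed
  have fin: "ty (take i w) \<in> T" for i w by (simp only: ty_def T_def mem_Times_iff fst_conv snd_conv reachD_subset reachE_subset)
  show up: "infinite (cls u)" if "v \<in> cls u" "length u + 4 ^ p \<le> length v" for v
    using pumping_up[of "cls u" "length u" ty T "4 ^ p", OF pump fin T that] by blast
  show "infinite (cls u) \<longleftrightarrow>
      (\<exists>v \<in> cls u. length u + 4 ^ p < length v \<and> length v \<le> length u + 2 * 4 ^ p)"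
  proof
    assume "infinite (cls u)"
    moreover have "finite {w. set w \<subseteq> {..<k} \<and> length w \<le> length u + 4 ^ p}"
      by (rule finite_lists_length_le) simp
    ultimately have "\<not> cls u \<subseteq> {w. set w \<subseteq> {..<k} \<and> length w \<le> length u + 4 ^ p}"
      using finite_subset[of "cls u"] by auto
    then obtain v where "v \<in> cls u" "v \<notin> {w. set w \<subseteq> {..<k} \<and> length w \<le> length u + 4 ^ p}"
      unfolding subset_iff by blast
    then have v: "v \<in> cls u" "length u + 4 ^ p < length v"
      by (auto simp: cls_iff[OF u] dom_iff)
    have "\<exists>w'\<in>cls u. length u + 4 ^ p < length w' \<and> length w' \<le> length u + 4 ^ p + 4 ^ p"
      by (rule pumping_down[of "cls u" "length u" ty T "4 ^ p", OF pump fin T v]) simp_all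
    then show "\<exists>v \<in> cls u. length u + 4 ^ p < length v \<and> length v \<le> length u + 2 * 4 ^ p"
      by (simp add: mult_2 add.assoc)
  qed (use up less_imp_le in blast)
qed

section \<open>Prefix types of shortest class members\<close>

definition prefixes :: "nat list \<Rightarrow> nat list set" where
  "prefixes x = {v. set v \<subseteq> {..<k} \<and> length v \<le> length x}"

text \<open>All that a continuation of v can observe: the states of both automata, and whether v has
  the full length of x; if not, the word has already ended.\<close>

definition key :: "nat list \<Rightarrow> nat list \<Rightarrow> bool \<times> nat set \<times> nat set" where
  "key x v = (length v = length x, reachE (conv2 x v), reachD v)"

definition keys :: "(bool \<times> nat set \<times> nat set) set" where
  "keys = UNIV \<times> Pow {..<p} \<times> Pow {..<p}"

definition conts :: "nat list \<Rightarrow> bool \<times> nat set \<times> nat set \<Rightarrow> nat list set" where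
  "conts z \<kappa> = (case \<kappa> of (b, S, T) \<Rightarrow> {v. set v \<subseteq> {..<k} \<and> (b \<or> v = []) \<and>
     nfa_reach TD T v \<inter> set FD \<noteq> {} \<and> nfa_reach TE S (conv2 z v) \<inter> set FE \<noteq> {}})"

definition key_count :: "nat list \<Rightarrow> bool \<times> nat set \<times> nat set \<Rightarrow> nat" where
  "key_count x \<kappa> = card {v \<in> prefixes x. key x v = \<kappa>}"

text \<open>In an equivalence structure all representatives of one class have the same length, and m
  = 0 stands for the infinite classes.\<close>

definition representatives :: "nat \<Rightarrow> nat list set" where
  "representatives m = {x \<in> pres_dom P. card (cls x) = m \<and> (\<forall>v \<in> cls x. length x \<le> length v)}"

text \<open>Exact counts are unbounded; truncated at m + 1 they still separate all values that can
  contribute to a class of m elements, and only finitely many types remain.\<close>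

definition rep_type :: "nat \<Rightarrow> nat list \<Rightarrow> nat set \<times> (bool \<times> nat set \<times> nat set \<Rightarrow> nat)" where
  "rep_type m x = (reachD x, restrict (\<lambda>\<kappa>. min (Suc m) (key_count x \<kappa>)) keys)"

lemma finite_prefixes: "finite (prefixes x)"
  unfolding prefixes_def by (rule finite_lists_length_le) simp

lemma key_in_keys: "key x v \<in> keys"
  using reachD_subset reachE_subset by (auto simp: key_def keys_def)

lemma finite_keys: "finite keys" by (simp add: keys_def)

text \<open>Members of the class are cut at the length of x. A shorter member is its own prefix with
  the empty continuation, so the decomposition is unique.\<close>

lemma cls_append:
  assumes xz: "x @ z \<in> pres_dom P"
  shows "cls (x @ z) = (\<Union>v \<in> prefixes x. (\<lambda>v'. v @ v') ` conts z (key x v))"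
proof -
  have mem: "v @ v' \<in> cls (x @ z) \<longleftrightarrow> v' \<in> conts z (key x v)"
    if "v \<in> prefixes x" "length v = length x \<or> v' = []" for v v'
  proof -
    have "conv2 (x @ z) (v @ v') = conv2 x v @ conv2 z v'"
      using that by (intro conv2_append) (auto simp: prefixes_def)
    then show ?thesis
      using that by (auto simp: cls_iff[OF xz] dom_iff conts_def key_def prefixes_def
          reachD_def reachE_def nfa_reach_append)
  qed
  show ?thesis
  proof
    show "cls (x @ z) \<subseteq> (\<Union>v \<in> prefixes x. (\<lambda>v'. v @ v') ` conts z (key x v))"
    proof
      fix w assume w: "w \<in> cls (x @ z)"
      define v where "v = take (length x) w"
      define v' where "v' = drop (length x) w"
      have "set w \<subseteq> {..<k}" using w by (auto simp: cls_iff[OF xz] dom_iff)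
      then have v: "v \<in> prefixes x" using set_take_subset[of "length x" w] by (auto simp: prefixes_def v_def)
      have "length v = length x \<or> v' = []" by (auto simp: v_def v'_def)
      moreover have "w = v @ v'" by (simp add: v_def v'_def)
      ultimately have "v' \<in> conts z (key x v)" using mem[OF v] w by blast
      with v \<open>w = v @ v'\<close> show "w \<in> (\<Union>v \<in> prefixes x. (\<lambda>v'. v @ v') ` conts z (key x v))" by blast
    qed
    show "(\<Union>v \<in> prefixes x. (\<lambda>v'. v @ v') ` conts z (key x v)) \<subseteq> cls (x @ z)"
    proof
      fix w assume "w \<in> (\<Union>v \<in> prefixes x. (\<lambda>v'. v @ v') ` conts z (key x v))"
      then obtain v v' where v: "v \<in> prefixes x" "v' \<in> conts z (key x v)" "w = v @ v'" by blast
      then have "length v = length x \<or> v' = []" by (auto simp: conts_def key_def)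
      with mem v show "w \<in> cls (x @ z)" by blast
    qed
  qed
qed

lemma finite_cls_append_iff:
  assumes xz: "x @ z \<in> pres_dom P"
  shows "finite (cls (x @ z)) \<longleftrightarrow> (\<forall>\<kappa> \<in> keys. 0 < key_count x \<kappa> \<longrightarrow> finite (conts z \<kappa>))"
proof -
  have "finite (cls (x @ z)) \<longleftrightarrow> (\<forall>v \<in> prefixes x. finite ((\<lambda>v'. v @ v') ` conts z (key x v)))"
    unfolding cls_append[OF xz] by (rule finite_UN) (rule finite_prefixes)
  also have "\<dots> \<longleftrightarrow> (\<forall>v \<in> prefixes x. finite (conts z (key x v)))"
    by (intro ball_cong refl finite_image_iff) (simp add: inj_on_def)
  also have "\<dots> \<longleftrightarrow> (\<forall>\<kappa> \<in> keys. 0 < key_count x \<kappa> \<longrightarrow> finite (conts z \<kappa>))"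
    using key_in_keys by (fastforce simp: key_count_def card_gt_0_iff finite_prefixes)
  finally show ?thesis .
qed

text \<open>Prefixes with equal keys have the same continuations, so the prefixes can be grouped by
  key.\<close>

lemma card_cls_append:
  assumes xz: "x @ z \<in> pres_dom P" and fin: "finite (cls (x @ z))"
  shows "card (cls (x @ z)) = (\<Sum>\<kappa> \<in> keys. key_count x \<kappa> * card (conts z \<kappa>))"
proof -
  have "card (cls (x @ z)) = (\<Sum>v \<in> prefixes x. card ((\<lambda>v'. v @ v') ` conts z (key x v)))"
    unfolding cls_append[OF xz]
  proof (rule card_UN_disjoint)
    show "\<forall>v \<in> prefixes x. finite ((\<lambda>v'. v @ v') ` conts z (key x v))"
      using fin unfolding cls_append[OF xz] by (simp add: finite_prefixes)
    show "\<forall>v \<in> prefixes x. \<forall>w \<in> prefixes x. v \<noteq> w \<longrightarrow>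
        (\<lambda>v'. v @ v') ` conts z (key x v) \<inter> (\<lambda>v'. w @ v') ` conts z (key x w) = {}"
    proof -
      have "v = take (length x) (v @ v')" if "v \<in> prefixes x" "v' \<in> conts z (key x v)" for v v'
        using that by (auto simp: prefixes_def conts_def key_def)
      then show ?thesis by (smt (verit, best) disjoint_iff imageE)
    qed
  qed (rule finite_prefixes)
  also have "\<dots> = (\<Sum>v \<in> prefixes x. card (conts z (key x v)))"
    by (intro sum.cong refl card_image) (simp add: inj_on_def)
  also have "\<dots> = (\<Sum>\<kappa> \<in> keys. \<Sum>v \<in> {v \<in> prefixes x. key x v = \<kappa>}. card (conts z (key x v)))"
    by (rule sum.group[symmetric]) (use finite_prefixes finite_keys key_in_keys in auto)
  also have "\<dots> = (\<Sum>\<kappa> \<in> keys. key_count x \<kappa> * card (conts z \<kappa>))"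
    by (intro sum.cong refl) (simp add: key_count_def)
  finally show ?thesis .
qed

text \<open>Finiteness of the class depends only on which keys occur, and a finite size m is a sum
  of products of counts with numbers of continuations. A count with a nonzero factor is at most m,
  hence below the truncation and equal for x and y. Minimality is transferred by replacing a prefix
  by one with the same key.\<close>

lemma representatives_append:
  assumes ty: "rep_type m x = rep_type m y" and y: "set y \<subseteq> {..<k}"
    and xz: "x @ z \<in> representatives m"
  shows "y @ z \<in> representatives m"
proof -
  have xzD: "x @ z \<in> pres_dom P" using xz by (simp add: representatives_def)
  have "reachD (y @ z) = reachD (x @ z)" using ty by (intro reachD_append) (simp add: rep_type_def)
  with xzD y have yzD: "y @ z \<in> pres_dom P" unfolding dom_iff by (metis Un_subset_iff set_append)
  have min: "min (Suc m) (key_count x \<kappa>) = min (Suc m) (key_count y \<kappa>)" if "\<kappa> \<in> keys" for \<kappa>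
  proof -
    have "restrict (\<lambda>\<kappa>. min (Suc m) (key_count x \<kappa>)) keys \<kappa> = restrict (\<lambda>\<kappa>. min (Suc m) (key_count y \<kappa>)) keys \<kappa>"
      using ty by (simp only: rep_type_def prod.inject)
    with that show ?thesis by (simp only: restrict_apply')
  qed
  have pos: "0 < key_count x \<kappa> \<longleftrightarrow> 0 < key_count y \<kappa>" if "\<kappa> \<in> keys" for \<kappa>
    using min[OF that] by (auto simp: min_def split: if_splits)
  have fin: "finite (cls (x @ z)) \<longleftrightarrow> finite (cls (y @ z))"
    using pos by (simp add: finite_cls_append_iff xzD yzD)
  have "card (cls (y @ z)) = m"
  proof (cases "finite (cls (x @ z))")
    case False
    \<comment> \<open>The class of \<open>x @ z\<close> is infinite here, so m = 0 and it suffices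
      that the class of \<open>y @ z\<close> is infinite too.\<close>
    then show ?thesis using fin xz by (simp add: representatives_def)
  next
    case True
    have m: "(\<Sum>\<kappa> \<in> keys. key_count x \<kappa> * card (conts z \<kappa>)) = m"
      using card_cls_append[OF xzD True] xz by (simp add: representatives_def)
    have "key_count y \<kappa> * card (conts z \<kappa>) = key_count x \<kappa> * card (conts z \<kappa>)" if \<kappa>: "\<kappa> \<in> keys" for \<kappa>
    proof (cases "card (conts z \<kappa>) = 0")
      case False
      have "key_count x \<kappa> * card (conts z \<kappa>) \<le> m"
        unfolding m[symmetric] by (rule member_le_sum) (use \<kappa> finite_keys in auto)
      moreover have "key_count x \<kappa> * 1 \<le> key_count x \<kappa> * card (conts z \<kappa>)"
        using False by (intro mult_le_mono2) simp
      ultimately have "key_count x \<kappa> \<le> m" by linarith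
      with min[OF \<kappa>] have "key_count y \<kappa> = key_count x \<kappa>" by (auto simp: min_def split: if_splits)
      then show ?thesis by simp
    qed simp
    with m card_cls_append[OF yzD] fin True show ?thesis by simp
  qed
  moreover have "length (y @ z) \<le> length w" if w: "w \<in> cls (y @ z)" for w
  proof -
    from w obtain v v' where v: "v \<in> prefixes y" "v' \<in> conts z (key y v)" "w = v @ v'"
      unfolding cls_append[OF yzD] by blast
    have "finite {u \<in> prefixes y. key y u = key y v}" using finite_prefixes by simp
    then have "0 < key_count y (key y v)" using v(1) by (auto simp: key_count_def card_gt_0_iff)
    then have "0 < key_count x (key y v)" using pos[OF key_in_keys] by blast
    \<comment> \<open>The word u stands in for v on the side of x. If both have full length, the two
      lengths shift by the same amount; otherwise u alone would be a class member shorter than x,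
      which minimality of \<open>x @ z\<close> excludes.\<close>
    then obtain u where u: "u \<in> prefixes x" "key x u = key y v"
      by (auto simp: key_count_def card_gt_0_iff)
    have "u @ v' \<in> (\<lambda>v'. u @ v') ` conts z (key x u)" using v(2) u(2) by simp
    with u(1) have "u @ v' \<in> cls (x @ z)" unfolding cls_append[OF xzD] by blast
    then have le: "length (x @ z) \<le> length (u @ v')" using xz unfolding representatives_def by blast
    show ?thesis
    proof (cases "length v = length y")
      case True
      then have "length u = length x" using u by (simp add: key_def)
      with le v True show ?thesis by simp
    next
      case False
      then have "length u \<noteq> length x" "v' = []" using u v by (auto simp: key_def conts_def)
      with le u(1) show ?thesis by (simp add: prefixes_def)
    qed
  qed
  ultimately show ?thesis using yzD by (simp add: representatives_def)
qed

text \<open>There are \<open>2 ^ p\<close> state sets for x, m + 2 truncated values per key, and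
  \<open>2 * 4 ^ p\<close> keys.\<close>

lemma rep_type_range:
  fixes m defines "T \<equiv> Pow {..<p} \<times> (keys \<rightarrow>\<^sub>E {..Suc m})"
  shows "rep_type m x \<in> T" "finite T" "card T \<le> 2 ^ p * (m + 2) ^ (2 * 4 ^ p)"
proof -
  show "rep_type m x \<in> T" unfolding T_def rep_type_def using reachD_subset by auto
  show "finite T" unfolding T_def by (simp add: finite_keys finite_PiE)
  have "card keys = 2 * 4 ^ p"
    by (simp add: keys_def card_cartesian_product card_Pow power_mult_distrib[symmetric])
  then show "card T \<le> 2 ^ p * (m + 2) ^ (2 * 4 ^ p)"
    by (simp add: T_def card_cartesian_product card_Pow card_PiE finite_keys)
qed

lemma representatives_gap:
  assumes gap: "\<And>x. x \<in> representatives m \<Longrightarrow> \<not> (L < length x \<and> length x \<le> L + B)"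
    and B: "2 ^ p * (m + 2) ^ (2 * 4 ^ p) \<le> B" and x: "x \<in> representatives m"
  shows "length x \<le> L"
proof (rule ccontr)
  assume "\<not> ?thesis"
  then have L: "L < length x" by simp
  have "\<exists>w \<in> representatives m. L < length w \<and> length w \<le> L + B"
  \<comment> \<open>Cuts are allowed at every position, since here no second word is held
    fixed.\<close>
  proof (rule pumping_down[where l = 0 and ty = "rep_type m", OF _ rep_type_range(1,2) _ x L])
    show "card (Pow {..<p} \<times> (keys \<rightarrow>\<^sub>E {..Suc m})) \<le> B"
      using rep_type_range(3)[of m] B by (rule order.trans)
    fix w i j assume w: "w \<in> representatives m" and ty: "rep_type m (take i w) = rep_type m (take j w)"
    have "set (take i w) \<subseteq> {..<k}"
      using w set_take_subset[of i w] by (auto simp: representatives_def dom_iff)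
    from representatives_append[OF ty[symmetric] this, of "drop j w"] w
    show "take i w @ drop j w \<in> representatives m" by simp
  qed simp
  with gap show False by blast
qed

end

section \<open>Register programs for recursive functions\<close>

text \<open>Every assignment is an affine map with natural coefficients, and equality is the only
  test because its failure can be measured by a square. Branching is left to the nondeterminism of
  the control.\<close>

datatype cmd = Nop | Zro nat | Cpy nat nat | Inc nat | Eq nat nat

fun upd :: "cmd \<Rightarrow> (nat \<Rightarrow> nat) \<Rightarrow> (nat \<Rightarrow> nat)" where
  "upd (Zro i) s = s(i := 0)"
| "upd (Cpy i j) s = s(i := s j)"
| "upd (Inc i) s = s(i := Suc (s i))"
| "upd _ s = s"

fun guard :: "cmd \<Rightarrow> (nat \<Rightarrow> nat) \<Rightarrow> bool" where
  "guard (Eq i j) s \<longleftrightarrow> s i = s j"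
| "guard _ s \<longleftrightarrow> True"

datatype com = Cmd cmd | Seq com com (infixr ";;" 60) | Star com

fun sem :: "com \<Rightarrow> ((nat \<Rightarrow> nat) \<times> (nat \<Rightarrow> nat)) set" where
  "sem (Cmd c) = {(s, t). guard c s \<and> t = upd c s}"
| "sem (a ;; b) = sem a O sem b"
| "sem (Star a) = (sem a)\<^sup>*"

text \<open>Registers b and b + 1 receive 1 and 0, so the test fails on every run.\<close>

definition abort :: "nat \<Rightarrow> com" where
  "abort b = Cmd (Zro b) ;; Cmd (Zro (b + 1)) ;; Cmd (Inc b) ;; Cmd (Eq b (b + 1))"

text \<open>In place of an inequality test, a positive value is guessed in register u and compared
  with t.\<close>

definition assert_pos :: "nat \<Rightarrow> nat \<Rightarrow> com" where
  "assert_pos t u = Cmd (Zro u) ;; Cmd (Inc u) ;; Star (Cmd (Inc u)) ;; Cmd (Eq u t)"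

fun seqs :: "com list \<Rightarrow> com" where
  "seqs [] = Cmd Nop"
| "seqs (c # cs) = c ;; seqs cs"

text \<open>The number of iterations is guessed by \<open>Star\<close> and checked afterwards
  against r. Register b counts, b + 1 holds the current value, and b + 2 receives the next one. The
  register \<open>out\<close> may also be an argument register, so it is written last.\<close>

definition prec_prog :: "(nat list \<Rightarrow> nat \<Rightarrow> nat \<Rightarrow> com) \<Rightarrow> (nat list \<Rightarrow> nat \<Rightarrow> nat \<Rightarrow> com) \<Rightarrow> nat list \<Rightarrow> nat \<Rightarrow> nat \<Rightarrow> com" where
  "prec_prog cf cg rs out b = (case rs of [] \<Rightarrow> abort b | r # rs' \<Rightarrow>
     Cmd (Zro b) ;; cf rs' (b + 1) (b + 3) ;;
     Star (cg (b # (b + 1) # rs') (b + 2) (b + 3) ;; Cmd (Cpy (b + 1) (b + 2)) ;; Cmd (Inc b)) ;;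
     Cmd (Eq b r) ;; Cmd (Cpy out (b + 1)))"

text \<open>The loop is left at a guessed moment: each pass certifies a positive value and the final
  call a zero, so exactly the least zero survives.\<close>

definition mn_prog :: "(nat list \<Rightarrow> nat \<Rightarrow> nat \<Rightarrow> com) \<Rightarrow> nat list \<Rightarrow> nat \<Rightarrow> nat \<Rightarrow> com" where
  "mn_prog cf rs out b =
     Cmd (Zro b) ;;
     Star (cf (b # rs) (b + 1) (b + 3) ;; assert_pos (b + 1) (b + 2) ;; Cmd (Inc b)) ;;
     cf (b # rs) (b + 1) (b + 3) ;; Cmd (Zro (b + 2)) ;; Cmd (Eq (b + 1) (b + 2)) ;; Cmd (Cpy out b)"

text \<open>The argument and result registers lie below b; all registers from b on are scratch space.\<close>
primrec compile :: "recf \<Rightarrow> nat list \<Rightarrow> nat \<Rightarrow> nat \<Rightarrow> com" where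
  "compile Zero_f = (\<lambda>rs out b. Cmd (Zro out))"
| "compile Succ_f = (\<lambda>rs out b. case rs of [] \<Rightarrow> abort b | r # _ \<Rightarrow> Cmd (Cpy out r) ;; Cmd (Inc out))"
| "compile (Proj_f i) = (\<lambda>rs out b. if i < length rs then Cmd (Cpy out (rs ! i)) else abort b)"
| "compile (Comp_f f gs) = (\<lambda>rs out b.
     seqs (map (\<lambda>(i, g). g rs (b + i) (b + length gs)) (List.enumerate 0 (map compile gs))) ;;
     compile f [b..<b + length gs] out (b + length gs))"
| "compile (Prec_f f g) = prec_prog (compile f) (compile g)"
| "compile (Mn_f f) = mn_prog (compile f)"

text \<open>Programs are nondeterministic, so correctness has two halves: every complete run returns
  a value of f and preserves the other registers below b, and every value of f is returned by some
  run. Where f is undefined there is no complete run.\<close>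

definition computes :: "recf \<Rightarrow> (nat list \<Rightarrow> nat \<Rightarrow> nat \<Rightarrow> com) \<Rightarrow> bool" where
  "computes f c \<longleftrightarrow> (\<forall>rs out b. (\<forall>r\<in>set rs. r < b) \<and> out < b \<longrightarrow>
     (\<forall>s t. (s, t) \<in> sem (c rs out b) \<longrightarrow>
        recf_eval f (map s rs) (t out) \<and> (\<forall>r<b. r \<noteq> out \<longrightarrow> t r = s r)) \<and>
     (\<forall>s y. recf_eval f (map s rs) y \<longrightarrow> (\<exists>t. (s, t) \<in> sem (c rs out b) \<and> t out = y)))"

lemma computesI:
  assumes "\<And>rs out b s t. \<forall>r\<in>set rs. r < b \<Longrightarrow> out < b \<Longrightarrow> (s, t) \<in> sem (c rs out b) \<Longrightarrow>
      recf_eval f (map s rs) (t out) \<and> (\<forall>r<b. r \<noteq> out \<longrightarrow> t r = s r)"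
    and "\<And>rs out b s y. \<forall>r\<in>set rs. r < b \<Longrightarrow> out < b \<Longrightarrow> recf_eval f (map s rs) y \<Longrightarrow>
      \<exists>t. (s, t) \<in> sem (c rs out b) \<and> t out = y"
  shows "computes f c"
  unfolding computes_def
proof (intro allI impI, elim conjE, intro conjI)
  fix rs :: "nat list" and out b :: nat assume A: "\<forall>r\<in>set rs. r < b" "out < b"
  show "\<forall>s t. (s, t) \<in> sem (c rs out b) \<longrightarrow>
        recf_eval f (map s rs) (t out) \<and> (\<forall>r<b. r \<noteq> out \<longrightarrow> t r = s r)"
    using assms(1)[OF A] by simp
  show "\<forall>s y. recf_eval f (map s rs) y \<longrightarrow> (\<exists>t. (s, t) \<in> sem (c rs out b) \<and> t out = y)"
    using assms(2)[OF A] by simp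
qed

lemma computesD:
  assumes "computes f c" "\<forall>r\<in>set rs. r < b" "out < b"
  shows "(s, t) \<in> sem (c rs out b) \<Longrightarrow> recf_eval f (map s rs) (t out)"
    and "(s, t) \<in> sem (c rs out b) \<Longrightarrow> r < b \<Longrightarrow> r \<noteq> out \<Longrightarrow> t r = s r"
    and "recf_eval f (map s rs) y \<Longrightarrow> \<exists>t. (s, t) \<in> sem (c rs out b) \<and> t out = y"
  using assms(1)[unfolded computes_def, rule_format, of rs b out] assms(2,3) by auto

lemma sem_abort: "sem (abort b) = {}"
  by (auto simp: abort_def)

lemma sem_assert_pos:
  assumes "t \<noteq> u"
  shows "(s, s') \<in> sem (assert_pos t u) \<longleftrightarrow> 0 < s t \<and> s' = s(u := s t)"
proof -
  have 1: "\<exists>n. s'' = s'(u := s' u + n)" if "(s', s'') \<in> (sem (Cmd (Inc u)))\<^sup>*" for s' s''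
    using that
  proof (induction rule: rtrancl_induct)
    case base
    show ?case by (intro exI[of _ 0]) simp
  next
    case (step y z)
    then obtain n where "y = s'(u := s' u + n)" by blast
    then show ?case using step(2) by (intro exI[of _ "Suc n"]) auto
  qed
  have 2: "(s', s'(u := s' u + n)) \<in> (sem (Cmd (Inc u)))\<^sup>*" for s' n
  proof (induction n)
    case (Suc n)
    have "(s'(u := s' u + n), s'(u := s' u + Suc n)) \<in> sem (Cmd (Inc u))" by (auto simp: fun_eq_iff)
    with Suc show ?case by (rule rtrancl_into_rtrancl)
  qed simp
  show ?thesis
  proof
    assume "(s, s') \<in> sem (assert_pos t u)"
    then obtain s'' where s'': "(s(u := Suc 0), s'') \<in> (sem (Cmd (Inc u)))\<^sup>*" "s'' u = s'' t" "s' = s''"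
      by (auto simp: assert_pos_def)
    from 1[OF this(1)] obtain n where "s'' = s(u := Suc n)" by auto
    with s'' assms have "s t = Suc n" "s' = s(u := Suc n)" by auto
    then show "0 < s t \<and> s' = s(u := s t)" by simp
  next
    assume s': "0 < s t \<and> s' = s(u := s t)"
    have "(s(u := Suc 0), s(u := s t)) \<in> (sem (Cmd (Inc u)))\<^sup>*"
      using 2[of "s(u := Suc 0)" "s t - 1"] s' by simp
    moreover have "(s(u := s t), s') \<in> sem (Cmd (Eq u t))" using s' assms by simp
    ultimately have "(s(u := Suc 0), s') \<in> sem (Star (Cmd (Inc u)) ;; Cmd (Eq u t))"
      unfolding sem.simps(2,3) by (rule relcompI)
    then show "(s, s') \<in> sem (assert_pos t u)" unfolding assert_pos_def
      by (auto simp del: sem.simps(3) simp: relcomp.simps)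
  qed
qed

lemma computes_Comp:
  assumes f: "computes f cf" and gs: "length cs = length gs" "\<And>i. i < length gs \<Longrightarrow> computes (gs ! i) (cs ! i)"
  shows "computes (Comp_f f gs) (\<lambda>rs out b.
     seqs (map (\<lambda>(i, g). g rs (b + i) (b + length gs)) (List.enumerate 0 cs)) ;;
     cf [b..<b + length gs] out (b + length gs))"
proof -
  let ?n = "length gs"
  \<comment> \<open>Generalized to an arbitrary list of argument indices for the induction. Result i
    goes to register b + i, and the scratch space of every call starts above all results.\<close>
  define prog where "prog rs b js = seqs (map (\<lambda>i. (cs ! i) rs (b + i) (b + ?n)) js)" for rs b js
  have prog: "seqs (map (\<lambda>(i, g). g rs (b + i) (b + ?n)) (List.enumerate 0 cs)) = prog rs b [0..<?n]" for rs b
  proof -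
    have "map (\<lambda>(i, g). g rs (b + i) (b + ?n)) (List.enumerate 0 cs) = map (\<lambda>i. (cs ! i) rs (b + i) (b + ?n)) [0..<?n]"
      using gs(1) by (intro nth_equalityI) (auto simp: nth_enumerate_eq)
    then show ?thesis by (simp add: prog_def)
  qed
  have sound: "(\<forall>i\<in>set js. recf_eval (gs ! i) (map s rs) (t (b + i))) \<and>
      (\<forall>r<b. t r = s r) \<and> (\<forall>i<?n. i \<notin> set js \<longrightarrow> t (b + i) = s (b + i))"
    if "(s, t) \<in> sem (prog rs b js)" "\<forall>r\<in>set rs. r < b" "set js \<subseteq> {..<?n}" "distinct js" for rs b js s t
    using that(1,3,4)
  proof (induction js arbitrary: s)
    case (Cons j js)
    have j: "j < ?n" using Cons.prems by simp
    obtain u where u: "(s, u) \<in> sem ((cs ! j) rs (b + j) (b + ?n))" "(u, t) \<in> sem (prog rs b js)"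
      using Cons.prems by (auto simp: prog_def)
    have rs: "\<forall>r\<in>set rs. r < b + ?n" using that(2) by auto
    note C = computesD[OF gs(2)[OF j] rs, of "b + j"]
    have ev: "recf_eval (gs ! j) (map s rs) (u (b + j))" using C(1)[OF _ u(1)] j by simp
    have fr: "u r = s r" if "r < b + ?n" "r \<noteq> b + j" for r using C(2)[OF _ u(1) that] j by simp
    have IH: "(\<forall>i\<in>set js. recf_eval (gs ! i) (map u rs) (t (b + i)))" "\<forall>r<b. t r = u r"
      "\<forall>i<?n. i \<notin> set js \<longrightarrow> t (b + i) = u (b + i)"
      using Cons.IH[OF u(2)] Cons.prems by auto
    have e: "map u rs = map s rs" using fr that(2) by auto
    have "t (b + j) = u (b + j)" using IH(3) j Cons.prems by simp
    then show ?case using ev IH(1)[unfolded e] IH(2,3) fr by auto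
  qed (simp add: prog_def)
  have complete: "\<exists>t. (s, t) \<in> sem (prog rs b js)"
    if "\<forall>i\<in>set js. \<exists>y. recf_eval (gs ! i) (map s rs) y" "\<forall>r\<in>set rs. r < b" "set js \<subseteq> {..<?n}" for rs b js s
    using that(1,3)
  proof (induction js arbitrary: s)
    case (Cons j js)
    have j: "j < ?n" using Cons.prems by simp
    have rs: "\<forall>r\<in>set rs. r < b + ?n" using that(2) by auto
    note C = computesD[OF gs(2)[OF j] rs, of "b + j"]
    obtain u where u: "(s, u) \<in> sem ((cs ! j) rs (b + j) (b + ?n))" using C(3) Cons.prems j by fastforce
    have fr: "u r = s r" if "r < b + ?n" "r \<noteq> b + j" for r using C(2)[OF _ u that] j by simp
    have e: "map u rs = map s rs" using fr that(2) by auto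
    obtain t where "(u, t) \<in> sem (prog rs b js)" using Cons.IH[of u, unfolded e] Cons.prems by auto
    with u show ?case by (auto simp: prog_def)
  qed (simp add: prog_def)
  have sub: "set [0..<?n] \<subseteq> {..<?n}" by auto
  show ?thesis unfolding prog
  proof (rule computesI)
    fix rs :: "nat list" and out b :: nat and s t
    assume rs: "\<forall>r\<in>set rs. r < b" and out: "out < b"
      and "(s, t) \<in> sem (prog rs b [0..<?n] ;; cf [b..<b + ?n] out (b + ?n))"
    then obtain u where u: "(s, u) \<in> sem (prog rs b [0..<?n])" "(u, t) \<in> sem (cf [b..<b + ?n] out (b + ?n))"
      by auto
    have S: "\<forall>i<?n. recf_eval (gs ! i) (map s rs) (u (b + i))" "\<forall>r<b. u r = s r"
      using sound[OF u(1) rs sub distinct_upt] by simp_all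
    have D: "recf_eval f (map u [b..<b + ?n]) (t out)" "\<And>r. r < b + ?n \<Longrightarrow> r \<noteq> out \<Longrightarrow> t r = u r"
      using computesD(1,2)[OF f _ _ u(2)] out by auto
    have "recf_eval (Comp_f f gs) (map s rs) (t out)"
      by (rule ev_comp[OF _ _ D(1)]) (use S(1) in auto)
    moreover have "\<forall>r<b. r \<noteq> out \<longrightarrow> t r = s r" using S(2) D(2) by simp
    ultimately show "recf_eval (Comp_f f gs) (map s rs) (t out) \<and> (\<forall>r<b. r \<noteq> out \<longrightarrow> t r = s r)" ..
  next
    fix rs :: "nat list" and out b :: nat and s y
    assume rs: "\<forall>r\<in>set rs. r < b" and out: "out < b" and "recf_eval (Comp_f f gs) (map s rs) y"
    from this(3) obtain ys where ys: "length ys = ?n" "\<forall>i<?n. recf_eval (gs ! i) (map s rs) (ys ! i)" "recf_eval f ys y"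
      by (cases rule: recf_eval.cases) auto
    then have "\<forall>i\<in>set [0..<?n]. \<exists>y. recf_eval (gs ! i) (map s rs) y" by auto
    from complete[OF this rs sub] obtain u where u: "(s, u) \<in> sem (prog rs b [0..<?n])" by blast
    have "recf_eval (gs ! i) (map s rs) (u (b + i))" if "i < ?n" for i
      using sound[OF u rs sub distinct_upt] that by simp
    then have "map u [b..<b + ?n] = ys"
      using ys by (intro nth_equalityI) (auto intro: recf_eval_deterministic)
    then obtain t where "(u, t) \<in> sem (cf [b..<b + ?n] out (b + ?n))" "t out = y"
      using computesD(3)[OF f, of "[b..<b + ?n]" "b + ?n" out u y] ys(3) out by auto
    with u show "\<exists>t. (s, t) \<in> sem (prog rs b [0..<?n] ;; cf [b..<b + ?n] out (b + ?n)) \<and> t out = y" by auto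
  qed
qed

lemma computes_Prec:
  assumes f: "computes f cf" and g: "computes g cg"
  shows "computes (Prec_f f g) (prec_prog cf cg)"
proof -
  define body where "body rs b = cg (b # (b + 1) # rs) (b + 2) (b + 3) ;; Cmd (Cpy (b + 1) (b + 2)) ;; Cmd (Inc b)" for rs b
  define loop where "loop rs b = Cmd (Zro b) ;; cf rs (b + 1) (b + 3) ;; Star (body rs b)" for rs b
  have body: "t b = Suc (s b) \<and> recf_eval g (s b # s (b + 1) # map s rs) (t (b + 1)) \<and> (\<forall>r<b. t r = s r)"
    if st: "(s, t) \<in> sem (body rs b)" and rs: "\<forall>r\<in>set rs. r < b" for s t rs b
  proof -
    obtain u where u: "(s, u) \<in> sem (cg (b # (b + 1) # rs) (b + 2) (b + 3))"
      and t: "t = upd (Inc b) (upd (Cpy (b + 1) (b + 2)) u)"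
      using st by (auto simp: body_def)
    have "\<forall>r\<in>set (b # (b + 1) # rs). r < b + 3" using rs by auto
    note C = computesD(1,2)[OF g this, of "b + 2", OF _ u]
    show ?thesis using C t by auto
  qed
  have init: "u b = 0 \<and> recf_eval f (map s rs) (u (b + 1)) \<and> (\<forall>r<b. u r = s r)"
    if "(s(b := 0), u) \<in> sem (cf rs (b + 1) (b + 3))" and rs: "\<forall>r\<in>set rs. r < b" for s u rs b
  proof -
    have "\<forall>r\<in>set rs. r < b + 3" using rs by auto
    note C = computesD(1,2)[OF f this, of "b + 1", OF _ that(1)]
    have e: "map (s(b := 0)) rs = map s rs" using rs by auto
    show ?thesis using C(1)[unfolded e] C(2) by auto
  qed
  have loop_iff: "(s, t) \<in> sem (loop rs b) \<longleftrightarrow>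
      (\<exists>u. (s(b := 0), u) \<in> sem (cf rs (b + 1) (b + 3)) \<and> (u, t) \<in> (sem (body rs b))\<^sup>*)" for s t rs b
    by (simp add: loop_def relcomp.simps)
  \<comment> \<open>Loop invariant: register b + 1 holds the value of the recursion at the count in
    register b, whatever the number of passes.\<close>
  have loop: "recf_eval (Prec_f f g) (t b # map s rs) (t (b + 1)) \<and> (\<forall>r<b. t r = s r)"
    if st: "(s, t) \<in> sem (loop rs b)" and rs: "\<forall>r\<in>set rs. r < b" for s t rs b
  proof -
    obtain u where u: "(s(b := 0), u) \<in> sem (cf rs (b + 1) (b + 3))" and t: "(u, t) \<in> (sem (body rs b))\<^sup>*"
      using st unfolding loop_iff by blast
    from t show ?thesis
    proof (induction rule: rtrancl_induct)
      case base
      show ?case using init[OF u rs] by (auto intro: ev_prec0)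
    next
      case (step v w)
      note B = body[OF step(2) rs]
      have e: "map v rs = map s rs" using step.IH rs by auto
      show ?case using B[unfolded e] step.IH by (auto intro: ev_precS)
    qed
  qed
  have loop_complete: "\<exists>t. (s, t) \<in> sem (loop rs b) \<and> t b = n"
    if "recf_eval (Prec_f f g) (n # map s rs) y" and rs: "\<forall>r\<in>set rs. r < b" for s y rs b n
    using that(1)
  proof (induction n arbitrary: y)
    case 0
    then have ev: "recf_eval f (map s rs) y" by (cases rule: recf_eval.cases) auto
    have e: "map (s(b := 0)) rs = map s rs" using rs by auto
    have r3: "\<forall>r\<in>set rs. r < b + 3" using rs by auto
    obtain u where u: "(s(b := 0), u) \<in> sem (cf rs (b + 1) (b + 3))"
      using computesD(3)[OF f r3, of "b + 1" "s(b := 0)" y, unfolded e] ev by auto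
    have "(s, u) \<in> sem (loop rs b)" using u unfolding loop_iff by blast
    with init[OF u rs] show ?case by blast
  next
    case (Suc n)
    from Suc.prems obtain y' where y': "recf_eval (Prec_f f g) (n # map s rs) y'" "recf_eval g (n # y' # map s rs) y"
      by (cases rule: recf_eval.cases) auto
    then obtain t where t: "(s, t) \<in> sem (loop rs b)" "t b = n" using Suc.IH by blast
    note L = loop[OF t(1) rs]
    \<comment> \<open>The induction hypothesis fixes only the counter of the run; determinism
      identifies the content of b + 1 with the intermediate value.\<close>
    have "t (b + 1) = y'" using L t(2) y'(1) recf_eval_deterministic by blast
    moreover have "map t rs = map s rs" using L rs by auto
    ultimately have e: "map t (b # (b + 1) # rs) = n # y' # map s rs" using t(2) by simp
    have r3: "\<forall>r\<in>set (b # (b + 1) # rs). r < b + 3" using rs by auto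
    obtain u where u: "(t, u) \<in> sem (cg (b # (b + 1) # rs) (b + 2) (b + 3))"
      using computesD(3)[OF g r3, of "b + 2" t y, unfolded e] y'(2) by auto
    then have w: "(t, upd (Inc b) (upd (Cpy (b + 1) (b + 2)) u)) \<in> sem (body rs b)"
      by (auto simp: body_def intro!: relcompI)
    then have "(s, upd (Inc b) (upd (Cpy (b + 1) (b + 2)) u)) \<in> sem (loop rs b)"
      using t(1) unfolding loop_iff by (blast intro: rtrancl_into_rtrancl)
    moreover have "upd (Inc b) (upd (Cpy (b + 1) (b + 2)) u) b = Suc n" using body[OF w rs] t(2) by simp
    ultimately show ?case by blast
  qed
  have sem_prog: "(s, t) \<in> sem (prec_prog cf cg (r # rs') out b) \<longleftrightarrow>
     (\<exists>u. (s, u) \<in> sem (loop rs' b) \<and> u b = u r \<and> t = u(out := u (b + 1)))" for s t b rs' r out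
    unfolding prec_prog_def list.case body_def[symmetric] by (simp add: loop_iff relcomp.simps) blast
  show ?thesis
  proof (rule computesI)
    fix rs :: "nat list" and out b :: nat and s t
    assume rs: "\<forall>r\<in>set rs. r < b" and out: "out < b"
      and st: "(s, t) \<in> sem (prec_prog cf cg rs out b)"
    then obtain r rs' where rr: "rs = r # rs'" by (cases rs) (auto simp: prec_prog_def sem_abort)
    obtain u where u: "(s, u) \<in> sem (loop rs' b)" "u b = u r" "t = u(out := u (b + 1))"
      using st unfolding rr sem_prog by blast
    note L = loop[OF u(1)]
    show "recf_eval (Prec_f f g) (map s rs) (t out) \<and> (\<forall>r<b. r \<noteq> out \<longrightarrow> t r = s r)"
      using L u rs rr out by auto
  next
    fix rs :: "nat list" and out b :: nat and s y
    assume rs: "\<forall>r\<in>set rs. r < b" and out: "out < b" and y: "recf_eval (Prec_f f g) (map s rs) y"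
    then obtain r rs' where rr: "rs = r # rs'" by (cases rs) (auto elim: recf_eval.cases)
    have rs': "\<forall>r\<in>set rs'. r < b" "r < b" using rs rr by auto
    obtain u where u: "(s, u) \<in> sem (loop rs' b)" "u b = s r"
      using loop_complete[OF _ rs'(1), of "s r" s y] y rr by auto
    note L = loop[OF u(1) rs'(1)]
    have "u b = u r" using L u(2) rs' by simp
    moreover have "u (b + 1) = y" using L u(2) y rr recf_eval_deterministic by fastforce
    ultimately have "(s, u(out := y)) \<in> sem (prec_prog cf cg rs out b)"
      using u(1) unfolding rr sem_prog by blast
    then show "\<exists>t. (s, t) \<in> sem (prec_prog cf cg rs out b) \<and> t out = y"
      by (intro exI[of _ "u(out := y)"]) (simp del: sem.simps)
  qed
qed

lemma computes_Mn:
  assumes f: "computes f cf"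
  shows "computes (Mn_f f) (mn_prog cf)"
proof -
  define body where "body rs b = cf (b # rs) (b + 1) (b + 3) ;; assert_pos (b + 1) (b + 2) ;; Cmd (Inc b)" for rs b
  have cf: "u b = s b \<and> recf_eval f (s b # map s rs) (u (b + 1)) \<and> (\<forall>r<b. u r = s r)"
    if "(s, u) \<in> sem (cf (b # rs) (b + 1) (b + 3))" and rs: "\<forall>r\<in>set rs. r < b" for s u rs b
  proof -
    have "\<forall>r\<in>set (b # rs). r < b + 3" using rs by auto
    note C = computesD(1,2)[OF f this, of "b + 1", OF _ that(1)]
    show ?thesis using C by auto
  qed
  have cf_complete: "\<exists>u. (s, u) \<in> sem (cf (b # rs) (b + 1) (b + 3)) \<and> u (b + 1) = y"
    if "recf_eval f (s b # map s rs) y" and rs: "\<forall>r\<in>set rs. r < b" for s rs b y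
  proof -
    have "\<forall>r\<in>set (b # rs). r < b + 3" using rs by auto
    then show ?thesis using computesD(3)[OF f, of "b # rs" "b + 3" "b + 1" s y] that(1) by auto
  qed
  have body_iff: "(s, t) \<in> sem (body rs b) \<longleftrightarrow>
     (\<exists>u. (s, u) \<in> sem (cf (b # rs) (b + 1) (b + 3)) \<and> 0 < u (b + 1) \<and> t = upd (Inc b) (u(b + 2 := u (b + 1))))"
    for s t rs b
    by (auto simp: body_def relcomp.simps sem_assert_pos)
  have body: "t b = Suc (s b) \<and> (\<exists>y. recf_eval f (s b # map s rs) (Suc y)) \<and> (\<forall>r<b. t r = s r)"
    if st: "(s, t) \<in> sem (body rs b)" and rs: "\<forall>r\<in>set rs. r < b" for s t rs b
  proof -
    obtain u where u: "(s, u) \<in> sem (cf (b # rs) (b + 1) (b + 3))" "0 < u (b + 1)"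
        "t = upd (Inc b) (u(b + 2 := u (b + 1)))"
      using st by (auto simp: body_iff)
    obtain y where "u (b + 1) = Suc y" using u(2) gr0_conv_Suc by blast
    then show ?thesis using cf[OF u(1) rs] u(3) by auto
  qed
  \<comment> \<open>Loop invariant: every argument below the counter has been certified to give a
    positive value.\<close>
  have loop: "(\<forall>m<t b. \<exists>y. recf_eval f (m # map s rs) (Suc y)) \<and> (\<forall>r<b. t r = s r)"
    if "(s(b := 0), t) \<in> (sem (body rs b))\<^sup>*" and rs: "\<forall>r\<in>set rs. r < b" for s t rs b
    using that(1)
  proof (induction rule: rtrancl_induct)
    case (step v w)
    note B = body[OF step(2) rs]
    have e: "map v rs = map s rs" using step.IH rs by auto
    show ?case using B[unfolded e] step.IH by (auto simp: less_Suc_eq)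
  qed simp
  have loop_complete: "\<exists>t. (s(b := 0), t) \<in> (sem (body rs b))\<^sup>* \<and> t b = n"
    if "\<forall>m<n. \<exists>y. recf_eval f (m # map s rs) (Suc y)" and rs: "\<forall>r\<in>set rs. r < b" for s rs b n
    using that(1)
  proof (induction n)
    case 0
    show ?case by (intro exI[of _ "s(b := 0)"]) simp
  next
    case (Suc n)
    then have "\<forall>m<n. \<exists>y. recf_eval f (m # map s rs) (Suc y)" by simp
    from Suc.IH[OF this] obtain t where t: "(s(b := 0), t) \<in> (sem (body rs b))\<^sup>*" "t b = n" by blast
    have e: "map t rs = map s rs" using loop[OF t(1) rs] rs by auto
    obtain y where "recf_eval f (t b # map t rs) (Suc y)" unfolding e t(2) using Suc.prems by auto
    from cf_complete[OF this rs] obtain u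
      where u: "(t, u) \<in> sem (cf (b # rs) (b + 1) (b + 3))" "u (b + 1) = Suc y" by blast
    define w where "w = upd (Inc b) (u(b + 2 := u (b + 1)))"
    have w: "(t, w) \<in> sem (body rs b)" using u by (auto simp: body_iff w_def)
    have "w b = Suc n" using body[OF w rs] t(2) by simp
    with rtrancl_into_rtrancl[OF t(1) w] show ?case by blast
  qed
  have sem_prog: "(s, t) \<in> sem (mn_prog cf rs out b) \<longleftrightarrow>
    (\<exists>u v. (s(b := 0), u) \<in> (sem (body rs b))\<^sup>* \<and> (u, v) \<in> sem (cf (b # rs) (b + 1) (b + 3)) \<and>
      v (b + 1) = 0 \<and> t = v(b + 2 := 0, out := v b))" for s t b rs out
    unfolding mn_prog_def body_def[symmetric] by (auto simp: relcomp.simps)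
  show ?thesis
  proof (rule computesI)
    fix rs :: "nat list" and out b :: nat and s t
    assume rs: "\<forall>r\<in>set rs. r < b" and out: "out < b" and st: "(s, t) \<in> sem (mn_prog cf rs out b)"
    from st obtain u v where u: "(s(b := 0), u) \<in> (sem (body rs b))\<^sup>*"
      and v: "(u, v) \<in> sem (cf (b # rs) (b + 1) (b + 3))" "v (b + 1) = 0" "t = v(b + 2 := 0, out := v b)"
      unfolding sem_prog by blast
    note L = loop[OF u rs]
    have e: "map u rs = map s rs" using L rs by auto
    note C = cf[OF v(1) rs, unfolded e]
    have "recf_eval (Mn_f f) (map s rs) (u b)"
      by (rule ev_mn) (use L C v(2) in auto)
    then show "recf_eval (Mn_f f) (map s rs) (t out) \<and> (\<forall>r<b. r \<noteq> out \<longrightarrow> t r = s r)"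
      using L C v(3) out by auto
  next
    fix rs :: "nat list" and out b :: nat and s y
    assume rs: "\<forall>r\<in>set rs. r < b" and out: "out < b" and y: "recf_eval (Mn_f f) (map s rs) y"
    from y have y': "recf_eval f (y # map s rs) 0" "\<forall>m<y. \<exists>z. recf_eval f (m # map s rs) (Suc z)"
      by (cases rule: recf_eval.cases; auto)+
    from loop_complete[OF y'(2) rs] obtain u where u: "(s(b := 0), u) \<in> (sem (body rs b))\<^sup>*" "u b = y" by blast
    have e: "map u rs = map s rs" using loop[OF u(1) rs] rs by auto
    obtain v where v: "(u, v) \<in> sem (cf (b # rs) (b + 1) (b + 3))" "v (b + 1) = 0"
      using cf_complete[OF _ rs, of u 0, unfolded e u(2), OF y'(1)] by blast
    have "(v(b + 2 := 0, out := v b)) out = y" using cf[OF v(1) rs] u(2) by simp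
    with u(1) v show "\<exists>t. (s, t) \<in> sem (mn_prog cf rs out b) \<and> t out = y"
      unfolding sem_prog by blast
  qed
qed

theorem computes_compile: "computes f (compile f)"
proof (induction f)
  case Zero_f
  show ?case by (rule computesI) (auto intro: ev_zero elim: recf_eval.cases)
next
  case Succ_f
  show ?case
  proof (rule computesI)
    fix rs :: "nat list" and out b :: nat and s t
    assume "out < b" "(s, t) \<in> sem (compile Succ_f rs out b)"
    then show "recf_eval Succ_f (map s rs) (t out) \<and> (\<forall>r<b. r \<noteq> out \<longrightarrow> t r = s r)"
      by (cases rs) (auto simp: sem_abort intro: ev_succ)
  next
    fix rs :: "nat list" and out b :: nat and s y
    assume "recf_eval Succ_f (map s rs) y"
    then obtain r rs' where "rs = r # rs'" "y = Suc (s r)" by (cases rule: recf_eval.cases) auto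
    then show "\<exists>t. (s, t) \<in> sem (compile Succ_f rs out b) \<and> t out = y" by (simp add: relcomp.simps)
  qed
next
  case (Proj_f i)
  show ?case
  proof (rule computesI)
    fix rs :: "nat list" and out b :: nat and s t
    assume "out < b" "(s, t) \<in> sem (compile (Proj_f i) rs out b)"
    then show "recf_eval (Proj_f i) (map s rs) (t out) \<and> (\<forall>r<b. r \<noteq> out \<longrightarrow> t r = s r)"
      using ev_proj[of i "map s rs"] by (auto simp: sem_abort split: if_splits)
  next
    fix rs :: "nat list" and out b :: nat and s y
    assume "recf_eval (Proj_f i) (map s rs) y"
    then have "i < length rs" "y = s (rs ! i)" by (cases rule: recf_eval.cases; simp)+
    then show "\<exists>t. (s, t) \<in> sem (compile (Proj_f i) rs out b) \<and> t out = y" by auto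
  qed
next
  case (Comp_f f gs)
  show ?case unfolding compile.simps
    using computes_Comp[OF Comp_f.IH(1), of "map compile gs" gs] Comp_f.IH(2) by simp
next
  case (Prec_f f g)
  show ?case unfolding compile.simps by (rule computes_Prec[OF Prec_f.IH])
next
  case (Mn_f f)
  show ?case unfolding compile.simps by (rule computes_Mn[OF Mn_f.IH])
qed

text \<open>Continuations of a program serve as control states.\<close>
inductive edge :: "com list \<Rightarrow> cmd \<Rightarrow> com list \<Rightarrow> bool" where
  edge_cmd: "edge (Cmd c # k) c k"
| edge_seq: "edge ((a ;; b) # k) Nop (a # b # k)"
| edge_exit: "edge (Star a # k) Nop k"
| edge_loop: "edge (Star a # k) Nop (a # Star a # k)"

inductive_set run :: "((com list \<times> (nat \<Rightarrow> nat)) \<times> com list \<times> (nat \<Rightarrow> nat)) set" where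
  "edge k c k' \<Longrightarrow> guard c s \<Longrightarrow> ((k, s), (k', upd c s)) \<in> run"

fun sem_list :: "com list \<Rightarrow> ((nat \<Rightarrow> nat) \<times> (nat \<Rightarrow> nat)) set" where
  "sem_list [] = Id"
| "sem_list (a # k) = sem a O sem_list k"

lemma run_sound: "((k, s), ([], t)) \<in> run\<^sup>* \<Longrightarrow> (s, t) \<in> sem_list k"
proof (induction "(k, s)" arbitrary: k s rule: converse_rtrancl_induct)
  case (step z)
  obtain k' c where z: "z = (k', upd c s)" and e: "edge k c k'" and g: "guard c s"
    using step(1) by (cases z) (auto elim: run.cases)
  have IH: "(upd c s, t) \<in> sem_list k'" using step(3)[OF z] .
  from e show ?case
    by (cases rule: edge.cases) (use g IH in \<open>auto intro: relcompI converse_rtrancl_into_rtrancl\<close>)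
qed simp

lemma run_complete: "(s, t) \<in> sem a \<Longrightarrow> ((a # k, s), (k, t)) \<in> run\<^sup>*"
proof (induction a arbitrary: s t k)
  case (Cmd c)
  then show ?case using run.intros[OF edge_cmd[of c k], of s] by auto
next
  case (Seq a b)
  have "(((a ;; b) # k, s), (a # b # k, s)) \<in> run" using run.intros[OF edge_seq[of a b k], of s] by simp
  moreover obtain u where "(s, u) \<in> sem a" "(u, t) \<in> sem b" using Seq.prems by auto
  ultimately show ?case
    using Seq.IH(1)[of s u "b # k"] Seq.IH(2)[of u t k] by (meson converse_rtrancl_into_rtrancl rtrancl_trans)
next
  case (Star a)
  have loop: "((Star a # k, s), (a # Star a # k, s)) \<in> run" for s using run.intros[OF edge_loop[of a k], of s] by simp
  have exit: "((Star a # k, s), (k, s)) \<in> run" for s using run.intros[OF edge_exit[of a k], of s] by simp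
  from Star.prems have "(s, t) \<in> (sem a)\<^sup>*" by simp
  then show ?case
  proof (induction rule: converse_rtrancl_induct)
    case base
    show ?case using exit by blast
  next
    case (step y z)
    have "((Star a # k, y), (Star a # k, z)) \<in> run\<^sup>*"
      using converse_rtrancl_into_rtrancl[OF loop Star.IH[OF step(1)]] .
    with step(3) show ?case by (rule rtrancl_trans[rotated])
  qed
qed

corollary run_iff: "((([a], s), ([], t)) \<in> run\<^sup>*) \<longleftrightarrow> (s, t) \<in> sem a"
  using run_sound[of "[a]" s t] run_complete[of s t a "[]"] by auto

text \<open>Contains all continuations met while the program runs in front of k, except k itself. A
  loop returns to its own continuation, which keeps the set finite and hence the control graph
  finite.\<close>

fun conts_of :: "com \<Rightarrow> com list \<Rightarrow> com list set" where
  "conts_of (Cmd c) k = {Cmd c # k}"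
| "conts_of (a ;; b) k = {(a ;; b) # k} \<union> conts_of a (b # k) \<union> conts_of b k"
| "conts_of (Star a) k = {Star a # k} \<union> conts_of a (Star a # k)"

lemma finite_conts_of: "finite (conts_of a k)"
  by (induction a arbitrary: k) auto

lemma self_mem_conts_of: "a # k \<in> conts_of a k"
  by (cases a) auto

lemma edge_conts_of: "l \<in> conts_of a k \<Longrightarrow> edge l c l' \<Longrightarrow> l' \<in> insert k (conts_of a k)"
proof (induction a arbitrary: k)
  case (Cmd d)
  then show ?case by (auto elim: edge.cases)
next
  case (Seq a b)
  from Seq.prems(1) consider "l = (a ;; b) # k" | "l \<in> conts_of a (b # k)" | "l \<in> conts_of b k" by auto
  then show ?case
  proof cases
    case 1
    with Seq.prems(2) have "l' = a # b # k" by (auto elim: edge.cases)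
    then show ?thesis using self_mem_conts_of by simp
  next
    case 2
    then show ?thesis using Seq.IH(1) Seq.prems(2) self_mem_conts_of[of b k] by fastforce
  next
    case 3
    then show ?thesis using Seq.IH(2) Seq.prems(2) by fastforce
  qed
next
  case (Star a)
  from Star.prems(1) consider "l = Star a # k" | "l \<in> conts_of a (Star a # k)" by auto
  then show ?case
  proof cases
    case 1
    with Star.prems(2) have "l' = k \<or> l' = a # Star a # k" by (auto elim: edge.cases)
    then show ?thesis using self_mem_conts_of by auto
  next
    case 2
    then show ?thesis using Star.IH Star.prems(2) by fastforce
  qed
qed

section \<open>Arithmetization of runs\<close>

inductive mreach :: "(nat \<times> cmd \<times> nat) set \<Rightarrow> nat \<Rightarrow> nat \<Rightarrow> (nat \<Rightarrow> nat) \<Rightarrow> bool" for E n where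
  mreach_init: "mreach E n 1 ((\<lambda>_. 0)(0 := n))"
| mreach_step: "mreach E n l s \<Longrightarrow> (l, c, l') \<in> E \<Longrightarrow> guard c s \<Longrightarrow> mreach E n l' (upd c s)"

lemma finite_edges: "finite {(c, k'). edge k c k'}"
proof (cases k)
  case Nil
  then have "{(c, k'). edge k c k'} = {}" by (auto elim: edge.cases)
  then show ?thesis by simp
next
  case (Cons a l)
  show ?thesis
  proof (cases a)
    case (Cmd c)
    then have "{(c, k'). edge k c k'} \<subseteq> {(c, l)}" using Cons by (auto elim: edge.cases)
    then show ?thesis by (rule finite_subset) simp
  next
    case (Seq a1 a2)
    then have "{(c, k'). edge k c k'} \<subseteq> {(Nop, a1 # a2 # l)}" using Cons by (auto elim: edge.cases)
    then show ?thesis by (rule finite_subset) simp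
  next
    case (Star a1)
    then have "{(c, k'). edge k c k'} \<subseteq> {(Nop, l), (Nop, a1 # Star a1 # l)}"
      using Cons by (auto elim: edge.cases)
    then show ?thesis by (rule finite_subset) simp
  qed
qed

theorem halting_machine:
  "\<exists>E. finite E \<and> (\<forall>n. (\<exists>s. mreach E n 0 s) \<longleftrightarrow> (\<exists>y. recf_eval f [n] y))"
proof -
  define p where "p = compile f [0] 1 2"
  define R where "R = insert [] (conts_of p [])"
  have finR: "finite R" by (simp add: R_def finite_conts_of)
  have pR: "[p] \<in> R" by (simp add: R_def self_mem_conts_of)
  have R_edge: "k' \<in> R" if "k \<in> R" "edge k c k'" for k c k'
    using that edge_conts_of[of k p "[]" c k'] by (auto simp: R_def elim: edge.cases)
  obtain g :: "com list \<Rightarrow> nat" where g: "inj_on g R"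
    using finite_imp_inj_to_nat_seg[OF finR] by blast
  \<comment> \<open>Halting gets label 0, so that the squared label, which \<open>xval\<close> adds
    at the end, vanishes exactly for a halted run. The start of \<open>mreach\<close> is 1, and the
    shift by 2 keeps the other labels apart.\<close>
  define lab where "lab k = (if k = [] then 0 else if k = [p] then 1 else g k + 2)" for k
  have lab_inj: "k = k'" if "k \<in> R" "k' \<in> R" "lab k = lab k'" for k k'
    using that g by (auto simp: lab_def inj_on_def split: if_splits)
  define E where "E = (\<Union>k\<in>R. (\<lambda>(c, k'). (lab k, c, lab k')) ` {(c, k'). edge k c k'})"
  have finE: "finite E" by (simp add: E_def finR finite_edges)
  have run_R: "k' \<in> R" if "((k, s), (k', s')) \<in> run\<^sup>*" "k \<in> R" for k s k' s'
    using that by (induction rule: rtrancl_induct2) (auto elim!: run.cases intro: R_edge)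
  have mreach_iff: "mreach E n l s \<longleftrightarrow> (\<exists>k\<in>R. lab k = l \<and> (([p], (\<lambda>_. 0)(0 := n)), (k, s)) \<in> run\<^sup>*)"
    (is "_ \<longleftrightarrow> ?run l s") for n l s
  proof
    assume "mreach E n l s"
    then show "?run l s"
    proof induction
      case mreach_init
      have "lab [p] = 1" by (simp add: lab_def)
      with pR show ?case by blast
    next
      case (mreach_step l s c l')
      then obtain k where k: "k \<in> R" "lab k = l" "(([p], (\<lambda>_. 0)(0 := n)), (k, s)) \<in> run\<^sup>*" by blast
      from mreach_step(2) obtain k0 k' where k0: "k0 \<in> R" "edge k0 c k'" "lab k0 = l" "lab k' = l'"
        by (auto simp: E_def)
      with k lab_inj have "k0 = k" by metis
      then have "((k, s), (k', upd c s)) \<in> run" using k0 mreach_step(3) by (auto intro: run.intros)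
      with k(3) have "(([p], (\<lambda>_. 0)(0 := n)), (k', upd c s)) \<in> run\<^sup>*" by (rule rtrancl_into_rtrancl)
      then show ?case using R_edge k0 by blast
    qed
  next
    assume "?run l s"
    then obtain k where k: "k \<in> R" "lab k = l" "(([p], (\<lambda>_. 0)(0 := n)), (k, s)) \<in> run\<^sup>*" by blast
    from k(3) have "mreach E n (lab k) s"
    proof (induction rule: rtrancl_induct2)
      case refl
      have "lab [p] = 1" by (simp add: lab_def)
      then show ?case using mreach_init[of E n] by (simp only: )
    next
      case (step k s k' s')
      from step(2) obtain c where c: "edge k c k'" "guard c s" "s' = upd c s" by (auto elim: run.cases)
      have "k \<in> R" using run_R[OF step(1) pR] .
      then have "(lab k, c, lab k') \<in> E" using c(1) by (force simp: E_def)
      with step(3) c show ?case by (auto intro: mreach_step)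
    qed
    with k show "mreach E n l s" by simp
  qed
  have "(\<exists>s. mreach E n 0 s) \<longleftrightarrow> (\<exists>y. recf_eval f [n] y)" for n
  proof -
    have "lab k = 0 \<longleftrightarrow> k = []" for k by (simp add: lab_def)
    moreover have "[] \<in> R" by (simp add: R_def)
    ultimately have "(\<exists>s. mreach E n 0 s) \<longleftrightarrow> (\<exists>t. (([p], (\<lambda>_. 0)(0 := n)), ([], t)) \<in> run\<^sup>*)"
      by (auto simp: mreach_iff)
    also have "\<dots> \<longleftrightarrow> (\<exists>t. ((\<lambda>_. 0)(0 := n), t) \<in> sem p)" by (simp add: run_iff)
    also have "\<dots> \<longleftrightarrow> (\<exists>y. recf_eval f [n] y)"
      using computesD(1,3)[OF computes_compile[of f], of "[0]" 2 1 "(\<lambda>_. 0)(0 := n)"] by (auto simp: p_def)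
    finally show ?thesis .
  qed
  with finE show ?thesis by blast
qed

text \<open>\<open>In\<close> adds a unit to the input register, \<open>Pad\<close> serves to repeat
  every size, and \<open>XY\<close> and \<open>XX\<close> produce arbitrary accumulators with x
  \<ge> y. An edge is applied whether or not it fits the current location.\<close>

datatype op = In | Pad | XY | XX | Ed nat cmd nat

type_synonym state = "nat \<times> nat \<times> nat \<times> (nat \<Rightarrow> nat)"

text \<open>\<open>sq_sum\<close> and \<open>twice_prod\<close> are the positive and the negative
  terms of the squared difference of the tested registers.\<close>

fun sq_sum :: "cmd \<Rightarrow> (nat \<Rightarrow> nat) \<Rightarrow> nat" where
  "sq_sum (Eq i j) s = s i * s i + s j * s j"
| "sq_sum _ s = 0"

fun twice_prod :: "cmd \<Rightarrow> (nat \<Rightarrow> nat) \<Rightarrow> nat" where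
  "twice_prod (Eq i j) s = 2 * (s i * s j)"
| "twice_prod _ s = 0"

text \<open>An edge adds to the difference of the first two components the square of the control
  mismatch, and for an equality test also the square of the difference of the two registers.
  So that difference stays 0 exactly along the legal runs.\<close>
fun act :: "op \<Rightarrow> state \<Rightarrow> state" where
  "act In (x, y, pc, s) = (x, y, pc, s(0 := Suc (s 0)))"
| "act Pad \<sigma> = \<sigma>"
| "act XY (x, y, pc, s) = (Suc x, Suc y, pc, s)"
| "act XX (x, y, pc, s) = (Suc x, y, pc, s)"
| "act (Ed l c l') (x, y, pc, s) =
     (x + (pc * pc + l * l) + sq_sum c s, y + 2 * (l * pc) + twice_prod c s, l', upd c s)"

definition start :: state where "start = (0, 0, 1, \<lambda>_. 0)"

text \<open>The extra summand is the squared distance of the last location from the halting location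
  0.\<close>

fun xval :: "state \<Rightarrow> nat" where "xval (x, y, pc, s) = x + pc * pc"
fun yval :: "state \<Rightarrow> nat" where "yval (x, y, pc, s) = y"

text \<open>An injective pairing of the two values that is a polynomial with natural coefficients;
  the final 1 keeps every class nonempty.\<close>

definition size_of :: "state \<Rightarrow> nat" where
  "size_of \<sigma> = (xval \<sigma> + yval \<sigma>) * (xval \<sigma> + yval \<sigma>) + xval \<sigma> + 1"

lemma size_of_pos: "0 < size_of \<sigma>" by (simp add: size_of_def)

text \<open>Since x \<le> x + y, the value lies between the square of x + y and the next square,
  which determines x + y.\<close>

lemma square_plus_inj:
  fixes x y x' y' :: nat
  assumes "(x + y) * (x + y) + x = (x' + y') * (x' + y') + x'"
  shows "x = x' \<and> y = y'"
proof -
  have False if eq: "a * a + b = c * c + d" and "b \<le> a" "d \<le> c" "a < c" for a b c d :: nat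
  proof -
    have "(a + 1) * (a + 1) \<le> c * c" using \<open>a < c\<close> by (intro mult_le_mono) auto
    then show False using eq \<open>b \<le> a\<close> by (simp add: algebra_simps)
  qed
  from this[of "x + y" x "x' + y'" x'] this[of "x' + y'" x' "x + y" x] assms
  have "x + y = x' + y'" by (metis le_add1 linorder_neqE_nat)
  with assms show ?thesis by simp
qed

lemma size_of_inj: "size_of \<sigma> = size_of \<tau> \<Longrightarrow> xval \<sigma> = xval \<tau> \<and> yval \<sigma> = yval \<tau>"
  by (rule square_plus_inj) (simp add: size_of_def)

lemma square_mismatch: "2 * (a * b) \<le> a * a + b * (b::nat)" "2 * (a * b) = a * a + b * b \<longleftrightarrow> a = b"
proof -
  have "2 * (a * b) \<le> a * a + b * b \<and> (2 * (a * b) = a * a + b * b \<longleftrightarrow> a = b)"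
  proof (cases a b rule: le_cases)
    case le
    then obtain d where "b = a + d" using le_Suc_ex by blast
    then show ?thesis by (simp add: algebra_simps)
  next
    case ge
    then obtain d where "a = b + d" using le_Suc_ex by blast
    then show ?thesis by (simp add: algebra_simps)
  qed
  then show "2 * (a * b) \<le> a * a + b * (b::nat)" "2 * (a * b) = a * a + b * b \<longleftrightarrow> a = b" by auto
qed

lemma twice_prod_le: "twice_prod c s \<le> sq_sum c s"
  by (cases c) (auto simp: square_mismatch)

lemma twice_prod_eq_iff: "twice_prod c s = sq_sum c s \<longleftrightarrow> guard c s"
  by (cases c) (auto simp: square_mismatch)

declare foldr_replicate [simp del]

text \<open>Words are read from the right: the head of the list acts last.\<close>
definition state_after :: "nat \<Rightarrow> op list \<Rightarrow> state" where
  "state_after n ws = foldr act (ws @ replicate n In) start"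

lemma state_after_Cons [simp]: "state_after n (w # ws) = act w (state_after n ws)"
  by (simp add: state_after_def)

lemma state_after_append: "state_after n (vs @ ws) = foldr act vs (state_after n ws)"
  by (simp add: state_after_def)

lemma state_after_Nil: "state_after n [] = (0, 0, 1, (\<lambda>_. 0)(0 := n))"
  unfolding state_after_def append_Nil
proof (induction n)
  case 0
  show ?case by (simp add: start_def fun_eq_iff)
next
  case (Suc n)
  then show ?case by (simp add: fun_eq_iff)
qed

definition E_ops :: "(nat \<times> cmd \<times> nat) set \<Rightarrow> op set" where
  "E_ops E = {Ed l c l' | l c l'. (l, c, l') \<in> E}"

text \<open>No letter decreases x - y, so a positive difference is never repaired; equality at the
  end forces every edge to match its location and to pass its test.\<close>

lemma act_invariant:
  assumes "set ws \<subseteq> {Pad, XY, XX} \<union> E_ops E"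
    and "state_after n ws = (x, y, pc, s)"
  shows "y \<le> x \<and> (x = y \<longrightarrow> mreach E n pc s)"
  using assms
proof (induction ws arbitrary: x y pc s)
  case Nil
  then show ?case using mreach_init[of E n] by (auto simp: state_after_Nil)
next
  case (Cons w ws)
  obtain x0 y0 pc0 s0 where \<sigma>: "state_after n ws = (x0, y0, pc0, s0)"
    by (cases "state_after n ws") auto
  have IH: "y0 \<le> x0" "x0 = y0 \<Longrightarrow> mreach E n pc0 s0" using Cons.IH[OF _ \<sigma>] Cons.prems(1) by auto
  have eq: "act w (x0, y0, pc0, s0) = (x, y, pc, s)" using Cons.prems(2) \<sigma> by simp
  consider "w = Pad" | "w = XY" | "w = XX" | l c l' where "w = Ed l c l'" "(l, c, l') \<in> E"
    using Cons.prems(1) by (auto simp: E_ops_def)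
  then show ?case
  proof cases
    case (4 l c l')
    then have e: "x = x0 + (pc0 * pc0 + l * l) + sq_sum c s0" "y = y0 + 2 * (l * pc0) + twice_prod c s0"
      "pc = l'" "s = upd c s0" using eq by auto
    have 1: "2 * (l * pc0) \<le> pc0 * pc0 + l * l" using square_mismatch(1)[of l pc0] by simp
    have 2: "twice_prod c s0 \<le> sq_sum c s0" by (rule twice_prod_le)
    have "mreach E n pc s" if "x = y"
    proof -
      have "x0 = y0" "2 * (l * pc0) = l * l + pc0 * pc0" "twice_prod c s0 = sq_sum c s0"
        using that e 1 2 IH(1) by linarith+
      then show ?thesis using IH(2) 4(2) e square_mismatch(2)[of l pc0] twice_prod_eq_iff
        by (auto intro: mreach_step)
    qed
    then show ?thesis using e 1 2 IH(1) by simp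
  qed (use eq IH in auto)
qed

lemma mreach_word:
  assumes "mreach E n pc s"
  shows "\<exists>ws x. set ws \<subseteq> E_ops E \<and> state_after n ws = (x, x, pc, s)"
  using assms
proof induction
  case mreach_init
  show ?case by (intro exI[of _ "[]"]) (simp add: state_after_Nil fun_eq_iff)
next
  case (mreach_step l s c l')
  then obtain ws x where ws: "set ws \<subseteq> E_ops E"
    "state_after n ws = (x, x, l, s)" by blast
  have "set (Ed l c l' # ws) \<subseteq> E_ops E" using ws(1) mreach_step(2) by (auto simp: E_ops_def)
  moreover have "twice_prod c s = sq_sum c s" using mreach_step(3) by (simp add: twice_prod_eq_iff)
  ultimately show ?case
    using ws(2) by (intro exI[of _ "Ed l c l' # ws"] exI[of _ "x + 2 * (l * l) + sq_sum c s"]) simp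
qed

lemma halting_word_iff:
  "(\<exists>ws. set ws \<subseteq> {Pad, XY, XX} \<union> E_ops E \<and>
     xval (state_after n ws) = yval (state_after n ws))
   \<longleftrightarrow> (\<exists>s. mreach E n 0 s)"
proof
  assume "\<exists>ws. set ws \<subseteq> {Pad, XY, XX} \<union> E_ops E \<and>
     xval (state_after n ws) = yval (state_after n ws)"
  then obtain ws where ws: "set ws \<subseteq> {Pad, XY, XX} \<union> E_ops E"
    "xval (state_after n ws) = yval (state_after n ws)"
    by blast
  obtain x y pc s where \<sigma>: "state_after n ws = (x, y, pc, s)"
    by (cases "state_after n ws") auto
  \<comment> \<open>Together with y \<le> x this forces pc = 0 and x = y.\<close>
  have "x + pc * pc = y" using ws(2) \<sigma> by simp
  with act_invariant[OF ws(1) \<sigma>] have "pc = 0" "mreach E n pc s" by auto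
  then show "\<exists>s. mreach E n 0 s" by blast
next
  assume "\<exists>s. mreach E n 0 s"
  then obtain ws x s where ws: "set ws \<subseteq> E_ops E"
    "state_after n ws = (x, x, 0, s)" using mreach_word by blast
  then show "\<exists>ws. set ws \<subseteq> {Pad, XY, XX} \<union> E_ops E \<and>
     xval (state_after n ws) = yval (state_after n ws)"
    by (intro exI[of _ ws]) auto
qed

lemma yval_le_xval:
  assumes "set ws \<subseteq> {Pad, XY, XX} \<union> E_ops E"
  shows "yval (state_after n ws) \<le> xval (state_after n ws)"
proof -
  obtain x y pc s where \<sigma>: "state_after n ws = (x, y, pc, s)"
    by (cases "state_after n ws") auto
  from act_invariant[OF assms \<sigma>] \<sigma> show ?thesis by simp
qed

text \<open>Without edges the location stays 1 and contributes 1 to \<open>xval\<close>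
  alone.\<close>

lemma yval_less_xval_simple:
  assumes "set ws \<subseteq> {Pad, XY, XX}"
  shows "yval (state_after n ws) < xval (state_after n ws)"
proof -
  have "\<exists>x y s. y \<le> x \<and> state_after n ws = (x, y, 1, s)"
    using assms
  proof (induction ws)
    case (Cons w ws)
    then obtain x y s where "y \<le> x" "state_after n ws = (x, y, 1, s)" by auto
    with Cons.prems show ?case by auto
  qed (simp add: state_after_Nil)
  then show ?thesis by auto
qed

lemma simple_word:
  assumes "b < a"
  shows "\<exists>ws. set ws \<subseteq> {Pad, XY, XX} \<and>
    xval (state_after n ws) = a \<and>
    yval (state_after n ws) = b"
proof -
  have 1: "state_after n (replicate i XX) = (i, 0, 1, (\<lambda>_. 0)(0 := n))" for i
    by (induction i) (auto simp: state_after_Nil)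
  have 2: "foldr act (replicate i XY) (x, y, pc, s) = (x + i, y + i, pc, s)" for i x y pc s
    by (induction i) auto
  \<comment> \<open>One unit of the difference comes from the location 1, hence a - b - 1 copies of
    \<open>XX\<close>.\<close>
  show ?thesis
    by (intro exI[of _ "replicate b XY @ replicate (a - b - 1) XX"])
      (use assms in \<open>auto simp: state_after_append 1 2\<close>)
qed

text \<open>Simple words already realize every pair with \<open>yval\<close> below
  \<open>xval\<close>. Edges can therefore add only pairs with equal components, which occur exactly
  for halting runs; by injectivity of \<open>size_of\<close> their sizes are new.\<close>

theorem sizes_iff_halting:
  "(\<exists>s. mreach E n 0 s) \<longleftrightarrow>
   (\<lambda>ws. size_of (state_after n ws)) ` {ws. set ws \<subseteq> {Pad, XY, XX} \<union> E_ops E} \<noteq>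
   (\<lambda>ws. size_of (state_after n ws)) ` {ws. set ws \<subseteq> {Pad, XY, XX}}"
proof -
  have "(\<lambda>ws. size_of (state_after n ws)) ` {ws. set ws \<subseteq> {Pad, XY, XX} \<union> E_ops E} =
     (\<lambda>ws. size_of (state_after n ws)) ` {ws. set ws \<subseteq> {Pad, XY, XX}}"
    if "\<nexists>s. mreach E n 0 s"
  proof
    show "(\<lambda>ws. size_of (state_after n ws)) ` {ws. set ws \<subseteq> {Pad, XY, XX} \<union> E_ops E} \<subseteq>
       (\<lambda>ws. size_of (state_after n ws)) ` {ws. set ws \<subseteq> {Pad, XY, XX}}"
    proof
      fix m assume "m \<in> (\<lambda>ws. size_of (state_after n ws)) ` {ws. set ws \<subseteq> {Pad, XY, XX} \<union> E_ops E}"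
      then obtain ws where ws: "set ws \<subseteq> {Pad, XY, XX} \<union> E_ops E" "m = size_of (state_after n ws)" by blast
      have "yval (state_after n ws) \<le> xval (state_after n ws)" using yval_le_xval[OF ws(1), of n] .
      moreover have "xval (state_after n ws) \<noteq> yval (state_after n ws)"
        using that ws(1) unfolding halting_word_iff[symmetric] by blast
      ultimately have "yval (state_after n ws) < xval (state_after n ws)" by simp
      from simple_word[OF this, of n] obtain vs where "set vs \<subseteq> {Pad, XY, XX}"
        "xval (state_after n vs) = xval (state_after n ws)" "yval (state_after n vs) = yval (state_after n ws)" by blast
      then show "m \<in> (\<lambda>ws. size_of (state_after n ws)) ` {ws. set ws \<subseteq> {Pad, XY, XX}}"
        using ws(2) by (intro image_eqI[of _ _ vs]) (auto simp: size_of_def)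
    qed
  qed auto
  moreover have "(\<lambda>ws. size_of (state_after n ws)) ` {ws. set ws \<subseteq> {Pad, XY, XX} \<union> E_ops E} \<noteq>
     (\<lambda>ws. size_of (state_after n ws)) ` {ws. set ws \<subseteq> {Pad, XY, XX}}"
    if "\<exists>s. mreach E n 0 s"
  proof
    assume eq: "(\<lambda>ws. size_of (state_after n ws)) ` {ws. set ws \<subseteq> {Pad, XY, XX} \<union> E_ops E} =
     (\<lambda>ws. size_of (state_after n ws)) ` {ws. set ws \<subseteq> {Pad, XY, XX}}"
    from that obtain ws where ws: "set ws \<subseteq> {Pad, XY, XX} \<union> E_ops E" "xval (state_after n ws) = yval (state_after n ws)"
      unfolding halting_word_iff[symmetric] by blast
    then have "size_of (state_after n ws) \<in> (\<lambda>ws. size_of (state_after n ws)) ` {ws. set ws \<subseteq> {Pad, XY, XX}}"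
      unfolding eq[symmetric] by blast
    then obtain vs where vs: "set vs \<subseteq> {Pad, XY, XX}" "size_of (state_after n ws) = size_of (state_after n vs)" by blast
    have "yval (state_after n vs) < xval (state_after n vs)" using yval_less_xval_simple[OF vs(1), of n] .
    with size_of_inj[OF vs(2)] ws(2) show False by simp
  qed
  ultimately show ?thesis by blast
qed

section \<open>Linear systems of weights\<close>

text \<open>Linear combinations as sums with repetition instead of coefficients: each summand later
  becomes one nondeterministic choice of an automaton.\<close>

inductive_set nspan :: "('a \<Rightarrow> nat) set \<Rightarrow> ('a \<Rightarrow> nat) set" for S where
  nspan_zero: "(\<lambda>_. 0) \<in> nspan S"
| nspan_step: "g \<in> S \<Longrightarrow> f \<in> nspan S \<Longrightarrow> (\<lambda>x. g x + f x) \<in> nspan S"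

lemma nspan_add: "f \<in> nspan S \<Longrightarrow> g \<in> nspan S \<Longrightarrow> (\<lambda>x. f x + g x) \<in> nspan S"
  by (induction rule: nspan.induct) (auto simp: add.assoc intro: nspan_step)

lemma nspan_base: "g \<in> S \<Longrightarrow> g \<in> nspan S"
  using nspan_step[OF _ nspan_zero, of g S] by simp

lemma nspan_scale: "f \<in> nspan S \<Longrightarrow> (\<lambda>x. c * f x) \<in> nspan S"
  by (induction c) (auto intro: nspan_zero nspan_add)

lemma nspan_bind:
  assumes "f \<in> nspan S" "\<And>g. g \<in> S \<Longrightarrow> (\<lambda>x. g (h x)) \<in> nspan T"
  shows "(\<lambda>x. f (h x)) \<in> nspan T"
  using assms(1) by (induction rule: nspan.induct) (auto intro: nspan_zero nspan_add assms(2))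

lemma nspan_mono: "S \<subseteq> T \<Longrightarrow> f \<in> nspan S \<Longrightarrow> f \<in> nspan T"
  using nspan_bind[of f S id T] by (auto intro: nspan_base)

definition products :: "('a \<Rightarrow> nat) set \<Rightarrow> ('a \<Rightarrow> nat) set" where
  "products S = {(\<lambda>x. f x * g x) | f g. f \<in> S \<and> g \<in> S}"

lemma finite_products: assumes "finite S" shows "finite (products S)"
proof -
  have "products S = (\<lambda>(f, g). \<lambda>x. f x * g x) ` (S \<times> S)" by (auto simp: products_def)
  with assms show ?thesis by simp
qed

lemma nspan_products:
  assumes "f \<in> nspan S" "g \<in> nspan S" shows "(\<lambda>x. f x * g x) \<in> nspan (products S)"
  using assms(1)
proof (induction rule: nspan.induct)
  case (nspan_step h f)
  from assms(2) have "(\<lambda>x. h x * g x) \<in> nspan (products S)"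
  proof (induction rule: nspan.induct)
    case (nspan_step h' g)
    have "(\<lambda>x. h x * h' x) \<in> products S" using \<open>h \<in> S\<close> nspan_step(1) by (auto simp: products_def)
    from nspan.nspan_step[OF this nspan_step(3)] show ?case by (simp add: distrib_left)
  qed (simp add: nspan_zero)
  from nspan_add[OF this nspan_step(3)] show ?case by (simp add: distrib_right)
qed (simp add: nspan_zero)

lemma nspan_sum_list:
  "f \<in> nspan (set fs) \<Longrightarrow> \<exists>js. set js \<subseteq> {..<length fs} \<and> f = (\<lambda>x. \<Sum>i\<leftarrow>js. (fs ! i) x)"
proof (induction rule: nspan.induct)
  case nspan_zero
  show ?case by (intro exI[of _ "[]"]) simp
next
  case (nspan_step g f)
  then obtain js i where "set js \<subseteq> {..<length fs}" "f = (\<lambda>x. \<Sum>i\<leftarrow>js. (fs ! i) x)"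
    "i < length fs" "g = fs ! i" by (auto simp: in_set_conv_nth)
  then show ?case by (intro exI[of _ "i # js"]) simp
qed

text \<open>For finite S this says that every operation acts on S by a matrix of natural
  numbers.\<close>

definition shift_closed :: "('b \<Rightarrow> 'a \<Rightarrow> 'a) \<Rightarrow> 'b set \<Rightarrow> ('a \<Rightarrow> nat) set \<Rightarrow> bool" where
  "shift_closed h B S \<longleftrightarrow> (\<forall>b\<in>B. \<forall>f\<in>S. (\<lambda>x. f (h b x)) \<in> nspan S)"

text \<open>Precomposition with an operation is multiplicative.\<close>

lemma shift_closed_products: "shift_closed h B S \<Longrightarrow> shift_closed h B (products S)"
  unfolding shift_closed_def by (auto simp: products_def[of S] intro: nspan_products[unfolded products_def])

lemma shift_closed_insert:
  assumes "shift_closed h B S" "f \<in> nspan S" shows "shift_closed h B (insert f S)"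
proof -
  have "(\<lambda>x. g (h b x)) \<in> nspan S" if "b \<in> B" "g \<in> insert f S" for b g
    using that assms nspan_bind[of f S "h b" S] by (auto simp: shift_closed_def)
  then show ?thesis unfolding shift_closed_def using nspan_mono[of S "insert f S"] by blast
qed

section \<open>Functions of the store, graded by degree\<close>

fun regs :: "cmd \<Rightarrow> nat set" where
  "regs Nop = {}"
| "regs (Zro i) = {i}"
| "regs (Cpy i j) = {i, j}"
| "regs (Inc i) = {i}"
| "regs (Eq i j) = {i, j}"

fun op_regs :: "op \<Rightarrow> nat set" where
  "op_regs (Ed l c l') = regs c"
| "op_regs _ = {}"

fun pcval :: "state \<Rightarrow> nat" where "pcval (x, y, pc, s) = pc"
fun xacc :: "state \<Rightarrow> nat" where "xacc (x, y, pc, s) = x"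
fun reg :: "nat \<Rightarrow> state \<Rightarrow> nat" where "reg i (x, y, pc, s) = s i"

definition linear_part :: "nat \<Rightarrow> (state \<Rightarrow> nat) set" where
  "linear_part N = {\<lambda>_. 1, pcval} \<union> reg ` {..<N}"

text \<open>The accumulators receive increments of degree two in the location and the registers, so
  they count as degree two themselves. \<open>size_of\<close>, which is quadratic in them, then
  lives in the products of this set.\<close>

definition quadratic_part :: "nat \<Rightarrow> (state \<Rightarrow> nat) set" where
  "quadratic_part N = {xacc, yval} \<union> products (linear_part N)"

lemma linear_part_const: "(\<lambda>_. c) \<in> nspan (linear_part N)"
proof -
  have "(\<lambda>_. 1) \<in> nspan (linear_part N)" by (rule nspan_base) (simp add: linear_part_def)
  from nspan_scale[OF this, of c] show ?thesis by simp
qed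

lemma linear_part_pc: "pcval \<in> nspan (linear_part N)"
  by (rule nspan_base) (simp add: linear_part_def)

lemma linear_part_reg: "i < N \<Longrightarrow> reg i \<in> nspan (linear_part N)"
  by (rule nspan_base) (simp add: linear_part_def)

text \<open>After a command a register holds 0, some old register, or its own value plus 1.\<close>

lemma reg_upd_span:
  assumes "regs c \<subseteq> {..<N}" "i < N"
  shows "(\<lambda>(x, y, pc, s). upd c s i) \<in> nspan (linear_part N)"
proof -
  have "(\<lambda>(x, y, pc, s). upd c s i) \<in> {\<lambda>_. 0} \<union> reg ` {..<N} \<union> {\<lambda>\<sigma>. 1 + reg i \<sigma>}"
    using assms by (cases c) (auto simp: fun_eq_iff image_iff Bex_def)
  then show ?thesis
    using assms(2) nspan_add[OF linear_part_const[of 1 N] linear_part_reg[OF assms(2)]]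
    by (auto intro: linear_part_reg linear_part_const)
qed

lemma linear_part_shift_closed:
  assumes "\<Union> (op_regs ` B) \<subseteq> {..<N}"
  shows "shift_closed act B (linear_part N)"
  unfolding shift_closed_def
proof (intro ballI)
  fix b f assume b: "b \<in> B" and f: "f \<in> linear_part N"
  from f consider "f = (\<lambda>_. 1)" | "f = pcval" | i where "i < N" "f = reg i"
    by (auto simp: linear_part_def)
  then show "(\<lambda>\<sigma>. f (act b \<sigma>)) \<in> nspan (linear_part N)"
  proof cases
    case 1
    then show ?thesis by (simp add: linear_part_const)
  next
    case 2
    have "(\<lambda>\<sigma>. pcval (act b \<sigma>)) = pcval \<or> (\<exists>l. (\<lambda>\<sigma>. pcval (act b \<sigma>)) = (\<lambda>_. l))"
      by (cases b) (auto simp: fun_eq_iff)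
    with 2 show ?thesis using linear_part_pc linear_part_const by metis
  next
    case 3
    show ?thesis
    proof (cases "\<exists>l c l'. b = Ed l c l'")
      case True
      then obtain l c l' where bc: "b = Ed l c l'" by blast
      have "(\<lambda>\<sigma>. f (act b \<sigma>)) = (\<lambda>(x, y, pc, s). upd c s i)" using 3 bc by (auto simp: fun_eq_iff)
      moreover have "regs c \<subseteq> {..<N}" using assms b bc by force
      ultimately show ?thesis using reg_upd_span 3 by simp
    next
      case False
      then have "(\<lambda>\<sigma>. f (act b \<sigma>)) = reg i \<or> (\<lambda>\<sigma>. f (act b \<sigma>)) = (\<lambda>\<sigma>. 1 + reg i \<sigma>)"
        using 3 by (cases b) (auto simp: fun_eq_iff)
      then show ?thesis using 3(1) linear_part_reg nspan_add[OF linear_part_const[of 1]] by metis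
    qed
  qed
qed

lemma quadratic_part_shift_closed:
  assumes "\<Union> (op_regs ` B) \<subseteq> {..<N}"
  shows "shift_closed act B (quadratic_part N)"
  unfolding shift_closed_def
proof (intro ballI)
  fix b f assume b: "b \<in> B" and f: "f \<in> quadratic_part N"
  have prod: "g \<in> nspan (quadratic_part N)" if "g \<in> nspan (products (linear_part N))" for g
    using that nspan_mono[of "products (linear_part N)" "quadratic_part N"] by (auto simp: quadratic_part_def)
  have base: "xacc \<in> nspan (quadratic_part N)" "yval \<in> nspan (quadratic_part N)"
    by (auto intro!: nspan_base simp: quadratic_part_def)
  have const: "(\<lambda>_. k) \<in> nspan (quadratic_part N)" for k
    using prod[OF nspan_products[OF linear_part_const[of k] linear_part_const[of 1]]] by simp
  have simple: "(\<lambda>\<sigma>. f (act b \<sigma>)) \<in> nspan (quadratic_part N)"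
    if "f = xacc \<or> f = yval" "\<forall>l c l'. b \<noteq> Ed l c l'"
  proof -
    have "(\<lambda>\<sigma>. f (act b \<sigma>)) = f \<or> (\<lambda>\<sigma>. f (act b \<sigma>)) = (\<lambda>\<sigma>. f \<sigma> + 1)"
      using that by (cases b) (auto simp: fun_eq_iff)
    then show ?thesis
      using that(1) base nspan_add[OF base(1) const[of 1]] nspan_add[OF base(2) const[of 1]] by metis
  qed
  from f consider "f \<in> products (linear_part N)" | "f = xacc" | "f = yval"
    by (auto simp: quadratic_part_def)
  then show "(\<lambda>\<sigma>. f (act b \<sigma>)) \<in> nspan (quadratic_part N)"
  proof cases
    case 1
    then show ?thesis
      using shift_closed_products[OF linear_part_shift_closed[OF assms]] b prod by (auto simp: shift_closed_def)
  next
    case 2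
    show ?thesis
    proof (cases b)
      case (Ed l c l')
      then have c: "regs c \<subseteq> {..<N}" using assms b by force
      have "(\<lambda>\<sigma>. case \<sigma> of (x, y, pc, s) \<Rightarrow> sq_sum c s) \<in> nspan (quadratic_part N)"
      proof (cases c)
        case (Eq i j)
        have "(\<lambda>\<sigma>. case \<sigma> of (x, y, pc, s) \<Rightarrow> sq_sum c s) = (\<lambda>\<sigma>. reg i \<sigma> * reg i \<sigma> + reg j \<sigma> * reg j \<sigma>)"
          using Eq by (auto simp: fun_eq_iff)
        with c Eq show ?thesis by (auto intro!: nspan_add prod nspan_products linear_part_reg)
      qed (simp_all add: const)
      moreover have "(\<lambda>\<sigma>. pcval \<sigma> * pcval \<sigma>) \<in> nspan (quadratic_part N)"
        by (intro prod nspan_products linear_part_pc)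
      moreover have "(\<lambda>\<sigma>. f (act b \<sigma>)) = (\<lambda>\<sigma>. xacc \<sigma> + (pcval \<sigma> * pcval \<sigma> + l * l) +
          (case \<sigma> of (x, y, pc, s) \<Rightarrow> sq_sum c s))"
        using 2 Ed by (auto simp: fun_eq_iff)
      ultimately show ?thesis using base const by (auto intro!: nspan_add)
    qed (use 2 simple in simp_all)
  next
    case 3
    show ?thesis
    proof (cases b)
      case (Ed l c l')
      then have c: "regs c \<subseteq> {..<N}" using assms b by force
      have "(\<lambda>\<sigma>. case \<sigma> of (x, y, pc, s) \<Rightarrow> twice_prod c s) \<in> nspan (quadratic_part N)"
      proof (cases c)
        case (Eq i j)
        have "(\<lambda>\<sigma>. case \<sigma> of (x, y, pc, s) \<Rightarrow> twice_prod c s) = (\<lambda>\<sigma>. 2 * (reg i \<sigma> * reg j \<sigma>))"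
          using Eq by (auto simp: fun_eq_iff)
        with c Eq show ?thesis by (auto intro!: nspan_scale prod nspan_products linear_part_reg)
      qed (simp_all add: const)
      moreover have "(\<lambda>\<sigma>. 2 * (l * pcval \<sigma>)) \<in> nspan (quadratic_part N)"
        by (intro nspan_scale prod nspan_products linear_part_pc linear_part_const)
      moreover have "(\<lambda>\<sigma>. f (act b \<sigma>)) = (\<lambda>\<sigma>. yval \<sigma> + 2 * (l * pcval \<sigma>) +
          (case \<sigma> of (x, y, pc, s) \<Rightarrow> twice_prod c s))"
        using 3 Ed by (auto simp: fun_eq_iff)
      ultimately show ?thesis using base const by (auto intro!: nspan_add)
    qed (use 3 simple in simp_all)
  qed
qed

lemma size_of_span: "size_of \<in> nspan (products (quadratic_part N))"
proof -
  have prod: "g \<in> nspan (quadratic_part N)" if "g \<in> nspan (products (linear_part N))" for g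
    using that nspan_mono[of "products (linear_part N)" "quadratic_part N"] by (auto simp: quadratic_part_def)
  have y: "yval \<in> nspan (quadratic_part N)" and x: "xacc \<in> nspan (quadratic_part N)"
    by (auto intro!: nspan_base simp: quadratic_part_def)
  have one: "(\<lambda>_. 1) \<in> nspan (quadratic_part N)"
    using prod[OF nspan_products[OF linear_part_const[of 1] linear_part_const[of 1]]] by simp
  have "(\<lambda>\<sigma>. xacc \<sigma> + pcval \<sigma> * pcval \<sigma>) \<in> nspan (quadratic_part N)"
    by (intro nspan_add x prod nspan_products linear_part_pc)
  moreover have "xval = (\<lambda>\<sigma>. xacc \<sigma> + pcval \<sigma> * pcval \<sigma>)" by (auto simp: fun_eq_iff)
  ultimately have xv: "xval \<in> nspan (quadratic_part N)" by simp
  \<comment> \<open>The factors 1 turn the lower terms into products of two functions of the span as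
    well.\<close>
  have "(\<lambda>\<sigma>. (xval \<sigma> + yval \<sigma>) * (xval \<sigma> + yval \<sigma>) + xval \<sigma> * 1 + 1 * 1) \<in> nspan (products (quadratic_part N))"
    by (intro nspan_add nspan_products xv y one)
  moreover have "size_of = (\<lambda>\<sigma>. (xval \<sigma> + yval \<sigma>) * (xval \<sigma> + yval \<sigma>) + xval \<sigma> * 1 + 1 * 1)"
    by (simp add: fun_eq_iff size_of_def)
  ultimately show ?thesis by simp
qed

text \<open>Finitely many operations mention finitely many registers, so finitely many products
  suffice; \<open>size_of\<close> is put in front to get index 0.\<close>

theorem size_of_linear_system:
  assumes "finite B"
  shows "\<exists>fs. fs \<noteq> [] \<and> fs ! 0 = size_of \<and> (\<forall>j<length fs. \<forall>b\<in>B. \<exists>js. set js \<subseteq> {..<length fs} \<and>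
           (\<forall>\<sigma>. (fs ! j) (act b \<sigma>) = (\<Sum>i\<leftarrow>js. (fs ! i) \<sigma>)))"
proof -
  have fin: "finite (regs c)" for c by (cases c) auto
  have "finite (op_regs b)" for b by (cases b) (auto simp: fin)
  then have "finite (\<Union> (op_regs ` B))" using assms by blast
  then obtain N where N: "\<Union> (op_regs ` B) \<subseteq> {..<N}"
    unfolding finite_nat_set_iff_bounded by (auto simp: subset_iff)
  define S where "S = products (quadratic_part N)"
  have "finite S" unfolding S_def quadratic_part_def linear_part_def by (intro finite_products finite_UnI) auto
  then obtain gs where gs: "set gs = S" using finite_list by blast
  have "shift_closed act B (insert size_of S)" unfolding S_def
    by (intro shift_closed_insert shift_closed_products quadratic_part_shift_closed N size_of_span)
  then have "shift_closed act B (set (size_of # gs))" using gs by simp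
  then have "\<exists>js. set js \<subseteq> {..<length (size_of # gs)} \<and>
      (\<forall>\<sigma>. ((size_of # gs) ! j) (act b \<sigma>) = (\<Sum>i\<leftarrow>js. ((size_of # gs) ! i) \<sigma>))"
    if "j < length (size_of # gs)" "b \<in> B" for j b
    using nspan_sum_list[of "\<lambda>\<sigma>. ((size_of # gs) ! j) (act b \<sigma>)" "size_of # gs"] that nth_mem[OF that(1)]
    unfolding shift_closed_def fun_eq_iff by blast
  then show ?thesis by (intro exI[of _ "size_of # gs"]) simp
qed

section \<open>Presentations with prescribed class sizes\<close>

abbreviation pe :: "nat \<Rightarrow> nat \<Rightarrow> nat" where "pe a b \<equiv> prod_encode (a, b)"

fun nfa_path :: "(nat \<times> 'a \<times> nat) list \<Rightarrow> nat \<Rightarrow> 'a list \<Rightarrow> nat \<Rightarrow> bool" where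
  "nfa_path tr q [] q' \<longleftrightarrow> q = q'"
| "nfa_path tr q (a # w) q' \<longleftrightarrow> (\<exists>r. (q, a, r) \<in> set tr \<and> nfa_path tr r w q')"

lemma nfa_reach_iff_path: "q' \<in> nfa_reach tr S w \<longleftrightarrow> (\<exists>q\<in>S. nfa_path tr q w q')"
  by (induction w arbitrary: S) auto

text \<open>A linear system in automaton form, with K functions and A operations: after operation a,
  function j is the sum of the functions listed in \<open>L j a\<close>, and \<open>e\<close> gives
  the initial values. M bounds all choices of a summand or unit. Label 0 will be the input and label
  1 the padding.\<close>

locale counting_system =
  fixes K A M :: nat and L :: "nat \<Rightarrow> nat \<Rightarrow> nat list" and e :: "nat \<Rightarrow> nat"
  assumes K_pos: "0 < K"
    and L_set: "j < K \<Longrightarrow> a < A \<Longrightarrow> set (L j a) \<subseteq> {..<K}"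
    and L_length: "j < K \<Longrightarrow> a < A \<Longrightarrow> length (L j a) \<le> M"
    and e_le: "j < K \<Longrightarrow> e j \<le> M"
    and A_pos: "1 < A"
begin

text \<open>The words above w consist of pairs of a label and a choice of a summand; the last letter, with label A,
  chooses one of e j units.  Their number is the weight of w.\<close>
fun lift :: "nat \<Rightarrow> nat list \<Rightarrow> nat list set" where
  "lift j [] = (\<lambda>t. [pe A t]) ` {..<e j}"
| "lift j (a # w) = (\<Union>t<length (L j a). (#) (pe a t) ` lift (L j a ! t) w)"

fun wt :: "nat \<Rightarrow> nat list \<Rightarrow> nat" where
  "wt j [] = e j"
| "wt j (a # w) = (\<Sum>i\<leftarrow>L j a. wt i w)"

lemma finite_lift: "finite (lift j w)"
  by (induction w arbitrary: j) auto

lemma card_lift: "card (lift j w) = wt j w"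
proof (induction w arbitrary: j)
  case Nil
  have "card ((\<lambda>t. [pe A t]) ` {..<e j}) = card {..<e j}" by (rule card_image) (auto simp: inj_on_def)
  then show ?case by simp
next
  case (Cons a w)
  have "card (lift j (a # w)) = (\<Sum>t<length (L j a). card ((#) (pe a t) ` lift (L j a ! t) w))"
    unfolding lift.simps by (rule card_UN_disjoint) (auto simp: finite_lift)
  also have "\<dots> = (\<Sum>t<length (L j a). wt (L j a ! t) w)"
    by (intro sum.cong refl) (simp add: card_image Cons.IH)
  also have "\<dots> = wt j (a # w)"
    by (simp add: sum_list_sum_nth atLeast0LessThan)
  finally show ?case .
qed

definition letters :: "nat list" where
  "letters = concat (map (\<lambda>a. map (pe a) [0..<M]) [0..<Suc A])"

lemma set_letters: "set letters = {pe a t | a t. a \<le> A \<and> t < M}"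
  by (force simp: letters_def simp del: upt_Suc)

lemma lift_letters: "u \<in> lift j w \<Longrightarrow> j < K \<Longrightarrow> set w \<subseteq> {..<A} \<Longrightarrow> set u \<subseteq> set letters"
proof (induction w arbitrary: j u)
  case Nil
  then show ?case using e_le[of j] by (auto simp: set_letters)
next
  case (Cons a w)
  then obtain t u' where t: "t < length (L j a)" "u = pe a t # u'" "u' \<in> lift (L j a ! t) w" by auto
  have "L j a ! t < K" using L_set[of j a] nth_mem[OF t(1)] Cons.prems by auto
  then have "set u' \<subseteq> set letters" using Cons.IH t(3) Cons.prems by auto
  moreover have "pe a t \<in> set letters" using L_length[of j a] t(1) Cons.prems by (force simp: set_letters)
  ultimately show ?case using t(2) by simp
qed

text \<open>The labels recover w, so the sets above distinct words are disjoint, and a class is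
  recognized by comparing labels letter by letter.\<close>

lemma lift_projection: "u \<in> lift j w \<Longrightarrow> map pfst u = w @ [A]"
  by (induction w arbitrary: j u) auto

section \<open>Automata for the words above a language\<close>

definition free_idx :: "nat \<Rightarrow> (nat \<times> nat \<times> nat) list" where
  "free_idx G = concat (map (\<lambda>j. concat (map (\<lambda>a. map (\<lambda>t. (j, a, t)) [0..<length (L j a)]) [1..<G])) [0..<K])"

definition input_idx :: "(nat \<times> nat) list" where
  "input_idx = concat (map (\<lambda>j. map (\<lambda>t. (j, t)) [0..<length (L j 0)]) [0..<K])"

definition end_idx :: "(nat \<times> nat) list" where
  "end_idx = concat (map (\<lambda>j. map (\<lambda>t. (j, t)) [0..<e j]) [0..<K])"

text \<open>A state is a pair of an index j < K and the number i of input letters (label 0) still to be read; the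
  final state is (K, 0).\<close>
fun chain :: "nat \<Rightarrow> (nat \<times> nat \<times> nat) list" where
  "chain 0 = map (\<lambda>(j, t). (pe j 0, pe A t, pe K 0)) end_idx"
| "chain (Suc i) = map (\<lambda>(j, t). (pe j (Suc i), pe 0 t, pe (L j 0 ! t) i)) input_idx @ chain i"

text \<open>Heads of words act last, so the n input letters stand at the end: free letters are read
  while the counter is still n, then the chain counts it down. Only the chain gets longer with
  n.\<close>

definition transitions :: "nat \<Rightarrow> nat \<Rightarrow> (nat \<times> nat \<times> nat) list" where
  "transitions G n = map (\<lambda>(j, a, t). (pe j n, pe a t, pe (L j a ! t) n)) (free_idx G) @ chain n"

lemma set_end_idx: "set end_idx = {(j, t). j < K \<and> t < e j}"
  by (auto simp: end_idx_def)

lemma set_input_idx: "set input_idx = {(j, t). j < K \<and> t < length (L j 0)}"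
  by (auto simp: input_idx_def)

lemma set_free_idx: "set (free_idx G) = {(j, a, t). j < K \<and> a \<in> {1..<G} \<and> t < length (L j a)}"
  by (force simp: free_idx_def)

lemma set_chain: "set (chain n) = {(pe j 0, pe A t, pe K 0) | j t. j < K \<and> t < e j} \<union>
   {(pe j (Suc i), pe 0 t, pe (L j 0 ! t) i) | j i t. i < n \<and> j < K \<and> t < length (L j 0)}"
proof (induction n)
  case 0
  show ?case by (force simp: set_end_idx)
next
  case (Suc n)
  have "set (map (\<lambda>(j, t). (pe j (Suc n), pe 0 t, pe (L j 0 ! t) n)) input_idx) =
      {(pe j (Suc n), pe 0 t, pe (L j 0 ! t) n) | j t. j < K \<and> t < length (L j 0)}"
    by (force simp: set_input_idx)
  then show ?case unfolding chain.simps set_append Suc by (auto simp: less_Suc_eq)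
qed

lemma set_transitions: "set (transitions G n) = set (chain n) \<union>
   {(pe j n, pe a t, pe (L j a ! t) n) | j a t. j < K \<and> a \<in> {1..<G} \<and> t < length (L j a)}"
  by (force simp: transitions_def set_free_idx)

text \<open>What may remain to be read at counter i: free letters are possible only before the first
  input letter.\<close>

definition words :: "nat \<Rightarrow> nat \<Rightarrow> nat \<Rightarrow> nat list set" where
  "words G n i = (if i = n then {f @ replicate n 0 | f. set f \<subseteq> {1..<G}} else {replicate i 0})"

lemma trans_cases:
  assumes "j < K" "i \<le> n"
  shows "(pe j i, b, q) \<in> set (transitions G n) \<longleftrightarrow>
    (\<exists>a t. i = n \<and> a \<in> {1..<G} \<and> t < length (L j a) \<and> b = pe a t \<and> q = pe (L j a ! t) n) \<or>
    (\<exists>i' t. i = Suc i' \<and> t < length (L j 0) \<and> b = pe 0 t \<and> q = pe (L j 0 ! t) i') \<or>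
    (\<exists>t. i = 0 \<and> t < e j \<and> b = pe A t \<and> q = pe K 0)"
  using assms by (auto simp: set_transitions set_chain)

lemma no_trans_from_final: "(pe K 0, b, q) \<notin> set (transitions G n)"
  by (auto simp: set_transitions set_chain)

lemma words_cons: "b # w \<in> words G n i \<longleftrightarrow>
   (i = n \<and> b \<in> {1..<G} \<and> w \<in> words G n n) \<or> (\<exists>i'. i = Suc i' \<and> b = 0 \<and> i' < n \<and> w = replicate i' 0)"
  if "i \<le> n"
proof -
  have "b # w \<in> {f @ replicate n 0 | f. set f \<subseteq> {1..<G}} \<longleftrightarrow>
     (b \<in> {1..<G} \<and> w \<in> {f @ replicate n 0 | f. set f \<subseteq> {1..<G}}) \<or> (\<exists>i'. n = Suc i' \<and> b = 0 \<and> w = replicate i' 0)"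
  proof -
    have "b # w = f @ replicate n 0 \<longleftrightarrow>
       (\<exists>f'. f = b # f' \<and> w = f' @ replicate n 0) \<or> (f = [] \<and> (\<exists>i'. n = Suc i' \<and> b = 0 \<and> w = replicate i' 0))" for f
      by (cases f; cases n) auto
    then show ?thesis by (simp only: mem_Collect_eq) force
  qed
  with that show ?thesis by (cases i) (auto simp: words_def)
qed

lemma nil_words: "[] \<in> words G n i \<longleftrightarrow> i = 0"
  by (auto simp: words_def)

lemma replicate_words_lift: "i < n \<Longrightarrow> w \<in> words G n i \<longleftrightarrow> w = replicate i 0"
  by (simp add: words_def)

text \<open>The index j in a state names the function being unfolded; reading a letter moves on to
  the chosen summand, in step with the recursion of \<open>lift\<close>.\<close>

lemma path_iff_lift:
  assumes "G \<le> A"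
  shows "j < K \<Longrightarrow> i \<le> n \<Longrightarrow> nfa_path (transitions G n) (pe j i) u (pe K 0) \<longleftrightarrow> (\<exists>w\<in>words G n i. u \<in> lift j w)"
proof (induction u arbitrary: j i)
  case Nil
  have "[] \<notin> lift j w" for w by (cases w) auto
  with Nil show ?case by auto
next
  case (Cons b u)
  have fin: "nfa_path (transitions G n) (pe K 0) u (pe K 0) \<longleftrightarrow> u = []"
    by (cases u) (auto simp: no_trans_from_final)
  have LK: "L j a ! t < K" if "a < A" "t < length (L j a)" for a t
    using L_set[OF Cons.prems(1) that(1)] nth_mem[OF that(2)] by auto
  have lift_b: "b # u \<in> lift j w \<longleftrightarrow> (w = [] \<and> u = [] \<and> (\<exists>t<e j. b = pe A t)) \<or>
     (\<exists>a t w'. w = a # w' \<and> t < length (L j a) \<and> b = pe a t \<and> u \<in> lift (L j a ! t) w')" for w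
    by (cases w) auto
  show ?case
  proof
    assume "nfa_path (transitions G n) (pe j i) (b # u) (pe K 0)"
    then obtain q where q: "(pe j i, b, q) \<in> set (transitions G n)" "nfa_path (transitions G n) q u (pe K 0)" by auto
    from q(1) consider (free) a t where "i = n" "a \<in> {1..<G}" "t < length (L j a)" "b = pe a t" "q = pe (L j a ! t) n"
      | (inp) i' t where "i = Suc i'" "t < length (L j 0)" "b = pe 0 t" "q = pe (L j 0 ! t) i'"
      | (fin) t where "i = 0" "t < e j" "b = pe A t" "q = pe K 0"
      unfolding trans_cases[OF Cons.prems] by blast
    then show "\<exists>w\<in>words G n i. b # u \<in> lift j w"
    proof cases
      case free
      have "a < A" using free assms by simp
      with Cons.IH[OF LK[OF this free(3)] order.refl] q(2) free(5) obtain w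
        where w: "w \<in> words G n n" "u \<in> lift (L j a ! t) w" by blast
      then have "a # w \<in> words G n i" using words_cons[OF Cons.prems(2)] free by blast
      moreover have "b # u \<in> lift j (a # w)" using w free by auto
      ultimately show ?thesis by blast
    next
      case inp
      have i': "i' < n" using inp Cons.prems by simp
      have "0 < A" using A_pos by simp
      with Cons.IH[OF LK[OF this inp(2)] less_imp_le[OF i']] q(2) inp(4) obtain w
        where w: "w \<in> words G n i'" "u \<in> lift (L j 0 ! t) w" by blast
      then have "0 # w \<in> words G n i" using words_cons[OF Cons.prems(2)] inp i' replicate_words_lift by blast
      moreover have "b # u \<in> lift j (0 # w)" using w inp by auto
      ultimately show ?thesis by blast
    next
      case fin
      then have "u = []" using q(2) \<open>nfa_path (transitions G n) (pe K 0) u (pe K 0) \<longleftrightarrow> u = []\<close> by simp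
      then have "b # u \<in> lift j []" using fin by auto
      then show ?thesis using nil_words fin(1) by blast
    qed
  next
    assume "\<exists>w\<in>words G n i. b # u \<in> lift j w"
    then obtain w where w: "w \<in> words G n i" "b # u \<in> lift j w" by blast
    from w(2) consider "w = []" "u = []" "\<exists>t<e j. b = pe A t"
      | a t w' where "w = a # w'" "t < length (L j a)" "b = pe a t" "u \<in> lift (L j a ! t) w'"
      unfolding lift_b by blast
    then show "nfa_path (transitions G n) (pe j i) (b # u) (pe K 0)"
    proof cases
      case 1
      then have "i = 0" using w(1) nil_words by simp
      then have "(pe j i, b, pe K 0) \<in> set (transitions G n)" using 1(3) trans_cases[OF Cons.prems] by blast
      with 1(2) show ?thesis by auto
    next
      case 2
      from w(1) have "a # w' \<in> words G n i" using 2 by simp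
      then consider "i = n" "a \<in> {1..<G}" "w' \<in> words G n n"
        | i' where "i = Suc i'" "a = 0" "i' < n" "w' = replicate i' 0"
        unfolding words_cons[OF Cons.prems(2)] by blast
      then show ?thesis
      proof cases
        case 1
        then have "a < A" using assms by simp
        from Cons.IH[OF LK[OF this 2(2)] order.refl] 1(3) 2(4)
        have "nfa_path (transitions G n) (pe (L j a ! t) n) u (pe K 0)" by blast
        moreover have "(pe j i, b, pe (L j a ! t) n) \<in> set (transitions G n)"
          using 1 2 trans_cases[OF Cons.prems] by blast
        ultimately show ?thesis by auto
      next
        case (2 i')
        note i' = this
        have "0 < A" using A_pos by simp
        from Cons.IH[OF LK[OF this] less_imp_le[OF i'(3)]] replicate_words_lift[OF i'(3)]
        have "nfa_path (transitions G n) (pe (L j 0 ! t) i') u (pe K 0)"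
          using \<open>t < length (L j a)\<close> \<open>u \<in> lift (L j a ! t) w'\<close> i' by blast
        moreover have "(pe j i, b, pe (L j 0 ! t) i') \<in> set (transitions G n)"
          using i' \<open>t < length (L j a)\<close> \<open>b = pe a t\<close> trans_cases[OF Cons.prems] by blast
        ultimately show ?thesis by auto
      qed
    qed
  qed
qed

text \<open>No letter contains \<open>None\<close>, so related words have equal length; labels must
  agree, while the choices of summands are free.\<close>

definition pair_trans :: "(nat \<times> (nat option \<times> nat option) \<times> nat) list" where
  "pair_trans = concat (map (\<lambda>b. map (\<lambda>c. (0, (Some b, Some c), 0)) (filter (\<lambda>c. pfst b = pfst c) letters)) letters)"

definition alphabet :: nat where "alphabet = Suc (sum_list letters)"

definition presentation_of :: "nat \<Rightarrow> nat \<Rightarrow> pres" where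
  "presentation_of G n = Pres alphabet (NFA [pe 0 n] [pe K 0] (transitions G n)) (NFA [0] [0] pair_trans)"

lemma letters_less_alphabet: "set letters \<subseteq> {..<alphabet}"
  using member_le_sum_list[of _ letters] by (auto simp: alphabet_def less_Suc_eq_le)

lemma words_subset: "G \<le> A \<Longrightarrow> w \<in> words G n n \<Longrightarrow> set w \<subseteq> {..<A}"
  using A_pos by (auto simp: words_def dest!: subsetD)

lemma dom_presentation_of:
  assumes "G \<le> A"
  shows "pres_dom (presentation_of G n) = (\<Union>w\<in>words G n n. lift 0 w)"
proof -
  have "set u \<subseteq> {..<alphabet}" if "w \<in> words G n n" "u \<in> lift 0 w" for u w
    using lift_letters[OF that(2) K_pos words_subset[OF assms that(1)]] letters_less_alphabet by blast
  then show ?thesis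
    using path_iff_lift[OF assms K_pos order.refl]
    by (auto simp: presentation_of_def nfa_reach_iff_path disjoint_iff)
qed

lemma pair_path: "nfa_path pair_trans 0 w 0 \<longleftrightarrow>
    (\<forall>x\<in>set w. \<exists>b c. x = (Some b, Some c) \<and> b \<in> set letters \<and> c \<in> set letters \<and> pfst b = pfst c)"
proof (induction w)
  case (Cons x w)
  have "(0, x, r) \<in> set pair_trans \<longleftrightarrow>
     r = 0 \<and> (\<exists>b c. x = (Some b, Some c) \<and> b \<in> set letters \<and> c \<in> set letters \<and> pfst b = pfst c)" for r
    by (auto simp: pair_trans_def)
  with Cons show ?case by simp
qed simp

lemma pair_accepts_iff:
  assumes "set u \<subseteq> set letters" "set v \<subseteq> set letters"
  shows "nfa_accepts (NFA [0] [0] pair_trans) (conv2 u v) \<longleftrightarrow> map pfst u = map pfst v"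
proof -
  have "nfa_accepts (NFA [0] [0] pair_trans) (conv2 u v) \<longleftrightarrow> nfa_path pair_trans 0 (conv2 u v) 0"
    by (simp add: disjoint_iff nfa_reach_iff_path)
  also have "\<dots> \<longleftrightarrow> (\<forall>i<max (length u) (length v). \<exists>b c. conv2 u v ! i = (Some b, Some c) \<and>
       b \<in> set letters \<and> c \<in> set letters \<and> pfst b = pfst c)"
    unfolding pair_path by (simp add: all_set_conv_all_nth)
  also have "\<dots> \<longleftrightarrow> length u = length v \<and> (\<forall>i<length u. pfst (u ! i) = pfst (v ! i))"
  proof
    assume R: "\<forall>i<max (length u) (length v). \<exists>b c. conv2 u v ! i = (Some b, Some c) \<and>
       b \<in> set letters \<and> c \<in> set letters \<and> pfst b = pfst c"
    have "i < length u \<and> i < length v \<and> pfst (u ! i) = pfst (v ! i)" if "i < max (length u) (length v)" for i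
      using R[rule_format, OF that] by (auto simp: nth_conv2[OF that] split: if_splits)
    then show "length u = length v \<and> (\<forall>i<length u. pfst (u ! i) = pfst (v ! i))"
      by (metis less_irrefl less_max_iff_disj linorder_neqE_nat)
  next
    assume "length u = length v \<and> (\<forall>i<length u. pfst (u ! i) = pfst (v ! i))"
    then show "\<forall>i<max (length u) (length v). \<exists>b c. conv2 u v ! i = (Some b, Some c) \<and>
       b \<in> set letters \<and> c \<in> set letters \<and> pfst b = pfst c"
      using assms by (auto simp: nth_conv2)
  qed
  also have "\<dots> \<longleftrightarrow> map pfst u = map pfst v" by (auto simp: list_eq_iff_nth_eq)
  finally show ?thesis .
qed

lemma rel_presentation_of:
  assumes "G \<le> A"
  shows "pres_rel (presentation_of G n) =
    {(u, v). u \<in> pres_dom (presentation_of G n) \<and> v \<in> pres_dom (presentation_of G n) \<and> map pfst u = map pfst v}"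
proof -
  have lett: "set u \<subseteq> set letters" if "u \<in> pres_dom (presentation_of G n)" for u
    using that lift_letters[OF _ K_pos words_subset[OF assms]] unfolding dom_presentation_of[OF assms] by blast
  have eq: "pres_rel (presentation_of G n) = {(u, v). u \<in> pres_dom (presentation_of G n) \<and>
      v \<in> pres_dom (presentation_of G n) \<and> nfa_accepts (NFA [0] [0] pair_trans) (conv2 u v)}"
    by (simp only: presentation_of_def pres_rel.simps)
  have "nfa_accepts (NFA [0] [0] pair_trans) (conv2 u v) \<longleftrightarrow> map pfst u = map pfst v"
    if "u \<in> pres_dom (presentation_of G n)" "v \<in> pres_dom (presentation_of G n)" for u v
    using pair_accepts_iff[OF lett[OF that(1)] lett[OF that(2)]] .
  then show ?thesis unfolding eq by (auto simp del: nfa_accepts.simps)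
qed

lemma equiv_presentation_of:
  "G \<le> A \<Longrightarrow> equiv (pres_dom (presentation_of G n)) (pres_rel (presentation_of G n))"
  unfolding rel_presentation_of by (rule equivI) (auto simp: refl_on_def sym_def trans_def)

text \<open>Positive weights make every \<open>lift 0 w\<close> inhabited, so that it really is a
  class, and its size is the weight of w.\<close>

lemma classes_presentation_of:
  assumes G: "G \<le> A" and pos: "\<And>w. w \<in> words G n n \<Longrightarrow> 0 < wt 0 w"
  shows "classes_of_card (pres_dom (presentation_of G n)) (pres_rel (presentation_of G n)) m =
    lift 0 ` {w \<in> words G n n. wt 0 w = m}"
proof -
  let ?D = "pres_dom (presentation_of G n)" and ?r = "pres_rel (presentation_of G n)"
  have cls: "?r `` {u} = lift 0 w" if "w \<in> words G n n" "u \<in> lift 0 w" for u w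
    using that lift_projection by (auto simp: rel_presentation_of[OF G] dom_presentation_of[OF G])
  have "?D // ?r = lift 0 ` words G n n"
  proof
    show "?D // ?r \<subseteq> lift 0 ` words G n n"
    proof
      fix C assume "C \<in> ?D // ?r"
      then obtain u where u: "u \<in> ?D" "C = ?r `` {u}" by (auto elim: quotientE)
      then obtain w where "w \<in> words G n n" "u \<in> lift 0 w" unfolding dom_presentation_of[OF G] by blast
      with cls u show "C \<in> lift 0 ` words G n n" by blast
    qed
    show "lift 0 ` words G n n \<subseteq> ?D // ?r"
    proof
      fix C assume "C \<in> lift 0 ` words G n n"
      then obtain w where w: "w \<in> words G n n" "C = lift 0 w" by blast
      have "card C \<noteq> 0" using pos[OF w(1)] w(2) by (simp add: card_lift)
      then obtain u where u: "u \<in> lift 0 w" using w(2) by fastforce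
      then have "u \<in> ?D" using w(1) unfolding dom_presentation_of[OF G] by blast
      then show "C \<in> ?D // ?r" using cls[OF w(1) u] w(2) quotientI by metis
    qed
  qed
  then show ?thesis by (auto simp: classes_of_card_def card_lift)
qed

lemma inj_on_lift:
  assumes "\<And>w. w \<in> W \<Longrightarrow> 0 < wt 0 w"
  shows "inj_on (lift 0) W"
proof (rule inj_onI)
  fix w w' assume w: "w \<in> W" "w' \<in> W" "lift 0 w = lift 0 w'"
  have "lift 0 w \<noteq> {}" using assms[OF w(1)] card_lift[of 0 w] by auto
  then obtain u where u: "u \<in> lift 0 w" "u \<in> lift 0 w'" unfolding w(3) by blast
  have "w @ [A] = w' @ [A]"
    by (rule trans[OF sym[OF lift_projection[OF u(1)]] lift_projection[OF u(2)]])
  then show "w = w'" by simp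
qed

text \<open>Letter 1 keeps the weight and may be prepended any number of times.\<close>

lemma infinite_or_no_words:
  assumes "1 < G" "\<And>w. w \<in> words G n n \<Longrightarrow> wt 0 (1 # w) = wt 0 w"
  shows "infinite {w \<in> words G n n. wt 0 w = m} \<or> {w \<in> words G n n. wt 0 w = m} = {}"
proof (rule disjCI)
  assume "{w \<in> words G n n. wt 0 w = m} \<noteq> {}"
  then obtain w where w: "w \<in> words G n n" "wt 0 w = m" by blast
  have "replicate i 1 @ w \<in> words G n n \<and> wt 0 (replicate i 1 @ w) = m" for i
  proof (induction i)
    case (Suc i)
    have "1 # replicate i 1 @ w \<in> words G n n" using Suc assms(1) words_cons[of n n] by simp
    with Suc assms(2) show ?case by simp
  qed (simp add: w)
  then have "range (\<lambda>i. replicate i 1 @ w) \<subseteq> {w \<in> words G n n. wt 0 w = m}" by auto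
  moreover have "infinite (range (\<lambda>i. replicate i (1::nat) @ w))"
    by (rule range_inj_infinite) (auto simp: inj_on_def dest: arg_cong[of _ _ length])
  ultimately show "infinite {w \<in> words G n n. wt 0 w = m}" using infinite_super by blast
qed

theorem presentation_iso_iff:
  assumes G: "1 < G" "G \<le> A" "1 < H" "H \<le> A"
    and pos: "\<And>w. w \<in> words G n n \<union> words H n n \<Longrightarrow> 0 < wt 0 w"
    and pad: "\<And>w. w \<in> words G n n \<union> words H n n \<Longrightarrow> wt 0 (1 # w) = wt 0 w"
  shows "pres_iso (presentation_of G n) (presentation_of H n) \<longleftrightarrow> wt 0 ` words G n n = wt 0 ` words H n n"
proof -
  let ?W = "\<lambda>G m. {w \<in> words G n n. wt 0 w = m}"
  have cls: "classes_of_card (pres_dom (presentation_of G n)) (pres_rel (presentation_of G n)) m = lift 0 ` ?W G m"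
    "classes_of_card (pres_dom (presentation_of H n)) (pres_rel (presentation_of H n)) m = lift 0 ` ?W H m" for m
    by (rule classes_presentation_of; use G pos in blast)+
  \<comment> \<open>\<open>card\<close> is 0 for infinite and for empty sets alike, so finiteness
    alone tells whether size m occurs.\<close>
  have fin: "finite (lift 0 ` ?W G m) \<longleftrightarrow> ?W G m = {}" "card (lift 0 ` ?W G m) = 0"
    if "1 < G" "\<And>w. w \<in> words G n n \<Longrightarrow> 0 < wt 0 w" "\<And>w. w \<in> words G n n \<Longrightarrow> wt 0 (1 # w) = wt 0 w" for G m
  proof -
    have inj: "inj_on (lift 0) (?W G m)" by (rule inj_on_lift) (use that(2) in blast)
    note D = infinite_or_no_words[where n = n and m = m, OF that(1,3)]
    have X: "(finite X \<longleftrightarrow> X = {}) \<and> card X = 0" if "infinite X \<or> X = {}" for X :: "nat list set"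
      using that by auto
    show "finite (lift 0 ` ?W G m) \<longleftrightarrow> ?W G m = {}"
      unfolding finite_image_iff[OF inj] by (rule X[OF D, THEN conjunct1])
    show "card (lift 0 ` ?W G m) = 0"
      unfolding card_image[OF inj] by (rule X[OF D, THEN conjunct2])
  qed
  have "pres_iso (presentation_of G n) (presentation_of H n) \<longleftrightarrow>
     (\<forall>m. (finite (lift 0 ` ?W G m) \<longleftrightarrow> finite (lift 0 ` ?W H m)) \<and> card (lift 0 ` ?W G m) = card (lift 0 ` ?W H m))"
    unfolding pres_iso_def cls[symmetric]
    by (intro equiv_iso_iff_classes equiv_presentation_of assms countableI_type)
  also have "\<dots> \<longleftrightarrow> (\<forall>m. ?W G m = {} \<longleftrightarrow> ?W H m = {})"
  proof -
    have "(finite (lift 0 ` ?W G m) \<longleftrightarrow> ?W G m = {})" "card (lift 0 ` ?W G m) = 0" for m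
      by (rule fin[OF G(1)]; use pos pad in blast)+
    moreover have "(finite (lift 0 ` ?W H m) \<longleftrightarrow> ?W H m = {})" "card (lift 0 ` ?W H m) = 0" for m
      by (rule fin[OF G(3)]; use pos pad in blast)+
    ultimately show ?thesis by (simp only: simp_thms)
  qed
  also have "\<dots> \<longleftrightarrow> wt 0 ` words G n n = wt 0 ` words H n n" 
  proof -
    have "?W G m = {} \<longleftrightarrow> m \<notin> wt 0 ` words G n n" for G m by auto
    moreover have "(\<forall>m. m \<notin> X \<longleftrightarrow> m \<notin> Y) \<longleftrightarrow> X = Y" for X Y :: "nat set" by auto
    ultimately show ?thesis by (simp only:)
  qed
  finally show ?thesis .
qed

end

section \<open>Hardness\<close>

text \<open>The list \<open>xs\<close> does not depend on n, so the code is a fixed composition of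
  pairings.\<close>

lemma computable_list_encode_map:
  assumes "\<And>x. x \<in> set xs \<Longrightarrow> computable (g x)" "computable (\<lambda>n. list_encode (b n))"
  shows "computable (\<lambda>n. list_encode (map (\<lambda>x. g x n) xs @ b n))"
  using assms by (induction xs) (auto intro!: computable_Suc computable_prod_encode)

fun enc_trans :: "nat \<times> nat \<times> nat \<Rightarrow> nat" where
  "enc_trans (q, b, q') = pe q (pe b q')"

fun enc_opt :: "nat option \<Rightarrow> nat" where
  "enc_opt None = 0"
| "enc_opt (Some j) = Suc j"

fun enc_trans2 :: "nat \<times> (nat option \<times> nat option) \<times> nat \<Rightarrow> nat" where
  "enc_trans2 (q, (x, y), q') = pe q (pe (pe (enc_opt x) (enc_opt y)) q')"

lemma dec_opt_enc_opt [simp]: "dec_opt (enc_opt x) = x" by (cases x) auto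

context counting_system
begin

definition code_of :: "nat \<Rightarrow> nat \<Rightarrow> nat" where
  "code_of G n = pe alphabet (pe
     (pe (list_encode [pe 0 n]) (pe (list_encode [pe K 0]) (list_encode (map enc_trans (transitions G n)))))
     (pe (list_encode [0]) (pe (list_encode [0]) (list_encode (map enc_trans2 pair_trans)))))"

lemma dec_pres_code_of: "dec_pres (code_of G n) = presentation_of G n"
proof -
  have "map (\<lambda>m. case prod_decode m of (q, r) \<Rightarrow> case prod_decode r of (x, q') \<Rightarrow> (q, id x, q'))
      (map enc_trans tr) = tr" for tr
    by (induction tr) auto
  moreover have "map (\<lambda>m. case prod_decode m of (q, r) \<Rightarrow> case prod_decode r of (x, q') \<Rightarrow> (q, dec_letter2 x, q'))
      (map enc_trans2 tr) = tr" for tr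
    by (induction tr) (auto simp: dec_letter2_def)
  ultimately show ?thesis
    by (simp add: code_of_def dec_pres_def dec_nfa_def presentation_of_def del: list_encode.simps map_map)
qed

text \<open>The length of the chain depends on n, so its code is built by primitive recursion; each
  step puts one block of fixed length in front of the previous code.\<close>

lemma computable_chain: "computable (\<lambda>n. list_encode (map enc_trans (chain n)))"
proof -
  define step where "step i r = list_encode (map (\<lambda>(j, t). pe (pe j (Suc i)) (pe (pe 0 t) (pe (L j 0 ! t) i))) input_idx
      @ list_decode r)" for i r
  have "computable (\<lambda>p. list_encode (map (\<lambda>x. (case x of (j, t) \<Rightarrow>
      (\<lambda>p. pe (pe j (Suc (pfst (psnd p)))) (pe (pe 0 t) (pe (L j 0 ! t) (pfst (psnd p)))))) p) input_idx
      @ list_decode (psnd (psnd p))))"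
    by (rule computable_list_encode_map)
      (auto intro!: computable_prod_encode computable_const computable_Suc computable_pfst computable_psnd computable_id)
  moreover have "(case x of (j, t) \<Rightarrow>
      (\<lambda>p. pe (pe j (Suc (pfst (psnd p)))) (pe (pe 0 t) (pe (L j 0 ! t) (pfst (psnd p)))))) p =
      (\<lambda>(j, t). pe (pe j (Suc (pfst (psnd p)))) (pe (pe 0 t) (pe (L j 0 ! t) (pfst (psnd p))))) x" for x p
    by (cases x) simp
  ultimately have "computable (\<lambda>p. step (pfst (psnd p)) (psnd (psnd p)))" by (simp add: step_def)
  then have "computable (\<lambda>n. rec_nat (list_encode (map enc_trans (chain 0))) step n)"
    by (intro computable_rec_nat[where b = "\<lambda>_. step"] computable_const computable_id)
  moreover have "rec_nat (list_encode (map enc_trans (chain 0))) step n = list_encode (map enc_trans (chain n))" for n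
  proof (induction n)
    case (Suc n)
    have "map enc_trans (map (\<lambda>(j, t). (pe j (Suc n), pe 0 t, pe (L j 0 ! t) n)) input_idx) =
        map (\<lambda>(j, t). pe (pe j (Suc n)) (pe (pe 0 t) (pe (L j 0 ! t) n))) input_idx"
      by auto
    with Suc show ?case by (simp add: step_def del: map_map)
  qed simp
  ultimately show ?thesis by simp
qed

lemma computable_code_of: "computable (code_of G)"
proof -
  have "computable (\<lambda>n. list_encode (map (\<lambda>x. (case x of (j, a, t) \<Rightarrow>
      (\<lambda>n. pe (pe j n) (pe (pe a t) (pe (L j a ! t) n)))) n) (free_idx G) @ map enc_trans (chain n)))"
    by (rule computable_list_encode_map)
      (auto intro!: computable_prod_encode computable_const computable_id computable_chain)
  moreover have "map (\<lambda>x. (case x of (j, a, t) \<Rightarrow>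
      (\<lambda>n. pe (pe j n) (pe (pe a t) (pe (L j a ! t) n)))) n) (free_idx G) @ map enc_trans (chain n) =
      map enc_trans (transitions G n)" for n
    by (auto simp: transitions_def)
  ultimately have "computable (\<lambda>n. list_encode (map enc_trans (transitions G n)))" by simp
  moreover have "computable (\<lambda>n. list_encode [pe 0 n])"
    by (auto intro!: computable_Suc computable_prod_encode computable_const computable_id)
  ultimately have "computable (\<lambda>n. code_of G n)" unfolding code_of_def
    by (intro computable_prod_encode computable_const)
  then show ?thesis by simp
qed

end

lemma words_image:
  "(\<lambda>f. map g (f @ replicate n 0)) ` {f. set f \<subseteq> I} = (\<lambda>ws. ws @ replicate n (g 0)) ` {ws. set ws \<subseteq> g ` I}"
proof -
  have "{ws. set ws \<subseteq> g ` I} = map g ` {f. set f \<subseteq> I}"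
    using lists_image[of g I] by (simp add: lists_eq_set)
  then show ?thesis by (simp add: image_image)
qed

theorem Pi01_reducible_to_equiv_iso_problem:
  assumes "Pi01 B"
  shows "many_one_reducible B equiv_iso_problem"
proof -
  obtain f where f: "\<And>n. n \<notin> B \<longleftrightarrow> (\<exists>y. recf_eval f [n] y)"
    using assms by (auto simp: Pi01_def Sigma01_def)
  obtain E where "finite E" and E: "\<And>n. (\<exists>s. mreach E n 0 s) \<longleftrightarrow> (\<exists>y. recf_eval f [n] y)"
    using halting_machine[of f] by blast
  obtain es where es: "set es = E" using finite_list[OF \<open>finite E\<close>] by blast
  \<comment> \<open>The order fixes the labels: input is 0, padding is 1, and the labels below 4 are
    the operations without edges, which is why the comparison structure uses 4.\<close>
  define ops where "ops = [In, Pad, XY, XX] @ map (\<lambda>(l, c, l'). Ed l c l') es"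
  define A where "A = length ops"
  have A: "4 \<le> A" by (simp add: A_def ops_def)
  obtain fs where fs: "fs \<noteq> []" "fs ! 0 = size_of" and "\<forall>j<length fs. \<forall>b\<in>set ops. \<exists>js. set js \<subseteq> {..<length fs} \<and>
           (\<forall>\<sigma>. (fs ! j) (act b \<sigma>) = (\<Sum>i\<leftarrow>js. (fs ! i) \<sigma>))"
    using size_of_linear_system[of "set ops"] by blast
  then have "\<forall>j a. \<exists>js. j < length fs \<longrightarrow> a < A \<longrightarrow> set js \<subseteq> {..<length fs} \<and>
           (\<forall>\<sigma>. (fs ! j) (act (ops ! a) \<sigma>) = (\<Sum>i\<leftarrow>js. (fs ! i) \<sigma>))"
    using nth_mem[of _ ops] unfolding A_def by blast
  then obtain L where L: "\<And>j a. j < length fs \<Longrightarrow> a < A \<Longrightarrow> set (L j a) \<subseteq> {..<length fs}"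
    "\<And>j a \<sigma>. j < length fs \<Longrightarrow> a < A \<Longrightarrow> (fs ! j) (act (ops ! a) \<sigma>) = (\<Sum>i\<leftarrow>L j a. (fs ! i) \<sigma>)"
    by metis
  define K where "K = length fs"
  define e where "e j = (fs ! j) start" for j
  \<comment> \<open>A crude common bound: the sum is at least each of its terms.\<close>
  define M where "M = (\<Sum>j<K. e j + (\<Sum>a<A. length (L j a)))"
  have le: "e j + (\<Sum>a<A. length (L j a)) \<le> M" if "j < K" for j
    unfolding M_def by (rule member_le_sum[of j]) (use that in auto)
  interpret counting_system K A M L e
  proof
    show "0 < K" using fs(1) by (simp add: K_def)
    show "1 < A" using A by simp
    show "set (L j a) \<subseteq> {..<K}" if "j < K" "a < A" for j a using L that by (simp add: K_def)
    show "e j \<le> M" if "j < K" for j using le[OF that] by simp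
    show "length (L j a) \<le> M" if "j < K" "a < A" for j a
    proof -
      have "length (L j a) \<le> (\<Sum>a<A. length (L j a))"
        by (rule member_le_sum[of a]) (use that in auto)
      with le[OF that(1)] show ?thesis by simp
    qed
  qed
  \<comment> \<open>The weights evaluate the functions \<open>fs\<close> along a word, since in both
    recursions the head of the list is the last operation.\<close>
  have wt: "wt j w = (fs ! j) (foldr act (map ((!) ops) w) start)" if "j < K" "set w \<subseteq> {..<A}" for j w
    using that
  proof (induction w arbitrary: j)
    case (Cons a w)
    have "wt j (a # w) = (\<Sum>i\<leftarrow>L j a. (fs ! i) (foldr act (map ((!) ops) w) start))"
      unfolding wt.simps
      by (intro arg_cong[of _ _ sum_list] map_cong refl Cons.IH) (use Cons.prems L(1)[of j a] in \<open>auto simp: K_def\<close>)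
    with Cons.prems L(2)[of j a] show ?case by (simp add: K_def)
  qed (simp add: e_def)
  have wt0: "wt 0 w = size_of (foldr act (map ((!) ops) w) start)" if "w \<in> words G n n" "G \<le> A" for w G n
    using wt[OF K_pos words_subset[OF that(2,1)]] fs(2) by simp
  have sizes: "wt 0 ` words G n n = (\<lambda>ws. size_of (state_after n ws)) ` {ws. set ws \<subseteq> (!) ops ` {1..<G}}"
    if "G \<le> A" for G n
  proof -
    have W: "words G n n = (\<lambda>f. f @ replicate n 0) ` {f. set f \<subseteq> {1..<G}}"
      by (auto simp: words_def)
    have "wt 0 ` words G n n = (\<lambda>ws. size_of (foldr act ws start)) ` (map ((!) ops) ` words G n n)"
      unfolding image_image by (rule image_cong[OF refl]) (rule wt0[OF _ that])
    also have "map ((!) ops) ` words G n n = (\<lambda>f. map ((!) ops) (f @ replicate n 0)) ` {f. set f \<subseteq> {1..<G}}"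
      unfolding W by (rule image_image)
    also have "\<dots> = (\<lambda>ws. ws @ replicate n In) ` {ws. set ws \<subseteq> (!) ops ` {1..<G}}"
      unfolding words_image by (simp add: ops_def)
    finally show ?thesis by (simp add: image_image state_after_def)
  qed
  have ops4: "(!) ops ` {1..<4} = {Pad, XY, XX}"
  proof -
    have "{1..<4} = {1, 2, 3::nat}" by auto
    then show ?thesis by (simp add: ops_def)
  qed
  have opsA: "(!) ops ` {1..<A} = {Pad, XY, XX} \<union> E_ops E"
  proof -
    have eq: "{1..<A} = Suc ` {0..<length (tl ops)}"
      by (simp add: A_def ops_def image_Suc_atLeastLessThan)
    have "(!) ops ` {1..<A} = (\<lambda>i. ops ! Suc i) ` {0..<length (tl ops)}"
      unfolding eq by (rule image_image)
    also have "\<dots> = (\<lambda>i. tl ops ! i) ` {0..<length (tl ops)}"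
      by (rule image_cong[OF refl]) (simp add: nth_tl)
    also have "\<dots> = set (tl ops)" by (auto simp: set_conv_nth)
    also have "\<dots> = {Pad, XY, XX} \<union> E_ops E" by (force simp: ops_def E_ops_def es[symmetric])
    finally show ?thesis .
  qed
  have iso: "pres_iso (presentation_of A n) (presentation_of 4 n) \<longleftrightarrow> n \<in> B" for n
  proof -
    have "pres_iso (presentation_of A n) (presentation_of 4 n) \<longleftrightarrow> wt 0 ` words A n n = wt 0 ` words 4 n n"
    proof (rule presentation_iso_iff)
      fix w assume "w \<in> words A n n \<union> words 4 n n"
      moreover have "{1..<4} \<subseteq> {1..<A}" using A by auto
      ultimately have w: "w \<in> words A n n" unfolding words_def by (simp only: simp_thms if_True) blast
      show "0 < wt 0 w" using wt0[OF w order.refl] size_of_pos by simp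
      have "1 # w \<in> words A n n" using w A words_cons[of n n] by auto
      from wt0[OF this order.refl] wt0[OF w order.refl] show "wt 0 (1 # w) = wt 0 w"
        by (simp add: ops_def)
    qed (use A in auto)
    also have "\<dots> \<longleftrightarrow> \<not> (\<exists>s. mreach E n 0 s)"
      unfolding sizes[OF order.refl] sizes[OF A] ops4 opsA sizes_iff_halting by simp
    finally show ?thesis using E[of n] f[of n] by blast
  qed
  define h where "h n = pe (code_of A n) (code_of 4 n)" for n
  have "computable h" unfolding h_def
    using computable_code_of by (intro computable_prod_encode) auto
  moreover have "n \<in> B \<longleftrightarrow> h n \<in> equiv_iso_problem" for n
    using iso[of n] equiv_presentation_of[of A n]
    by (simp add: equiv_iso_problem_def h_def dec_pres_code_of is_equiv_structure_def)
  ultimately show ?thesis unfolding many_one_reducible_def by blast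
qed

section \<open>Deciding membership in presented relations\<close>

lemma computable_comp2:
  assumes "computable (\<lambda>p. f (pfst p) (psnd p))" "computable g" "computable h"
  shows "computable (\<lambda>e. f (g e) (h e))"
  using computable_comp[OF assms(1) computable_prod_encode[OF assms(2,3)]] by simp

lemma decidable_comp2:
  assumes "decidable (\<lambda>p. P (pfst p) (psnd p))" "computable g" "computable h"
  shows "decidable (\<lambda>e. P (g e) (h e))"
  using computable_comp2[of "\<lambda>a b. of_bool (P a b)" g h] assms by (simp add: decidable_def)

lemma computable_least:
  assumes "computable (\<lambda>p. F (pfst p) (psnd p))" "\<And>e. \<exists>i. F e i = 0"
  shows "computable (\<lambda>e. LEAST i. F e i = 0)"
proof -
  define G where "G p = F (pfst p) (psnd p)" for p
  have "computable G" using assms(1) by (simp add: G_def[abs_def])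
  then have "total_rec (Suc 1) (\<lambda>xs. G (pe (xs ! 1) (xs ! 0)))"
    by (intro total_rec_unary[of G] total_rec_prod_encode total_rec_proj) auto
  then have "total_rec (Suc 1) (\<lambda>xs. F (xs ! 1) (xs ! 0))" by (simp add: G_def)
  from total_rec_least[OF this] assms(2) show ?thesis by (simp add: computable_iff_total_rec)
qed

text \<open>The code of a nonempty list is the successor of the pair of head and tail code, so
  \<open>psnd (r - 1)\<close> is the tail; at the code 0 of the empty list it stays 0.\<close>

definition dropc :: "nat \<Rightarrow> nat \<Rightarrow> nat" where
  "dropc c i = rec_nat c (\<lambda>_ r. psnd (r - 1)) i"

definition nthc :: "nat \<Rightarrow> nat \<Rightarrow> nat" where "nthc c i = pfst (dropc c i - 1)"
definition lenc :: "nat \<Rightarrow> nat" where "lenc c = length (list_decode c)"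

lemma list_decode_psnd: "list_decode (psnd (c - 1)) = tl (list_decode c)"
proof (cases c)
  case 0
  have "psnd 0 = 0" using le_prod_encode_2[of "psnd 0" "pfst 0"] by simp
  with 0 show ?thesis by simp
next
  case (Suc n)
  then show ?thesis by (simp add: prod_decode_eq)
qed

lemma list_decode_dropc: "list_decode (dropc c i) = drop i (list_decode c)"
proof (induction i)
  case (Suc i)
  have "dropc c (Suc i) = psnd (dropc c i - 1)" by (simp add: dropc_def)
  then have "list_decode (dropc c (Suc i)) = tl (drop i (list_decode c))"
    using Suc by (simp only: list_decode_psnd)
  then show ?case by (simp add: drop_Suc tl_drop)
qed (simp add: dropc_def)

lemma nthc: "i < lenc c \<Longrightarrow> nthc c i = list_decode c ! i"
proof -
  assume i: "i < lenc c"
  then have "drop i (list_decode c) = list_decode c ! i # drop (Suc i) (list_decode c)"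
    by (simp add: lenc_def Cons_nth_drop_Suc)
  then have "list_decode (dropc c i) = list_decode c ! i # drop (Suc i) (list_decode c)"
    by (simp add: list_decode_dropc)
  then have "dropc c i = list_encode (list_decode c ! i # drop (Suc i) (list_decode c))"
    by (metis list_decode_inverse)
  then show ?thesis by (simp add: nthc_def)
qed

lemma lenc_eq: "lenc c = (LEAST i. dropc c i = 0)"
proof (rule Least_equality[symmetric])
  have iff: "dropc c i = 0 \<longleftrightarrow> lenc c \<le> i" for i
  proof -
    have "dropc c i = 0 \<longleftrightarrow> list_decode (dropc c i) = []"
      by (metis list_decode.simps(1) list_decode_inverse list_encode.simps(1))
    then show ?thesis by (simp add: list_decode_dropc lenc_def)
  qed
  show "dropc c (lenc c) = 0" by (simp add: iff)
  show "\<And>i. dropc c i = 0 \<Longrightarrow> lenc c \<le> i" by (simp add: iff)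
qed

lemma computable_dropc: "computable f \<Longrightarrow> computable g \<Longrightarrow> computable (\<lambda>e. dropc (f e) (g e))"
  unfolding dropc_def
  by (intro computable_rec_nat computable_psnd computable_diff computable_const computable_id)

lemma computable_nthc: "computable f \<Longrightarrow> computable g \<Longrightarrow> computable (\<lambda>e. nthc (f e) (g e))"
  unfolding nthc_def by (intro computable_pfst computable_diff computable_const computable_dropc)

lemma computable_lenc: "computable f \<Longrightarrow> computable (\<lambda>e. lenc (f e))"
proof (rule computable_comp[of lenc])
  have "computable (\<lambda>c. LEAST i. dropc c i = 0)"
  proof (rule computable_least)
    show "\<exists>i. dropc c i = 0" for c
      by (rule exI[of _ "lenc c"]) (metis drop_all lenc_def le_refl list_decode_dropc list_decode_inverse list_encode.simps(1))
  qed (intro computable_dropc computable_pfst computable_psnd computable_id)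
  then show "computable lenc" by (simp add: lenc_eq[abs_def])
qed

text \<open>The largest code of a list of at most l entries bounded by m. It makes quantifiers over
  short words and over runs numerically bounded.\<close>

definition repc :: "nat \<Rightarrow> nat \<Rightarrow> nat" where "repc m l = list_encode (replicate l m)"

lemma repc_rec: "repc m l = rec_nat 0 (\<lambda>_ r. Suc (pe m r)) l"
  by (induction l) (simp_all add: repc_def)

lemma computable_repc: "computable f \<Longrightarrow> computable g \<Longrightarrow> computable (\<lambda>e. repc (f e) (g e))"
proof (rule computable_comp2[of repc])
  show "computable (\<lambda>p. repc (pfst p) (psnd p))" unfolding repc_rec
    by (intro computable_rec_nat computable_Suc computable_prod_encode computable_pfst computable_psnd
          computable_const computable_id)
qed

lemma prod_encode_mono: "a \<le> a' \<Longrightarrow> b \<le> b' \<Longrightarrow> pe a b \<le> pe a' b'"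
  unfolding prod_encode_def by (simp add: add_mono triangle_mono)

lemma list_encode_le_repc: "length xs \<le> l \<Longrightarrow> (\<And>x. x \<in> set xs \<Longrightarrow> x \<le> m) \<Longrightarrow> list_encode xs \<le> repc m l"
proof (induction xs arbitrary: l)
  case (Cons x xs)
  then obtain l' where l: "l = Suc l'" "length xs \<le> l'" by (cases l) auto
  with Cons show ?case by (simp add: repc_def prod_encode_mono)
qed simp

lemma le_repc: "l \<le> repc m l"
proof (induction l)
  case (Suc l)
  have "repc m l \<le> pe m (repc m l)" by (rule le_prod_encode_2)
  with Suc show ?case by (simp add: repc_def)
qed simp

lemma mem_list_decode_less: "x \<in> set (list_decode c) \<Longrightarrow> x < c"
proof (induction c rule: list_decode.induct)
  case (2 n)
  have "pfst n \<le> n" "psnd n \<le> n"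
    using le_prod_encode_1[of "pfst n" "psnd n"] le_prod_encode_2[of "psnd n" "pfst n"] by simp_all
  with 2 show ?case by (auto simp: prod_decode_eq less_Suc_eq_le)
qed simp

definition memc :: "nat \<Rightarrow> nat \<Rightarrow> bool" where "memc x c \<longleftrightarrow> (\<exists>i<lenc c. nthc c i = x)"

lemma memc: "memc x c \<longleftrightarrow> x \<in> set (list_decode c)"
  by (auto simp: memc_def nthc in_set_conv_nth lenc_def[symmetric])

lemmas computable_intros =
  computable_id computable_const computable_Suc computable_add computable_mult computable_diff computable_power
  computable_prod_encode computable_pfst computable_psnd computable_if computable_card
  computable_nthc computable_lenc computable_repc
  decidable_not decidable_conj decidable_disj decidable_imp decidable_less decidable_le decidable_eq
  decidable_bex decidable_ball

lemma decidable_memc: "computable f \<Longrightarrow> computable g \<Longrightarrow> decidable (\<lambda>e. memc (f e) (g e))"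
proof (rule decidable_comp2[of memc])
  show "decidable (\<lambda>p. memc (pfst p) (psnd p))" unfolding memc_def by (intro computable_intros)
qed

text \<open>The automaton has code c, the input has length l and its letters have the codes f 0, ..., f (l - 1).
  States are at most c, which bounds the code r of the list of states along an accepting run.\<close>
definition accepts_code :: "nat \<Rightarrow> nat \<Rightarrow> (nat \<Rightarrow> nat) \<Rightarrow> bool" where
  "accepts_code c l f \<longleftrightarrow> (\<exists>r<Suc (repc c (Suc l)). lenc r = Suc l \<and> memc (nthc r 0) (pfst c) \<and>
     memc (nthc r l) (pfst (psnd c)) \<and>
     (\<forall>i<l. memc (pe (nthc r i) (pe (f i) (nthc r (Suc i)))) (psnd (psnd c))))"

lemma decidable_accepts_code:
  assumes "computable c" "computable l" "computable (\<lambda>p. f (pfst p) (psnd p))"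
  shows "decidable (\<lambda>e. accepts_code (c e) (l e) (f e))"
  unfolding accepts_code_def
  by (intro computable_intros decidable_memc computable_comp[OF assms(1)] computable_comp[OF assms(2)]
        assms(1,2) computable_comp2[OF assms(3)])

lemma nfa_path_iff_states:
  "nfa_path tr q w q' \<longleftrightarrow> (\<exists>r. length r = Suc (length w) \<and> r ! 0 = q \<and> r ! length w = q' \<and>
     (\<forall>i<length w. (r ! i, w ! i, r ! Suc i) \<in> set tr))"
proof (induction w arbitrary: q)
  case Nil
  show ?case by (auto intro: exI[of _ "[q]"] simp: length_Suc_conv)
next
  case (Cons a w)
  show ?case
  proof
    assume "nfa_path tr q (a # w) q'"
    then obtain q1 where q1: "(q, a, q1) \<in> set tr" "nfa_path tr q1 w q'" by auto
    then obtain r where r: "length r = Suc (length w)" "r ! 0 = q1" "r ! length w = q'"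
      "\<forall>i<length w. (r ! i, w ! i, r ! Suc i) \<in> set tr" using Cons.IH by blast
    have "((q # r) ! i, (a # w) ! i, (q # r) ! Suc i) \<in> set tr" if "i < length (a # w)" for i
      using that q1(1) r by (cases i) auto
    then show "\<exists>r. length r = Suc (length (a # w)) \<and> r ! 0 = q \<and> r ! length (a # w) = q' \<and>
       (\<forall>i<length (a # w). (r ! i, (a # w) ! i, r ! Suc i) \<in> set tr)"
      using r by (intro exI[of _ "q # r"]) auto
  next
    assume "\<exists>r. length r = Suc (length (a # w)) \<and> r ! 0 = q \<and> r ! length (a # w) = q' \<and>
       (\<forall>i<length (a # w). (r ! i, (a # w) ! i, r ! Suc i) \<in> set tr)"
    then obtain r where r: "length r = Suc (length (a # w))" "r ! 0 = q" "r ! length (a # w) = q'"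
       "\<forall>i<length (a # w). (r ! i, (a # w) ! i, r ! Suc i) \<in> set tr" by blast
    then obtain r' where r': "r = q # r'" by (cases r) auto
    have "(q, a, r' ! 0) \<in> set tr" using r(4) r' by force
    moreover have "\<forall>i<length w. (r' ! i, w ! i, r' ! Suc i) \<in> set tr" using r(4) r' by force
    then have "nfa_path tr (r' ! 0) w q'" unfolding Cons.IH using r r' by (intro exI[of _ r']) auto
    ultimately show "nfa_path tr q (a # w) q'" by auto
  qed
qed

lemma dec_nfa_eq: "dec_nfa dl c = NFA (list_decode (pfst c)) (list_decode (pfst (psnd c)))
   (map (\<lambda>m. (pfst m, dl (pfst (psnd m)), psnd (psnd m))) (list_decode (psnd (psnd c))))"
  by (simp add: dec_nfa_def prod_decode_eq)

text \<open>Injectivity of \<open>dl\<close> allows letters to be compared through their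
  codes.\<close>

lemma accepts_code:
  assumes "inj dl" "length w = l" "\<And>i. i < l \<Longrightarrow> w ! i = dl (f i)"
  shows "nfa_accepts (dec_nfa dl c) w \<longleftrightarrow> accepts_code c l f"
proof -
  let ?tr = "map (\<lambda>m. (pfst m, dl (pfst (psnd m)), psnd (psnd m))) (list_decode (psnd (psnd c)))"
  have tr: "(q, dl x, q') \<in> set ?tr \<longleftrightarrow> pe q (pe x q') \<in> set (list_decode (psnd (psnd c)))" for q x q'
  proof -
    have "(q, dl x, q') = (pfst m, dl (pfst (psnd m)), psnd (psnd m)) \<longleftrightarrow> m = pe q (pe x q')" for m
      using assms(1) by (auto simp: inj_eq) 
    then show ?thesis by (auto simp: image_iff)
  qed
  have c: "pfst c \<le> c" "psnd c \<le> c" for c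
    using le_prod_encode_1[of "pfst c" "psnd c"] le_prod_encode_2[of "psnd c" "pfst c"] by simp_all
  define valid where "valid r \<longleftrightarrow> length r = Suc l \<and> r ! 0 \<in> set (list_decode (pfst c)) \<and>
     r ! l \<in> set (list_decode (pfst (psnd c))) \<and>
     (\<forall>i<l. pe (r ! i) (pe (f i) (r ! Suc i)) \<in> set (list_decode (psnd (psnd c))))" for r
  have "nfa_accepts (dec_nfa dl c) w \<longleftrightarrow> (\<exists>q\<in>set (list_decode (pfst c)). \<exists>q'\<in>set (list_decode (pfst (psnd c))).
      nfa_path ?tr q w q')"
    by (auto simp: dec_nfa_eq nfa_reach_iff_path disjoint_iff)
  also have "\<dots> \<longleftrightarrow> (\<exists>r. length r = Suc l \<and> r ! 0 \<in> set (list_decode (pfst c)) \<and>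
     r ! l \<in> set (list_decode (pfst (psnd c))) \<and> (\<forall>i<l. (r ! i, w ! i, r ! Suc i) \<in> set ?tr))"
    unfolding nfa_path_iff_states assms(2) by blast
  also have "\<dots> \<longleftrightarrow> (\<exists>r. valid r)"
    unfolding valid_def using assms(3) tr by (intro ex_cong1 conj_cong refl all_cong imp_cong) (auto simp del: set_map)
  also have "\<dots> \<longleftrightarrow> (\<exists>n. valid (list_decode n))" by (metis list_encode_inverse)
  also have "\<dots> \<longleftrightarrow> (\<exists>n<Suc (repc c (Suc l)). valid (list_decode n))"
  proof -
    have "n < Suc (repc c (Suc l))" if v: "valid (list_decode n)" for n
    proof -
      let ?r = "list_decode n"
      have len: "length ?r = Suc l" using v by (simp add: valid_def)
      \<comment> \<open>The first state of a run is initial and every later one is the target of a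
        transition; both are parts of codes inside c.\<close>
      have "x \<le> c" if x: "x \<in> set ?r" for x
      proof -
        obtain i where i: "i < Suc l" "x = ?r ! i" using x len by (metis in_set_conv_nth)
        show ?thesis
        proof (cases i)
          case 0
          then have "x \<in> set (list_decode (pfst c))" using i v by (simp add: valid_def)
          from mem_list_decode_less[OF this] c[of c] show ?thesis by linarith
        next
          case (Suc i')
          let ?m = "pe (?r ! i') (pe (f i') x)"
          have "?m \<in> set (list_decode (psnd (psnd c)))" using i v Suc by (auto simp: valid_def)
          from mem_list_decode_less[OF this] c[of c] c[of "psnd c"] c(2)[of ?m] c(2)[of "psnd ?m"]
          show ?thesis by simp
        qed
      qed
      then have "list_encode ?r \<le> repc c (Suc l)" using len by (intro list_encode_le_repc) auto
      then show ?thesis by simp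
    qed
    then show ?thesis by blast
  qed
  also have "\<dots> \<longleftrightarrow> accepts_code c l f"
  proof -
    have "valid (list_decode n) \<longleftrightarrow> lenc n = Suc l \<and> memc (nthc n 0) (pfst c) \<and>
       memc (nthc n l) (pfst (psnd c)) \<and>
       (\<forall>i<l. memc (pe (nthc n i) (pe (f i) (nthc n (Suc i)))) (psnd (psnd c)))" for n
      unfolding valid_def memc lenc_def[symmetric] by (rule conj_cong[OF refl]) (simp add: nthc)
    then show ?thesis by (simp add: accepts_code_def)
  qed
  finally show ?thesis .
qed

definition in_dom :: "nat \<Rightarrow> nat \<Rightarrow> bool" where
  "in_dom a u \<longleftrightarrow> (\<forall>i<lenc u. nthc u i < pfst a) \<and> accepts_code (pfst (psnd a)) (lenc u) (nthc u)"

text \<open>The successor matches \<open>dec_opt\<close>, for which 0 is the padding symbol.\<close>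

definition letter_at :: "nat \<Rightarrow> nat \<Rightarrow> nat" where
  "letter_at u i = (if i < lenc u then Suc (nthc u i) else 0)"

definition in_rel :: "nat \<Rightarrow> nat \<Rightarrow> nat \<Rightarrow> bool" where
  "in_rel a u v \<longleftrightarrow> in_dom a u \<and> in_dom a v \<and>
     accepts_code (psnd (psnd a)) (if lenc u \<le> lenc v then lenc v else lenc u) (\<lambda>i. pe (letter_at u i) (letter_at v i))"

lemma decidable_in_dom: "computable f \<Longrightarrow> computable g \<Longrightarrow> decidable (\<lambda>e. in_dom (f e) (g e))"
proof (rule decidable_comp2[of in_dom])
  show "decidable (\<lambda>p. in_dom (pfst p) (psnd p))" unfolding in_dom_def
    by (intro computable_intros decidable_accepts_code)
qed

lemma computable_letter_at: "computable f \<Longrightarrow> computable g \<Longrightarrow> computable (\<lambda>e. letter_at (f e) (g e))"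
proof (rule computable_comp2[of letter_at])
  show "computable (\<lambda>p. letter_at (pfst p) (psnd p))" unfolding letter_at_def
    by (intro computable_intros)
qed

lemma decidable_in_rel:
  assumes "computable f" "computable g" "computable h"
  shows "decidable (\<lambda>e. in_rel (f e) (g e) (h e))"
proof -
  have "decidable (\<lambda>p. in_rel (pfst p) (pfst (psnd p)) (psnd (psnd p)))" unfolding in_rel_def
    by (intro computable_intros decidable_accepts_code decidable_in_dom computable_letter_at)
  from decidable_comp2[of "\<lambda>a q. in_rel a (pfst q) (psnd q)", OF this assms(1) computable_prod_encode[OF assms(2,3)]]
  show ?thesis by simp
qed

lemma inj_dec_letter2: "inj dec_letter2"
proof (rule injI)
  have inj: "x = y" if "dec_opt x = dec_opt y" for x y using that by (cases x; cases y) auto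
  fix m n assume "dec_letter2 m = dec_letter2 n"
  then have "pfst m = pfst n" "psnd m = psnd n" by (auto simp: dec_letter2_def prod_decode_eq intro: inj)
  then show "m = n" by (metis prod_encode_pfst_psnd)
qed

lemma dec_pres_eq: "dec_pres a = Pres (pfst a) (dec_nfa id (pfst (psnd a))) (dec_nfa dec_letter2 (psnd (psnd a)))"
  by (simp add: dec_pres_def prod_decode_eq)

lemma in_dom: "in_dom a u \<longleftrightarrow> list_decode u \<in> pres_dom (dec_pres a)"
proof -
  have "nfa_accepts (dec_nfa id (pfst (psnd a))) (list_decode u) \<longleftrightarrow> accepts_code (pfst (psnd a)) (lenc u) (nthc u)"
    by (rule accepts_code) (auto simp: lenc_def[symmetric] nthc)
  moreover have "set (list_decode u) \<subseteq> {..<pfst a} \<longleftrightarrow> (\<forall>i<lenc u. nthc u i < pfst a)"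
    by (auto simp: nthc lenc_def[symmetric] subset_iff in_set_conv_nth)
  ultimately show ?thesis by (simp add: dec_pres_eq in_dom_def)
qed

lemma in_rel: "in_rel a u v \<longleftrightarrow> (list_decode u, list_decode v) \<in> pres_rel (dec_pres a)"
proof -
  have "nfa_accepts (dec_nfa dec_letter2 (psnd (psnd a))) (conv2 (list_decode u) (list_decode v)) \<longleftrightarrow>
    accepts_code (psnd (psnd a)) (if lenc u \<le> lenc v then lenc v else lenc u) (\<lambda>i. pe (letter_at u i) (letter_at v i))"
    (is "_ \<longleftrightarrow> accepts_code _ ?l _")
  proof (rule accepts_code[OF inj_dec_letter2])
    show len: "length (conv2 (list_decode u) (list_decode v)) = ?l" by (simp add: lenc_def max_def)
    fix i assume "i < ?l"
    then have "i < max (length (list_decode u)) (length (list_decode v))" using len by simp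
    then show "conv2 (list_decode u) (list_decode v) ! i = dec_letter2 (pe (letter_at u i) (letter_at v i))"
      by (simp add: nth_conv2 dec_letter2_def letter_at_def lenc_def[symmetric] nthc)
  qed
  moreover have "(list_decode u, list_decode v) \<in> pres_rel (dec_pres a) \<longleftrightarrow> in_dom a u \<and> in_dom a v \<and>
    nfa_accepts (dec_nfa dec_letter2 (psnd (psnd a))) (conv2 (list_decode u) (list_decode v))"
    unfolding in_dom by (simp add: dec_pres_eq)
  ultimately show ?thesis by (simp add: in_rel_def)
qed

section \<open>Membership in the class\<close>

text \<open>States of both automata of the presentation with code a are at most a.\<close>
definition pump_const :: "nat \<Rightarrow> nat" where "pump_const a = 4 ^ Suc a"

text \<open>The bound on the number of prefix types, with \<open>Suc a\<close> as the number of
  states.\<close>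

definition window :: "nat \<Rightarrow> nat \<Rightarrow> nat" where
  "window a m = 2 ^ Suc a * (m + 2) ^ (2 * 4 ^ Suc a)"

text \<open>Lies above the codes of all words over the alphabet up to the end of the pumping window
  for the class of u.\<close>

definition class_bound :: "nat \<Rightarrow> nat \<Rightarrow> nat" where
  "class_bound a u = Suc (repc (pfst a) (lenc u + 2 * pump_const a))"

text \<open>The value 0 for an infinite class agrees with \<open>card\<close>, so infinite classes
  are handled as size 0 throughout.\<close>

definition class_card :: "nat \<Rightarrow> nat \<Rightarrow> nat" where
  "class_card a u =
     (if \<exists>v<class_bound a u. in_rel a u v \<and> lenc u + pump_const a < lenc v then 0
      else card {v. v < class_bound a u \<and> in_rel a u v})"

definition is_rep :: "nat \<Rightarrow> nat \<Rightarrow> nat \<Rightarrow> bool" where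
  "is_rep a m u \<longleftrightarrow> in_dom a u \<and> class_card a u = m \<and> (\<forall>v<class_bound a u. in_rel a u v \<longrightarrow> lenc u \<le> lenc v)"

definition no_rep_in_window :: "nat \<Rightarrow> nat \<Rightarrow> nat \<Rightarrow> bool" where
  "no_rep_in_window a m l \<longleftrightarrow> (\<forall>u<Suc (repc (pfst a) (l + window a m)). \<not> (is_rep a m u \<and> l < lenc u))"

text \<open>A class is counted through its member of least code, which makes the count a bounded
  one.\<close>

definition count_classes :: "nat \<Rightarrow> nat \<Rightarrow> nat \<Rightarrow> nat" where
  "count_classes a m N = card {u. u < N \<and> in_dom a u \<and> class_card a u = m \<and> (\<forall>v<u. \<not> in_rel a u v)}"

text \<open>The empty window certifies that l bounds all representatives in b, so the count for b is
  complete, whereas the count for a is only a lower bound. The sum a + b bounds both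
  alphabets.\<close>

definition differ :: "nat \<Rightarrow> nat \<Rightarrow> nat \<Rightarrow> nat \<Rightarrow> bool" where
  "differ a b m l \<longleftrightarrow> no_rep_in_window b m l \<and>
     count_classes b m (Suc (repc (a + b) l)) < count_classes a m (Suc (repc (a + b) l))"

definition not_equiv :: "nat \<Rightarrow> nat \<Rightarrow> nat \<Rightarrow> nat \<Rightarrow> bool" where
  "not_equiv a u v w \<longleftrightarrow> (in_dom a u \<and> \<not> in_rel a u u) \<or> (in_rel a u v \<and> \<not> in_rel a v u) \<or>
     (in_rel a u v \<and> in_rel a v w \<and> \<not> in_rel a u w)"

section \<open>Computability of the search predicates\<close>

lemma decidable_not_equiv:
  assumes "computable f" "computable g" "computable h" "computable k"
  shows "decidable (\<lambda>e. not_equiv (f e) (g e) (h e) (k e))"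
  unfolding not_equiv_def by (intro computable_intros decidable_in_dom decidable_in_rel assms)

lemma computable_pump_const: "computable f \<Longrightarrow> computable (\<lambda>e. pump_const (f e))"
  unfolding pump_const_def by (intro computable_intros)

lemma computable_window: "computable f \<Longrightarrow> computable g \<Longrightarrow> computable (\<lambda>e. window (f e) (g e))"
  unfolding window_def by (intro computable_intros)

lemma computable_class_bound: "computable f \<Longrightarrow> computable g \<Longrightarrow> computable (\<lambda>e. class_bound (f e) (g e))"
  unfolding class_bound_def by (intro computable_intros computable_pump_const)

lemma computable_class_card: "computable f \<Longrightarrow> computable g \<Longrightarrow> computable (\<lambda>e. class_card (f e) (g e))"
proof (rule computable_comp2[of class_card])
  show "computable (\<lambda>p. class_card (pfst p) (psnd p))" unfolding class_card_def
    by (intro computable_intros computable_pump_const computable_class_bound decidable_in_rel)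
qed

lemma decidable_is_rep:
  assumes "computable f" "computable g" "computable h"
  shows "decidable (\<lambda>e. is_rep (f e) (g e) (h e))"
proof -
  have "decidable (\<lambda>p. is_rep (pfst p) (pfst (psnd p)) (psnd (psnd p)))" unfolding is_rep_def
    by (intro computable_intros decidable_in_dom decidable_in_rel computable_class_card computable_class_bound)
  from decidable_comp2[of "\<lambda>a q. is_rep a (pfst q) (psnd q)", OF this assms(1) computable_prod_encode[OF assms(2,3)]]
  show ?thesis by simp
qed

lemma decidable_no_rep_in_window:
  assumes "computable f" "computable g" "computable h"
  shows "decidable (\<lambda>e. no_rep_in_window (f e) (g e) (h e))"
proof -
  have "decidable (\<lambda>p. no_rep_in_window (pfst p) (pfst (psnd p)) (psnd (psnd p)))" unfolding no_rep_in_window_def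
    by (intro computable_intros decidable_is_rep computable_window)
  from decidable_comp2[of "\<lambda>a q. no_rep_in_window a (pfst q) (psnd q)", OF this assms(1) computable_prod_encode[OF assms(2,3)]]
  show ?thesis by simp
qed

lemma computable_count_classes:
  assumes "computable f" "computable g" "computable h"
  shows "computable (\<lambda>e. count_classes (f e) (g e) (h e))"
proof -
  have "computable (\<lambda>p. count_classes (pfst p) (pfst (psnd p)) (psnd (psnd p)))" unfolding count_classes_def
    by (intro computable_intros decidable_in_dom decidable_in_rel computable_class_card)
  from computable_comp2[of "\<lambda>a q. count_classes a (pfst q) (psnd q)", OF this assms(1) computable_prod_encode[OF assms(2,3)]]
  show ?thesis by simp
qed

lemma decidable_differ:
  assumes "computable f" "computable g" "computable h" "computable k"
  shows "decidable (\<lambda>e. differ (f e) (g e) (h e) (k e))"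
  unfolding differ_def
  by (intro computable_intros decidable_no_rep_in_window computable_count_classes assms)

lemma presentation_dec_pres:
  "presentation (pfst a) (list_decode (pfst (pfst (psnd a)))) (list_decode (pfst (psnd (pfst (psnd a)))))
     (map (\<lambda>m. (pfst m, id (pfst (psnd m)), psnd (psnd m))) (list_decode (psnd (psnd (pfst (psnd a))))))
     (list_decode (pfst (psnd (psnd a)))) (list_decode (pfst (psnd (psnd (psnd a)))))
     (map (\<lambda>m. (pfst m, dec_letter2 (pfst (psnd m)), psnd (psnd m))) (list_decode (psnd (psnd (psnd (psnd a))))))
     (Suc a) (dec_pres a)"
proof -
  have c: "pfst c \<le> c" "psnd c \<le> c" for c
    using le_prod_encode_1[of "pfst c" "psnd c"] le_prod_encode_2[of "psnd c" "pfst c"] by simp_all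
  have init: "set (list_decode (pfst d)) \<subseteq> {..<Suc a}" if "d \<le> a" for d
  proof
    fix x assume "x \<in> set (list_decode (pfst d))"
    from mem_list_decode_less[OF this] c[of d] that show "x \<in> {..<Suc a}" by simp
  qed
  have tr: "psnd (psnd m) < Suc a" if "m \<in> set (list_decode (psnd (psnd d)))" "d \<le> a" for m d
    using mem_list_decode_less[OF that(1)] c(2)[of m] c(2)[of "psnd m"] c(2)[of d] c(2)[of "psnd d"] that(2)
    by linarith
  have AD: "pfst (psnd a) \<le> a" and AE: "psnd (psnd a) \<le> a"
    using c[of a] c[of "psnd a"] by linarith+
  show ?thesis
    by unfold_locales
      (use init[OF AD] init[OF AE] tr[OF _ AD] tr[OF _ AE] in \<open>auto simp: dec_pres_eq dec_nfa_eq\<close>)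
qed

section \<open>Correctness of the search predicates\<close>

definition class_of :: "nat \<Rightarrow> nat list \<Rightarrow> nat list set" where
  "class_of a u = pres_rel (dec_pres a) `` {u}"

definition reps :: "nat \<Rightarrow> nat \<Rightarrow> nat list set" where
  "reps a m = {x \<in> pres_dom (dec_pres a). card (class_of a x) = m \<and> (\<forall>v \<in> class_of a x. length x \<le> length v)}"

lemma
  shows class_of_infinite_if_long: "u \<in> pres_dom (dec_pres a) \<Longrightarrow> v \<in> class_of a u \<Longrightarrow>
      length u + pump_const a \<le> length v \<Longrightarrow> infinite (class_of a u)"
    and class_of_infinite_window: "u \<in> pres_dom (dec_pres a) \<Longrightarrow> infinite (class_of a u) \<Longrightarrow>
      \<exists>v \<in> class_of a u. length u + pump_const a < length v \<and> length v \<le> length u + 2 * pump_const a"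
    and reps_gap: "(\<And>x. x \<in> reps a m \<Longrightarrow> \<not> (l < length x \<and> length x \<le> l + window a m)) \<Longrightarrow>
      x \<in> reps a m \<Longrightarrow> length x \<le> l"
proof -
  interpret presentation "pfst a" "list_decode (pfst (pfst (psnd a)))" "list_decode (pfst (psnd (pfst (psnd a))))"
     "map (\<lambda>m. (pfst m, id (pfst (psnd m)), psnd (psnd m))) (list_decode (psnd (psnd (pfst (psnd a)))))"
     "list_decode (pfst (psnd (psnd a)))" "list_decode (pfst (psnd (psnd (psnd a))))"
     "map (\<lambda>m. (pfst m, dec_letter2 (pfst (psnd m)), psnd (psnd m))) (list_decode (psnd (psnd (psnd (psnd a)))))"
     "Suc a" "dec_pres a" by (rule presentation_dec_pres)
  have eq: "reps a m = representatives m" "class_of a u = cls u" for u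
    unfolding reps_def representatives_def class_of_def cls_def by (rule refl)+
  show "u \<in> pres_dom (dec_pres a) \<Longrightarrow> v \<in> class_of a u \<Longrightarrow>
      length u + pump_const a \<le> length v \<Longrightarrow> infinite (class_of a u)"
    unfolding eq pump_const_def by (rule infinite_cls_if_long)
  show "u \<in> pres_dom (dec_pres a) \<Longrightarrow> infinite (class_of a u) \<Longrightarrow>
      \<exists>v \<in> class_of a u. length u + pump_const a < length v \<and> length v \<le> length u + 2 * pump_const a"
    using infinite_cls_iff[of u] unfolding eq pump_const_def by blast
  show "(\<And>x. x \<in> reps a m \<Longrightarrow> \<not> (l < length x \<and> length x \<le> l + window a m)) \<Longrightarrow>
      x \<in> reps a m \<Longrightarrow> length x \<le> l"
    using representatives_gap[of m l "window a m" x] unfolding eq window_def by blast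
qed

lemma code_le_repc:
  assumes "w \<in> pres_dom (dec_pres a)" "length w \<le> l" "pfst a \<le> k"
  shows "list_encode w \<le> repc k l"
proof (rule list_encode_le_repc)
  fix x assume "x \<in> set w"
  then show "x \<le> k" using assms by (auto simp: dec_pres_eq)
qed (rule assms(2))

lemma class_of_subset: "class_of a u \<subseteq> pres_dom (dec_pres a)"
  by (auto simp: class_of_def dec_pres_eq)

text \<open>A finite class has no member beyond the pumping bound, so all its codes lie below
  \<open>class_bound\<close>; an infinite one has a member inside the window.\<close>

lemma class_card:
  assumes "in_dom a u"
  shows "class_card a u = card (class_of a (list_decode u))"
proof -
  let ?C = "class_of a (list_decode u)"
  have u: "list_decode u \<in> pres_dom (dec_pres a)" using assms by (simp add: in_dom)
  have rel: "in_rel a u v \<longleftrightarrow> list_decode v \<in> ?C" for v by (simp add: in_rel class_of_def)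
  have code: "list_encode v < class_bound a u" if "v \<in> ?C" "length v \<le> lenc u + 2 * pump_const a" for v
    unfolding class_bound_def using code_le_repc[OF _ that(2) order.refl] class_of_subset that(1)
    by (auto simp: less_Suc_eq_le)
  have inf: "infinite ?C \<longleftrightarrow> (\<exists>v<class_bound a u. in_rel a u v \<and> lenc u + pump_const a < lenc v)"
  proof
    assume "infinite ?C"
    from class_of_infinite_window[OF u this] obtain v where v: "v \<in> ?C"
      "lenc u + pump_const a < length v" "length v \<le> lenc u + 2 * pump_const a" by (auto simp: lenc_def)
    then show "\<exists>v<class_bound a u. in_rel a u v \<and> lenc u + pump_const a < lenc v"
      using code by (intro exI[of _ "list_encode v"]) (auto simp: rel lenc_def)
  next
    assume "\<exists>v<class_bound a u. in_rel a u v \<and> lenc u + pump_const a < lenc v"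
    then obtain v where "list_decode v \<in> ?C" "lenc u + pump_const a < lenc v" by (auto simp: rel)
    then show "infinite ?C" using class_of_infinite_if_long[OF u] by (auto simp: lenc_def)
  qed
  show ?thesis
  proof (cases "finite ?C")
    case False
    then show ?thesis using inf by (simp add: class_card_def)
  next
    case True
    have "length v \<le> lenc u + 2 * pump_const a" if "v \<in> ?C" for v
      by (cases "length (list_decode u) + pump_const a \<le> length v")
        (use class_of_infinite_if_long[OF u that] True in \<open>auto simp: lenc_def\<close>)
    then have "{v. v < class_bound a u \<and> in_rel a u v} = list_encode ` ?C"
      using code by (auto simp: rel intro!: image_eqI[of _ list_encode "list_decode _"])
    then have "card {v. v < class_bound a u \<and> in_rel a u v} = card ?C"
      using card_image[of list_encode ?C] inj_onI[of ?C list_encode] by (metis list_encode_inverse)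
    moreover have no: "\<not> (\<exists>v<class_bound a u. in_rel a u v \<and> lenc u + pump_const a < lenc v)"
      using inf True by blast
    ultimately show ?thesis by (simp only: class_card_def no if_False)
  qed
qed

lemma is_rep: "is_rep a m u \<longleftrightarrow> list_decode u \<in> reps a m"
proof -
  have "(\<forall>v<class_bound a u. in_rel a u v \<longrightarrow> lenc u \<le> lenc v) \<longleftrightarrow>
      (\<forall>v \<in> class_of a (list_decode u). length (list_decode u) \<le> length v)" (is "?L \<longleftrightarrow> ?R") if "in_dom a u"
  proof
    assume L: ?L
    show ?R
    proof
      fix v assume v: "v \<in> class_of a (list_decode u)"
      show "length (list_decode u) \<le> length v"
      proof (rule ccontr)
        assume "\<not> ?thesis"
        then have short: "length v < lenc u" by (simp add: lenc_def)
        then have "list_encode v \<le> repc (pfst a) (lenc u + 2 * pump_const a)"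
          using class_of_subset v by (intro code_le_repc) auto
        then have "lenc u \<le> lenc (list_encode v)"
          using L v by (auto simp: class_bound_def in_rel class_of_def)
        with short show False by (simp add: lenc_def)
      qed
    qed
  next
    assume ?R
    then show ?L by (auto simp: in_rel class_of_def lenc_def)
  qed
  then show ?thesis using class_card[of a u] by (auto simp: is_rep_def reps_def in_dom[symmetric])
qed

lemma no_rep_in_window:
  assumes "no_rep_in_window a m l" "x \<in> reps a m"
  shows "length x \<le> l"
proof (rule reps_gap[OF _ assms(2)])
  fix x assume x: "x \<in> reps a m"
  show "\<not> (l < length x \<and> length x \<le> l + window a m)"
  proof
    assume l: "l < length x \<and> length x \<le> l + window a m"
    then have "list_encode x \<le> repc (pfst a) (l + window a m)"
      using x by (intro code_le_repc) (auto simp: reps_def)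
    with assms(1) x l show False
      unfolding no_rep_in_window_def is_rep lenc_def by (metis le_imp_less_Suc list_encode_inverse)
  qed
qed

abbreviation classes :: "nat \<Rightarrow> nat \<Rightarrow> nat list set set" where
  "classes a m \<equiv> classes_of_card (pres_dom (dec_pres a)) (pres_rel (dec_pres a)) m"

lemma classes_eq: "classes a m = class_of a ` {u \<in> pres_dom (dec_pres a). card (class_of a u) = m}"
  by (auto simp: classes_of_card_def class_of_def quotient_def)

lemma count_classes:
  assumes eq: "equiv (pres_dom (dec_pres a)) (pres_rel (dec_pres a))"
  shows "count_classes a m N = card {C \<in> classes a m. \<exists>w\<in>C. list_encode w < N}"
    "finite {C \<in> classes a m. \<exists>w\<in>C. list_encode w < N}"
proof -
  let ?U = "{u. u < N \<and> in_dom a u \<and> class_card a u = m \<and> (\<forall>v<u. \<not> in_rel a u v)}"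
  let ?X = "{C \<in> classes a m. \<exists>w\<in>C. list_encode w < N}"
  have rel_sym: "in_rel a u v \<Longrightarrow> in_rel a v u" for u v
    using eq by (auto simp: in_rel equiv_def dest: symD)
  have "bij_betw (\<lambda>u. class_of a (list_decode u)) ?U ?X"
  proof (rule bij_betw_imageI)
    show "inj_on (\<lambda>u. class_of a (list_decode u)) ?U"
    proof (rule inj_onI)
      fix u v assume u: "u \<in> ?U" and v: "v \<in> ?U" and "class_of a (list_decode u) = class_of a (list_decode v)"
      then have "in_rel a u v"
        using eq_equiv_class_iff[OF eq, of "list_decode u" "list_decode v"] by (simp add: in_rel in_dom class_of_def)
      then have "\<not> v < u" "\<not> u < v" using u v rel_sym by blast+
      then show "u = v" by simp
    qed
    show "(\<lambda>u. class_of a (list_decode u)) ` ?U = ?X"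
    proof
      show "(\<lambda>u. class_of a (list_decode u)) ` ?U \<subseteq> ?X"
      proof
        fix C assume "C \<in> (\<lambda>u. class_of a (list_decode u)) ` ?U"
        then obtain u where u: "u \<in> ?U" "C = class_of a (list_decode u)" by blast
        have "list_decode u \<in> C" using equiv_class_self[OF eq] u by (simp add: in_dom class_of_def)
        then have "\<exists>w\<in>C. list_encode w < N" using u by (intro bexI[of _ "list_decode u"]) auto
        then show "C \<in> ?X" using u class_card[of a u] by (auto simp: classes_eq in_dom)
      qed
      show "?X \<subseteq> (\<lambda>u. class_of a (list_decode u)) ` ?U"
      proof
        fix C assume C: "C \<in> ?X"
        then obtain w where w: "w \<in> C" "list_encode w < N" by blast
        \<comment> \<open>The least code of a member is at most that of w, hence below N.\<close>
        define u where "u = (LEAST u. list_decode u \<in> C)"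
        have "list_decode (list_encode w) \<in> C" using w by simp
        then have uC: "list_decode u \<in> C" "u \<le> list_encode w"
          unfolding u_def by (rule LeastI, rule Least_le)
        have min: "list_decode v \<notin> C" if "v < u" for v using that not_less_Least unfolding u_def by blast
        have "C \<in> pres_dom (dec_pres a) // pres_rel (dec_pres a)" "card C = m"
          using C by (auto simp: classes_of_card_def)
        then have CC: "class_of a (list_decode u) = C"
          using equiv_class_of_mem_quotient[OF eq _ uC(1)] by (simp add: class_of_def)
        then have "in_dom a u" using uC(1) C by (auto simp: in_dom classes_eq class_of_def dec_pres_eq)
        moreover have "\<not> in_rel a u v" if "v < u" for v
          using min[OF that] CC by (auto simp: in_rel class_of_def)
        ultimately have "u \<in> ?U" using uC(2) w(2) CC \<open>card C = m\<close> class_card[of a u] by auto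
        with CC show "C \<in> (\<lambda>u. class_of a (list_decode u)) ` ?U" by blast
      qed
    qed
  qed
  moreover have "finite ?U" by simp
  ultimately show "count_classes a m N = card ?X" "finite ?X"
    unfolding count_classes_def by (auto simp: bij_betw_same_card bij_betw_finite)
qed

lemma class_has_rep:
  assumes eq: "equiv (pres_dom (dec_pres a)) (pres_rel (dec_pres a))" and C: "C \<in> classes a m"
  shows "\<exists>x\<in>C. x \<in> reps a m"
proof -
  have CQ: "C \<in> pres_dom (dec_pres a) // pres_rel (dec_pres a)" "card C = m"
    using C by (auto simp: classes_of_card_def)
  from in_quotient_imp_non_empty[OF eq CQ(1)] obtain w where "w \<in> C" by blast
  define x where "x = arg_min length (\<lambda>w. w \<in> C)"
  have x: "x \<in> C" "\<And>v. v \<in> C \<Longrightarrow> length x \<le> length v"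
    using arg_min_nat_lemma[of "\<lambda>w. w \<in> C" w length] \<open>w \<in> C\<close> by (auto simp: x_def)
  have "class_of a x = C" using equiv_class_of_mem_quotient[OF eq CQ(1) x(1)] by (simp add: class_of_def)
  moreover have "x \<in> pres_dom (dec_pres a)" using in_quotient_imp_subset[OF eq CQ(1)] x(1) by blast
  ultimately have "x \<in> reps a m" using x CQ(2) by (auto simp: reps_def)
  with x(1) show ?thesis by blast
qed

lemma pfst_le: "pfst c \<le> c"
  using le_prod_encode_1[of "pfst c" "psnd c"] by simp

text \<open>Every class of size m in b contains a representative, of length at most l and hence of
  code below the bound. So the count for b is exact, and the count for a does not exceed the true
  number if that is finite.\<close>

lemma differ_sound:
  assumes eqa: "equiv (pres_dom (dec_pres a)) (pres_rel (dec_pres a))"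
    and eqb: "equiv (pres_dom (dec_pres b)) (pres_rel (dec_pres b))" and "differ a b m l"
  shows "finite (classes b m) \<and> (infinite (classes a m) \<or> card (classes b m) < card (classes a m))"
proof -
  let ?N = "Suc (repc (a + b) l)"
  have win: "no_rep_in_window b m l" and less: "count_classes b m ?N < count_classes a m ?N"
    using assms(3) by (auto simp: differ_def)
  have "\<exists>w\<in>C. list_encode w < ?N" if "C \<in> classes b m" for C
  proof -
    from class_has_rep[OF eqb that] obtain x where x: "x \<in> C" "x \<in> reps b m" by blast
    have "list_encode x \<le> repc (a + b) l"
      using no_rep_in_window[OF win x(2)] x(2) pfst_le[of b] by (intro code_le_repc[of x b]) (auto simp: reps_def)
    with x(1) show ?thesis by (auto simp: less_Suc_eq_le)
  qed
  then have all: "{C \<in> classes b m. \<exists>w\<in>C. list_encode w < ?N} = classes b m" by blast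
  have b: "finite (classes b m)" "count_classes b m ?N = card (classes b m)"
    using count_classes[OF eqb, of m ?N] unfolding all by auto
  have "count_classes a m ?N \<le> card (classes a m)" if "finite (classes a m)"
    unfolding count_classes(1)[OF eqa] by (rule card_mono[OF that]) blast
  with b less show ?thesis by linarith
qed

lemma differ_complete:
  assumes eqa: "equiv (pres_dom (dec_pres a)) (pres_rel (dec_pres a))"
    and eqb: "equiv (pres_dom (dec_pres b)) (pres_rel (dec_pres b))"
    and fin: "finite (classes b m)" and more: "infinite (classes a m) \<or> card (classes b m) < card (classes a m)"
  shows "\<exists>l. differ a b m l"
proof -
  \<comment> \<open>Finitely many classes of a already outnumber those of b, even if a has
    infinitely many.\<close>
  obtain Y where Y: "Y \<subseteq> classes a m" "finite Y" "card (classes b m) < card Y"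
  proof (cases "finite (classes a m)")
    case True
    with more show ?thesis using that[of "classes a m"] by simp
  next
    case False
    from infinite_arbitrarily_large[OF False, of "Suc (card (classes b m))"] show ?thesis using that by auto
  qed
  have "\<exists>w. w \<in> C" if "C \<in> Y" for C
    using in_quotient_imp_non_empty[OF eqa] that Y(1) by (fastforce simp: classes_of_card_def)
  then obtain w where w: "\<And>C. C \<in> Y \<Longrightarrow> w C \<in> C" by metis
  \<comment> \<open>All representatives of one class are equally long, so any of them supplies the
    bound.\<close>
  have "\<exists>l. \<forall>x\<in>reps b m \<inter> C. length x \<le> l" if C: "C \<in> classes b m" for C
  proof -
    from class_has_rep[OF eqb C] obtain x where x: "x \<in> C" "x \<in> reps b m" by blast
    have "length y \<le> length x" if y: "y \<in> reps b m" "y \<in> C" for y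
    proof -
      have "class_of b y = C" using equiv_class_of_mem_quotient[OF eqb _ y(2)] C
        by (auto simp: class_of_def classes_of_card_def)
      with x y show ?thesis by (auto simp: reps_def)
    qed
    then show ?thesis by blast
  qed
  then obtain len where len: "\<And>C x. C \<in> classes b m \<Longrightarrow> x \<in> reps b m \<Longrightarrow> x \<in> C \<Longrightarrow> length x \<le> len C" by (metis IntI)
  \<comment> \<open>The first sum bounds the representatives of b; the second bounds the codes of
    the chosen members of Y, which \<open>le_repc\<close> places below the search bound.\<close>
  define l where "l = (\<Sum>C\<in>classes b m. len C) + (\<Sum>C\<in>Y. list_encode (w C))"
  let ?N = "Suc (repc (a + b) l)"
  have "length x \<le> l" if x: "x \<in> reps b m" for x
  proof -
    have "class_of b x \<in> classes b m" using x by (auto simp: classes_eq reps_def)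
    moreover have "x \<in> class_of b x" using x equiv_class_self[OF eqb] by (auto simp: class_of_def reps_def)
    ultimately have "length x \<le> len (class_of b x)" using len x by blast
    also have "\<dots> \<le> (\<Sum>C\<in>classes b m. len C)"
      by (rule member_le_sum) (use \<open>class_of b x \<in> classes b m\<close> fin in auto)
    finally show ?thesis by (simp add: l_def)
  qed
  then have "no_rep_in_window b m l" by (auto simp: no_rep_in_window_def is_rep lenc_def not_less)
  moreover have "count_classes b m ?N \<le> card (classes b m)"
    unfolding count_classes(1)[OF eqb] by (rule card_mono[OF fin]) blast
  moreover have "card Y \<le> count_classes a m ?N"
    unfolding count_classes(1)[OF eqa]
  proof (rule card_mono[OF count_classes(2)[OF eqa]])
    have "list_encode (w C) < ?N" if "C \<in> Y" for C
    proof -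
      have "list_encode (w C) \<le> (\<Sum>C\<in>Y. list_encode (w C))"
        by (rule member_le_sum[of C Y]) (use that Y(2) in auto)
      then show ?thesis using le_repc[of l "a + b"] by (simp add: l_def)
    qed
    then show "Y \<subseteq> {C \<in> classes a m. \<exists>w\<in>C. list_encode w < ?N}" using Y(1) w by blast
  qed
  ultimately have "differ a b m l" using Y(3) by (simp add: differ_def)
  then show ?thesis ..
qed

text \<open>Two numbers of classes, finite or infinite, are different iff one of them is finite and
  smaller than the other. One of the two directions of \<open>differ\<close> detects this, and m = 0
  covers the infinite classes.\<close>

lemma pres_iso_iff_not_differ:
  assumes "is_equiv_structure (dec_pres a)" "is_equiv_structure (dec_pres b)"
  shows "pres_iso (dec_pres a) (dec_pres b) \<longleftrightarrow> \<not> (\<exists>m l. differ a b m l \<or> differ b a m l)"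
proof -
  note eq = assms[unfolded is_equiv_structure_def]
  have iso: "pres_iso (dec_pres a) (dec_pres b) \<longleftrightarrow>
    (\<forall>m. (finite (classes a m) \<longleftrightarrow> finite (classes b m)) \<and> card (classes a m) = card (classes b m))"
    unfolding pres_iso_def by (rule equiv_iso_iff_classes) (use eq in auto)
  have "(finite (classes a m) \<longleftrightarrow> finite (classes b m)) \<and> card (classes a m) = card (classes b m) \<longleftrightarrow>
     \<not> (\<exists>l. differ a b m l \<or> differ b a m l)" for m
  proof -
    have 1: "(\<exists>l. differ a b m l) \<longleftrightarrow>
       finite (classes b m) \<and> (infinite (classes a m) \<or> card (classes b m) < card (classes a m))"
      using differ_sound[OF eq] differ_complete[OF eq] by blast
    have 2: "(\<exists>l. differ b a m l) \<longleftrightarrow>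
       finite (classes a m) \<and> (infinite (classes b m) \<or> card (classes a m) < card (classes b m))"
      using differ_sound[OF eq(2,1)] differ_complete[OF eq(2,1)] by blast
    show ?thesis unfolding ex_disj_distrib 1 2 by (cases "finite (classes a m)"; cases "finite (classes b m)") auto
  qed
  then show ?thesis unfolding iso by blast
qed

lemma is_equiv_structure_iff: "is_equiv_structure (dec_pres a) \<longleftrightarrow> \<not> (\<exists>u v w. not_equiv a u v w)"
proof -
  let ?D = "pres_dom (dec_pres a)" and ?r = "pres_rel (dec_pres a)"
  have sub: "?r \<subseteq> ?D \<times> ?D" by (auto simp: dec_pres_eq)
  have dec: "(\<forall>u. list_decode u \<in> ?D \<longrightarrow> (list_decode u, list_decode u) \<in> ?r) \<longleftrightarrow> (\<forall>x. x \<in> ?D \<longrightarrow> (x, x) \<in> ?r)"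
    "(\<forall>u v. (list_decode u, list_decode v) \<in> ?r \<longrightarrow> (list_decode v, list_decode u) \<in> ?r) \<longleftrightarrow>
     (\<forall>x y. (x, y) \<in> ?r \<longrightarrow> (y, x) \<in> ?r)"
    "(\<forall>u v w. (list_decode u, list_decode v) \<in> ?r \<longrightarrow> (list_decode v, list_decode w) \<in> ?r \<longrightarrow>
        (list_decode u, list_decode w) \<in> ?r) \<longleftrightarrow> (\<forall>x y z. (x, y) \<in> ?r \<longrightarrow> (y, z) \<in> ?r \<longrightarrow> (x, z) \<in> ?r)"
    by (metis list_encode_inverse)+
  have "\<not> (\<exists>u v w. not_equiv a u v w) \<longleftrightarrow>
     (\<forall>u. list_decode u \<in> ?D \<longrightarrow> (list_decode u, list_decode u) \<in> ?r) \<and>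
     (\<forall>u v. (list_decode u, list_decode v) \<in> ?r \<longrightarrow> (list_decode v, list_decode u) \<in> ?r) \<and>
     (\<forall>u v w. (list_decode u, list_decode v) \<in> ?r \<longrightarrow> (list_decode v, list_decode w) \<in> ?r \<longrightarrow>
        (list_decode u, list_decode w) \<in> ?r)"
    unfolding not_equiv_def in_dom in_rel by blast
  also have "\<dots> \<longleftrightarrow> (\<forall>x. x \<in> ?D \<longrightarrow> (x, x) \<in> ?r) \<and> (\<forall>x y. (x, y) \<in> ?r \<longrightarrow> (y, x) \<in> ?r) \<and>
     (\<forall>x y z. (x, y) \<in> ?r \<longrightarrow> (y, z) \<in> ?r \<longrightarrow> (x, z) \<in> ?r)"
    unfolding dec ..
  also have "\<dots> \<longleftrightarrow> equiv ?D ?r"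
    using sub by (auto simp: equiv_def refl_on_def sym_def trans_def)
  finally show ?thesis by (simp add: is_equiv_structure_def)
qed

text \<open>The problem demands an equivalence structure only on the left; isomorphism transports
  the axioms, so that class numbers can be compared on both sides.\<close>

lemma is_equiv_structure_iso:
  assumes "is_equiv_structure P" "pres_iso P Q" "\<And>u v. (u, v) \<in> pres_rel Q \<Longrightarrow> u \<in> pres_dom Q \<and> v \<in> pres_dom Q"
  shows "is_equiv_structure Q"
proof -
  obtain f where f: "bij_betw f (pres_dom P) (pres_dom Q)"
    and rel: "\<And>u v. u \<in> pres_dom P \<Longrightarrow> v \<in> pres_dom P \<Longrightarrow> (u, v) \<in> pres_rel P \<longleftrightarrow> (f u, f v) \<in> pres_rel Q"
    using assms(2) by (auto simp: pres_iso_def)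
  have eq: "equiv (pres_dom P) (pres_rel P)" using assms(1) by (simp add: is_equiv_structure_def)
  have pre: "\<exists>x\<in>pres_dom P. y = f x" if "y \<in> pres_dom Q" for y using that f by (auto simp: bij_betw_def)
  have "refl_on (pres_dom Q) (pres_rel Q)"
  proof (rule refl_onI)
    fix y assume "y \<in> pres_dom Q"
    with pre obtain x where "x \<in> pres_dom P" "y = f x" by blast
    then show "(y, y) \<in> pres_rel Q" using rel equiv_class_self[OF eq] by auto
  qed
  moreover have "sym (pres_rel Q)"
  proof (rule symI)
    fix y z assume yz: "(y, z) \<in> pres_rel Q"
    with assms(3) pre obtain x w where "x \<in> pres_dom P" "y = f x" "w \<in> pres_dom P" "z = f w" by metis
    then have "(w, x) \<in> pres_rel P" using yz rel eq by (auto simp: equiv_def dest: symD[of _ x w])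
    then show "(z, y) \<in> pres_rel Q" using rel \<open>x \<in> pres_dom P\<close> \<open>w \<in> pres_dom P\<close> \<open>y = f x\<close> \<open>z = f w\<close> by auto
  qed
  moreover have "Relation.trans (pres_rel Q)"
  proof (rule transI)
    fix y z t assume yz: "(y, z) \<in> pres_rel Q" "(z, t) \<in> pres_rel Q"
    with assms(3) pre obtain x w v where x: "x \<in> pres_dom P" "y = f x" "w \<in> pres_dom P" "z = f w"
      "v \<in> pres_dom P" "t = f v" by metis
    then have "(x, w) \<in> pres_rel P" "(w, v) \<in> pres_rel P" using yz rel by auto
    then have "(x, v) \<in> pres_rel P" using eq by (auto simp: equiv_def dest: transD)
    then show "(y, t) \<in> pres_rel Q" using rel x by auto
  qed
  moreover have "pres_rel Q \<subseteq> pres_dom Q \<times> pres_dom Q" using assms(3) by auto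
  ultimately show ?thesis by (simp add: is_equiv_structure_def equiv_def)
qed

theorem Pi01_equiv_iso_problem: "Pi01 equiv_iso_problem"
proof -
  \<comment> \<open>One search index serves for all failures: it is read as a triple of word codes
    or as a pair of a size and a length bound.\<close>
  define W where "W n i \<longleftrightarrow>
     not_equiv (pfst n) (pfst i) (pfst (psnd i)) (psnd (psnd i)) \<or>
     not_equiv (psnd n) (pfst i) (pfst (psnd i)) (psnd (psnd i)) \<or>
     differ (pfst n) (psnd n) (pfst i) (psnd i) \<or> differ (psnd n) (pfst n) (pfst i) (psnd i)" for n i
  have "decidable (\<lambda>p. W (pfst p) (psnd p))" unfolding W_def
    by (intro computable_intros decidable_not_equiv decidable_differ)
  then have "Sigma01 {n. \<exists>i. W n i}" by (rule Sigma01_exists)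
  moreover have "- equiv_iso_problem = {n. \<exists>i. W n i}"
  proof -
    have "n \<in> equiv_iso_problem \<longleftrightarrow> \<not> (\<exists>i. W n i)" for n
    proof -
      let ?a = "pfst n" and ?b = "psnd n"
      have "(\<exists>i. W n i) \<longleftrightarrow> (\<exists>u v w. not_equiv ?a u v w) \<or> (\<exists>u v w. not_equiv ?b u v w) \<or>
          (\<exists>m l. differ ?a ?b m l \<or> differ ?b ?a m l)" (is "?L \<longleftrightarrow> ?R")
      proof
        assume ?L
        then show ?R unfolding W_def by blast
      next
        assume ?R
        then consider u v w where "not_equiv ?a u v w" | u v w where "not_equiv ?b u v w"
          | m l where "differ ?a ?b m l \<or> differ ?b ?a m l" by blast
        then show ?L
        proof cases
          case (1 u v w)
          then show ?thesis by (intro exI[of _ "pe u (pe v w)"]) (simp add: W_def)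
        next
          case (2 u v w)
          then show ?thesis by (intro exI[of _ "pe u (pe v w)"]) (simp add: W_def)
        next
          case (3 m l)
          then show ?thesis by (intro exI[of _ "pe m l"]) (auto simp: W_def)
        qed
      qed
      also have "\<not> \<dots> \<longleftrightarrow> is_equiv_structure (dec_pres ?a) \<and> is_equiv_structure (dec_pres ?b) \<and>
         pres_iso (dec_pres ?a) (dec_pres ?b)"
        using is_equiv_structure_iff[of ?a] is_equiv_structure_iff[of ?b] pres_iso_iff_not_differ[of ?a ?b] by blast
      also have "\<dots> \<longleftrightarrow> is_equiv_structure (dec_pres ?a) \<and> pres_iso (dec_pres ?a) (dec_pres ?b)"
        using is_equiv_structure_iso[of "dec_pres ?a" "dec_pres ?b"] by (auto simp: dec_pres_eq)
      finally show ?thesis by (simp add: equiv_iso_problem_def prod_decode_eq)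
    qed
    then show ?thesis by blast
  qed
  ultimately show ?thesis by (simp add: Pi01_def)
qed

theorem theorem2:
  shows "Pi01_complete equiv_iso_problem"
  unfolding Pi01_complete_def
  using Pi01_equiv_iso_problem Pi01_reducible_to_equiv_iso_problem by blast

end
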